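(* Let $r, n, m$ be positive integers with $r < n$. The diagonal action of $\mathbb{P}GL(n)$ on $F(1, 2, \dots, r-1, r; n)^m$ is dense if and only if one of the following holds: (1) $m \leq 2$; (2) $r = 1$ and $n \geq m-1$; (3) $m = 3$, $r > 1$, and $n \geq 3r-2$; (4) $m > 3$, $r > 1$, and $n \geq mr-1$.
   Context: Work over an algebraically closed field. Let $V$ be an $n$-dimensional vector space. For integers $0 < k_1 < \cdots < k_r < n$, $F(k_1, \dots, k_r; n)$ denotes the partial flag variety parameterizing flags $W_{k_1} \subset \cdots \subset W_{k_r} \subset V$ of linear subspaces with $\dim W_{k_i} = k_i$; here $F(1,2,\dots,r;n)$ is the case $k_i = i$ for $1 \leq i \leq r$. The group $\mathbb{P}GL(n) = \mathbb{P}GL(V)$ acts on $F(k_1,\dots,k_r;n)$ and hence diagonally on the $m$-fold self-product $F(k_1,\dots,k_r;n)^m$. The action is called dense if it has a (Zariski) dense orbit, and sparse otherwise. *)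

theory Defs
  imports
    "HOL-Analysis.Analysis"
    "HOL-Library.Poly_Mapping"
    "HOL-Computational_Algebra.Polynomial"
    "HOL-Algebra.Group_Action"
begin

text \<open>
  The vector space is \<open>V = k^n\<close>, rendered as \<open>'a ^ 'n\<close> with \<open>CARD('n) = n\<close>. All notions below make
  sense over any field \<open>'a\<close>; the Zariski topology is the classical one on rational points, which is
  the intended notion when \<open>'a\<close> is algebraically closed.
\<close>

section \<open>The projective general linear group\<close>

definition general_linear :: "('a::field ^ 'n ^ 'n) monoid" where
  "general_linear = \<lparr>carrier = {A. invertible A}, monoid.mult = (**), one = mat 1\<rparr>"

definition scalar_matrices :: "('a::field ^ 'n ^ 'n) set" where
  "scalar_matrices = {mat c | c. c \<noteq> 0}"

definition PGL :: "('a::field ^ 'n ^ 'n) set monoid" where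
  "PGL = general_linear Mod scalar_matrices"

lemma group_general_linear: "group (general_linear :: ('a::field ^ 'n ^ 'n) monoid)"
proof (rule groupI)
  fix A :: "'a ^ 'n ^ 'n" assume "A \<in> carrier general_linear"
  then have "invertible A" by (simp add: general_linear_def)
  then obtain B where "A ** B = mat 1" "B ** A = mat 1" by (auto simp: invertible_def)
  then show "\<exists>B\<in>carrier general_linear. B \<otimes>\<^bsub>general_linear\<^esub> A = \<one>\<^bsub>general_linear\<^esub>"
    by (auto simp: general_linear_def invertible_def)
next
  show "\<one>\<^bsub>general_linear\<^esub> \<in> carrier (general_linear :: ('a ^ 'n ^ 'n) monoid)"
    by (auto simp: general_linear_def invertible_def intro: exI[of _ "mat 1"])
qed (auto simp: general_linear_def matrix_mul_assoc invertible_mult)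

lemma mat_mul_mat: "mat c ** (mat d :: 'a::field ^ 'n ^ 'n) = mat (c * d)"
  by (vector matrix_matrix_mult_def mat_def) (auto simp: if_distrib if_distribR cong: if_cong)

lemma mat_mul_commute: "mat c ** (A :: 'a::field ^ 'n ^ 'n) = A ** mat c"
  by (vector matrix_matrix_mult_def mat_def)
     (auto simp: if_distrib if_distribR mult.commute cong: if_cong)

lemma invertible_mat:
  assumes "c \<noteq> 0" shows "invertible (mat c :: 'a::field ^ 'n ^ 'n)"
  unfolding invertible_def
  by (rule exI[of _ "mat (inverse c)"]) (simp add: mat_mul_mat assms)

lemma normal_scalar_matrices:
  "(scalar_matrices :: ('a::field ^ 'n ^ 'n) set) \<lhd> general_linear"
proof -
  interpret G: group "general_linear :: ('a ^ 'n ^ 'n) monoid" by (rule group_general_linear)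
  have inv: "inv\<^bsub>general_linear\<^esub> (mat c) = (mat (inverse c) :: 'a ^ 'n ^ 'n)" if "c \<noteq> 0" for c
    by (rule G.inv_equality)
       (use that in \<open>auto simp: general_linear_def mat_mul_mat invertible_mat\<close>)
  have "subgroup (scalar_matrices :: ('a ^ 'n ^ 'n) set) general_linear"
  proof (rule G.subgroupI)
    show "scalar_matrices \<noteq> ({} :: ('a ^ 'n ^ 'n) set)"
      by (auto simp: scalar_matrices_def intro: exI[of _ 1])
  next
    fix A :: "'a ^ 'n ^ 'n" assume "A \<in> scalar_matrices"
    then obtain c where "A = mat c" "c \<noteq> 0" by (auto simp: scalar_matrices_def)
    then show "inv\<^bsub>general_linear\<^esub> A \<in> scalar_matrices"
      using inv by (auto simp: scalar_matrices_def intro: exI[of _ "inverse c"])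
  next
    fix A B :: "'a ^ 'n ^ 'n" assume "A \<in> scalar_matrices" "B \<in> scalar_matrices"
    then obtain c d where "A = mat c" "c \<noteq> 0" "B = mat d" "d \<noteq> 0"
      by (auto simp: scalar_matrices_def)
    then show "A \<otimes>\<^bsub>general_linear\<^esub> B \<in> scalar_matrices"
      by (auto simp: scalar_matrices_def general_linear_def mat_mul_mat intro: exI[of _ "c * d"])
  qed (auto simp: scalar_matrices_def general_linear_def invertible_mat)
  then show ?thesis
    by (rule G.normalI)
       (auto simp: r_coset_def l_coset_def scalar_matrices_def general_linear_def mat_mul_commute)
qed

lemma group_PGL: "group (PGL :: ('a::field ^ 'n ^ 'n) set monoid)"
  unfolding PGL_def by (rule normal.factorgroup_is_group[OF normal_scalar_matrices])

text \<open>
  An element of \<^const>\<open>PGL\<close> is a coset \<open>C\<close> of the scalars. All its members map a subspace \<open>W\<close> to the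
  same subspace, so the union below is \<open>g W\<close> for any \<open>g \<in> C\<close>.
\<close>

definition PGL_act :: "('a::field ^ 'n ^ 'n) set \<Rightarrow> ('a ^ 'n) set \<Rightarrow> ('a ^ 'n) set" where
  "PGL_act C W = (\<Union>g\<in>C. (*v) g ` W)"

lemma PGL_act_coset:
  assumes "vec.subspace W"
  shows "PGL_act (scalar_matrices #>\<^bsub>general_linear\<^esub> g) W = (*v) g ` W"
proof -
  have scal: "(mat c ** g) *v x = g *v (c *s x)" for c x
  proof -
    have "mat c *v x = c *s x"
      by (vector matrix_vector_mult_def mat_def) (auto simp: if_distrib if_distribR cong: if_cong)
    then show ?thesis by (metis mat_mul_commute matrix_vector_mul_assoc)
  qed
  have "(mat c ** g) *v x \<in> (*v) g ` W" if "x \<in> W" for c x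
    unfolding scal using that assms by (auto intro: vec.subspace_scale)
  moreover have "\<exists>c. c \<noteq> 0 \<and> g *v x = (mat c ** g) *v x" for x
    by (rule exI[of _ 1]) simp
  ultimately show ?thesis
    unfolding PGL_act_def r_coset_def scalar_matrices_def general_linear_def
    by fastforce
qed


section \<open>Partial flag varieties\<close>

text \<open>
  \<open>partial_flags [k\<^sub>1, \<dots>, k\<^sub>r]\<close> is the set of points of \<open>F(k\<^sub>1, \<dots>, k\<^sub>r; n)\<close>, and
  \<open>flag_power [k\<^sub>1, \<dots>, k\<^sub>r] m\<close> that of its \<open>m\<close>-fold self-product.
\<close>

definition partial_flags :: "nat list \<Rightarrow> ('a::field ^ 'n) set list set" where
  "partial_flags ks = {Ws. length Ws = length ks \<and>
     (\<forall>i<length ks. vec.subspace (Ws ! i) \<and> vec.dim (Ws ! i) = ks ! i) \<and>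
     sorted_wrt (\<subseteq>) Ws}"

definition flag_power :: "nat list \<Rightarrow> nat \<Rightarrow> ('a::field ^ 'n) set list list set" where
  "flag_power ks m = {x. length x = m \<and> set x \<subseteq> partial_flags ks}"

definition diagonal_act ::
    "('a::field ^ 'n ^ 'n) set \<Rightarrow> ('a ^ 'n) set list list \<Rightarrow> ('a ^ 'n) set list list" where
  "diagonal_act C = map (map (PGL_act C))"


section \<open>The Zariski topology\<close>

text \<open>
  The flag variety is embedded in a product of Grassmannians, and these in projective spaces by
  their Pluecker coordinates. For a basis \<open>b\<^sub>1, \<dots>, b\<^sub>k\<close> of \<open>W\<close> and row indices \<open>t\<^sub>1, \<dots>, t\<^sub>k\<close>, the
  coordinate is the minor with rows \<open>t\<^sub>1, \<dots>, t\<^sub>k\<close> of the matrix with columns \<open>b\<^sub>1, \<dots>, b\<^sub>k\<close>. Rather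
  than choosing an order on the index type \<open>'n\<close> and using increasing \<open>t\<close> only, all tuples \<open>t\<close> are
  admitted; the additional coordinates are \<open>0\<close> or agree with the others up to sign, so the
  topology is not affected.
\<close>

definition plucker_coord :: "('a::field ^ 'n) list \<Rightarrow> 'n list \<Rightarrow> 'a" where
  "plucker_coord bs t = (\<Sum>\<sigma> | \<sigma> permutes {..<length bs}.
     of_int (sign \<sigma>) * (\<Prod>i<length bs. (bs ! \<sigma> i) $ (t ! i)))"

definition is_basis_list :: "('a::field ^ 'n) set \<Rightarrow> ('a ^ 'n) list \<Rightarrow> bool" where
  "is_basis_list W bs \<longleftrightarrow> distinct bs \<and> vec.independent (set bs) \<and> vec.span (set bs) = W"

text \<open>
  The variable \<open>(j, i, t)\<close> stands for the Pluecker coordinate with rows \<open>t\<close> of the \<open>i\<close>-th subspace in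
  the \<open>j\<close>-th flag (both counted from \<open>0\<close>).
\<close>

type_synonym 'n plucker_var = "nat \<times> nat \<times> 'n list"

type_synonym ('n, 'a) plucker_poly = "('n plucker_var \<Rightarrow>\<^sub>0 nat) \<Rightarrow>\<^sub>0 'a"

definition plucker_vars :: "nat list \<Rightarrow> nat \<Rightarrow> 'n plucker_var set" where
  "plucker_vars ks m = {(j, i, t). j < m \<and> i < length ks \<and> length t = ks ! i}"

definition multihomogeneous ::
    "nat list \<Rightarrow> nat \<Rightarrow> (nat \<Rightarrow> nat \<Rightarrow> nat) \<Rightarrow> ('n, 'a::field) plucker_poly \<Rightarrow> bool" where
  "multihomogeneous ks m d f \<longleftrightarrow>
     (\<forall>\<mu>\<in>Poly_Mapping.keys f. Poly_Mapping.keys \<mu> \<subseteq> plucker_vars ks m \<and>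
       (\<forall>j<m. \<forall>i<length ks.
          (\<Sum>v | v \<in> Poly_Mapping.keys \<mu> \<and> fst v = j \<and> fst (snd v) = i.
             Poly_Mapping.lookup \<mu> v) = d j i))"

definition eval_poly :: "('v \<Rightarrow> 'a::field) \<Rightarrow> (('v \<Rightarrow>\<^sub>0 nat) \<Rightarrow>\<^sub>0 'a) \<Rightarrow> 'a" where
  "eval_poly p f = (\<Sum>\<mu>\<in>Poly_Mapping.keys f. Poly_Mapping.lookup f \<mu> *
     (\<Prod>v\<in>Poly_Mapping.keys \<mu>. p v ^ Poly_Mapping.lookup \<mu> v))"

text \<open>
  The points of the \<open>m\<close>-fold product at which \<open>f\<close> does not vanish. A change of the bases \<open>B j i\<close>
  rescales the coordinates of each subspace by a nonzero factor, so for multihomogeneous \<open>f\<close> the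
  condition does not depend on \<open>B\<close>.
\<close>

definition nonvanishing ::
    "nat list \<Rightarrow> nat \<Rightarrow> ('n, 'a::field) plucker_poly \<Rightarrow> ('a ^ 'n) set list list set" where
  "nonvanishing ks m f = {x \<in> flag_power ks m.
     \<exists>B. (\<forall>j<m. \<forall>i<length ks. is_basis_list (x ! j ! i) (B j i)) \<and>
         eval_poly (\<lambda>(j, i, t). plucker_coord (B j i) t) f \<noteq> 0}"

definition zariski_topology :: "nat list \<Rightarrow> nat \<Rightarrow> ('a::field ^ 'n) set list list topology" where
  "zariski_topology ks m =
     topology_generated_by {nonvanishing ks m f | f. \<exists>d. multihomogeneous ks m d f}"

lemma ex_basis_list:
  assumes "vec.subspace W"
  shows "\<exists>bs. is_basis_list (W :: ('a::field ^ 'n) set) bs"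
proof -
  obtain S where S: "S \<subseteq> W" "vec.independent S" "W \<subseteq> vec.span S"
    using vec.maximal_independent_subset by blast
  then have "finite S" by (simp add: vec.independent_bound_general)
  then obtain bs where bs: "set bs = S" "distinct bs" using finite_distinct_list by blast
  have "vec.span S = W"
    using S assms by (simp add: subset_antisym vec.span_minimal)
  then show ?thesis using S bs by (auto simp: is_basis_list_def)
qed

lemma topspace_zariski_topology:
  "topspace (zariski_topology ks m) = (flag_power ks m :: ('a::field ^ 'n) set list list set)"
proof -
  let ?one = "Poly_Mapping.single 0 1 :: ('n, 'a) plucker_poly"
  have "nonvanishing ks m ?one = flag_power ks m"
  proof (rule Set.set_eqI)
    fix x :: "('a ^ 'n) set list list"
    show "x \<in> nonvanishing ks m ?one \<longleftrightarrow> x \<in> flag_power ks m"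
    proof
      assume x: "x \<in> flag_power ks m"
      have "is_basis_list (x ! j ! i) (SOME b. is_basis_list (x ! j ! i) b)"
        if "j < m" "i < length ks" for i j
        by (rule someI_ex, rule ex_basis_list)
           (use x that in \<open>force simp: flag_power_def partial_flags_def dest: nth_mem\<close>)
      then show "x \<in> nonvanishing ks m ?one"
        using x unfolding nonvanishing_def eval_poly_def
        by (auto intro!: exI[of _ "\<lambda>j i. SOME b. is_basis_list (x ! j ! i) b"])
    qed (simp add: nonvanishing_def)
  qed
  moreover have "multihomogeneous ks m (\<lambda>_ _. 0) ?one"
    by (simp add: multihomogeneous_def)
  moreover have "nonvanishing ks m f \<subseteq> flag_power ks m" for f :: "('n, 'a) plucker_poly"
    by (auto simp: nonvanishing_def)
  ultimately show ?thesis
    unfolding zariski_topology_def topology_generated_by_topspace by blast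
qed


section \<open>Dense actions\<close>

definition dense_action :: "('g, 'c) monoid_scheme \<Rightarrow> ('g \<Rightarrow> 'b \<Rightarrow> 'b) \<Rightarrow> 'b topology \<Rightarrow> bool" where
  "dense_action G \<phi> X \<longleftrightarrow> (\<exists>x\<in>topspace X. X closure_of (orbit G \<phi> x) = topspace X)"

end

theory Submission
  imports Defs
begin

text \<open>
  \<^bold>\<open>Dense cases.\<close> Represent the flags by adapted vectors \<open>v j i\<close>. If \<open>n \<ge> m r\<close>, generically all of them are
  independent and any two such configurations are conjugate. If \<open>n = m r - 1\<close>, there is one linear
  relation; grouping it by flags, it reads \<open>w 0 + \<dots> + w (m - 1) = 0\<close>, and \<open>w j\<close> can replace the last
  vector of the \<open>j\<close>-th flag. If \<open>m = 3\<close> and \<open>n = 3 r - 2\<close>, the relations form a plane, which is cut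
  by the subspaces of dimension \<open>r - 1\<close> in three lines, and three points of a projective line have a
  normal form. For \<open>m = 2\<close> one intersects the members of the two flags. The orbit of the normal form
  then contains all configurations at which finitely many determinants do not vanish.

  \<^bold>\<open>Sparse cases.\<close> There is a nonconstant invariant rational function made of the determinants
  \<open>[c]\<close> of the first \<open>c j\<close> vectors of each flag, where \<open>c 0 + \<dots> + c (m - 1) = n\<close>. For \<open>m \<ge> 4\<close> and
  \<open>n \<le> m r - 2\<close> it is the cross-ratio of four directions modulo a subspace of dimension \<open>n - 2\<close>
  spanned by members of the flags; for \<open>m = 3\<close> and \<open>n \<le> 3 r - 3\<close> it is the triple ratio of three
  complete flags of a three-dimensional quotient. By Laplace expansion the determinants are
  polynomials in the Pluecker coordinates.
\<close>

section \<open>Pluecker coordinates\<close>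

text \<open>No dimension theory and no irreducibility enters. Flags are lifted to arrays of vectors,
  which form an affine space. On the dense side this makes straight lines available: along them
  every genericity condition is a polynomial in one parameter, and an infinite field has a parameter
  that avoids all zeros. On the sparse side, numerator and denominator get the same degree in every
  subspace, so that their linear combinations define open sets of flags although a single bracket
  depends on the chosen bases. That the quotient is not constant is certified by two arrays of unit
  vectors, at which brackets are read off combinatorially. The number of flags dictates the kind of
  invariant: in a two-dimensional quotient three flags give only three directions, which have no
  invariant, so for \<open>m = 3\<close> a three-dimensional quotient and two steps of each flag are
  used. Determinants are treated by hand because the field may have characteristic 2 and the
  coordinates carry no order.\<close>

definition minor :: "nat \<Rightarrow> (nat \<Rightarrow> 'x \<Rightarrow> 'a::field) \<Rightarrow> 'x list \<Rightarrow> 'a" where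
  "minor k c t = (\<Sum>\<sigma> | \<sigma> permutes {..<k}. of_int (sign \<sigma>) * (\<Prod>i<k. c (\<sigma> i) (t ! i)))"

lemma plucker_coord_minor: "plucker_coord bs t = minor (length bs) (\<lambda>i x. bs ! i $ x) t"
  by (simp add: plucker_coord_def minor_def)

lemma minor_cong:
  assumes "\<And>i j. i < k \<Longrightarrow> j < k \<Longrightarrow> c i (t ! j) = c' i (t' ! j)"
  shows "minor k c t = minor k c' t'"
proof -
  have "(\<Prod>i<k. c (\<sigma> i) (t ! i)) = (\<Prod>i<k. c' (\<sigma> i) (t' ! i))" if "\<sigma> permutes {..<k}" for \<sigma>
    by (rule prod.cong[OF refl]) (use assms permutes_in_image[OF that] in simp)
  then show ?thesis by (simp add: minor_def)
qed

text \<open>Antisymmetry alone would only give \<open>x = - x\<close>, which says nothing in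
  characteristic 2. Instead, composition with the transposition matches the even permutations with
  the odd ones, and the terms cancel in pairs.\<close>

lemma minor_not_distinct:
  assumes "\<And>x. c a x = c b x" "a < k" "b < k" "a \<noteq> b"
  shows "minor k c t = 0"
proof -
  let ?\<tau> = "Transposition.transpose a b"
  have \<tau>: "?\<tau> permutes {..<k}" using assms by (intro permutes_swap_id) auto
  let ?P = "{\<sigma>. \<sigma> permutes {..<k}}"
  let ?f = "\<lambda>\<sigma>. of_int (sign \<sigma>) * (\<Prod>i<k. c (\<sigma> i) (t ! i))"
  let ?E = "{\<sigma>\<in>?P. evenperm \<sigma>}"
  have perm: "permutation \<sigma>" if "\<sigma> \<in> ?P" for \<sigma>
    using that permutation_permutes[of \<sigma>] by blast
  have inv: "?\<tau> \<circ> (?\<tau> \<circ> \<sigma>) = \<sigma>" for \<sigma> :: "nat \<Rightarrow> nat"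
    by (simp add: fun_eq_iff)
  have pt: "permutation ?\<tau>" by (simp add: permutation_swap_id)
  have ev: "evenperm (?\<tau> \<circ> \<sigma>) \<longleftrightarrow> \<not> evenperm \<sigma>" if "\<sigma> \<in> ?P" for \<sigma>
    using evenperm_comp[OF pt perm[OF that]] assms(4) by (simp add: evenperm_swap)
  have "(\<circ>) ?\<tau> ` ?E = {\<sigma>\<in>?P. \<not> evenperm \<sigma>}"
  proof (intro equalityI subsetI)
    fix \<sigma> assume "\<sigma> \<in> {\<sigma>\<in>?P. \<not> evenperm \<sigma>}"
    then have "?\<tau> \<circ> \<sigma> \<in> ?E" using ev \<tau> permutes_compose[of \<sigma> _ ?\<tau>] by simp
    then show "\<sigma> \<in> (\<circ>) ?\<tau> ` ?E" using inv[of \<sigma>] by (metis image_eqI)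
  next
    fix \<sigma> assume "\<sigma> \<in> (\<circ>) ?\<tau> ` ?E"
    then obtain \<rho> where "\<rho> \<in> ?E" "\<sigma> = ?\<tau> \<circ> \<rho>" by blast
    then show "\<sigma> \<in> {\<sigma>\<in>?P. \<not> evenperm \<sigma>}" using ev[of \<rho>] \<tau> permutes_compose[of \<rho> _ ?\<tau>] by simp
  qed
  moreover have "inj_on ((\<circ>) ?\<tau>) ?E" by (rule inj_onI) (metis inv)
  ultimately have "(\<Sum>\<sigma>\<in>{\<sigma>\<in>?P. \<not> evenperm \<sigma>}. ?f \<sigma>) = (\<Sum>\<sigma>\<in>?E. ?f (?\<tau> \<circ> \<sigma>))"
    using sum.reindex[of "(\<circ>) ?\<tau>" ?E ?f] by (simp add: o_def)
  also have "\<dots> = (\<Sum>\<sigma>\<in>?E. - ?f \<sigma>)"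
  proof (rule sum.cong[OF refl])
    fix \<sigma> assume s: "\<sigma> \<in> ?E"
    have "c (?\<tau> (\<sigma> i)) x = c (\<sigma> i) x" for i x using assms by (simp add: Transposition.transpose_def)
    then show "?f (?\<tau> \<circ> \<sigma>) = - ?f \<sigma>" using ev[of \<sigma>] s by (simp add: sign_def)
  qed
  finally have "(\<Sum>\<sigma>\<in>{\<sigma>\<in>?P. \<not> evenperm \<sigma>}. ?f \<sigma>) = - (\<Sum>\<sigma>\<in>?E. ?f \<sigma>)" by (simp add: sum_negf)
  moreover have "sum ?f ?P = sum ?f ?E + (\<Sum>\<sigma>\<in>{\<sigma>\<in>?P. \<not> evenperm \<sigma>}. ?f \<sigma>)"
    using sum.Int_Diff[of ?P ?f "Collect evenperm"]
    by (simp add: finite_permutations Int_def set_diff_eq)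
  ultimately show ?thesis unfolding minor_def by simp
qed

lemma minor_permute:
  assumes "\<tau> permutes {..<k}"
  shows "minor k (\<lambda>i. c (\<tau> i)) t = of_int (sign \<tau>) * minor k c t"
proof -
  let ?P = "{\<sigma>. \<sigma> permutes {..<k}}"
  have "minor k c t = (\<Sum>\<sigma>\<in>?P. of_int (sign (\<tau> \<circ> \<sigma>)) * (\<Prod>i<k. c ((\<tau> \<circ> \<sigma>) i) (t ! i)))"
    unfolding minor_def by (rule setum_permutations_compose_left[OF assms])
  also have "\<dots> = (\<Sum>\<sigma>\<in>?P. of_int (sign \<tau>) * (of_int (sign \<sigma>) * (\<Prod>i<k. c (\<tau> (\<sigma> i)) (t ! i))))"
  proof (rule sum.cong[OF refl])
    fix \<sigma> assume "\<sigma> \<in> ?P"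
    then have "sign (\<tau> \<circ> \<sigma>) = sign \<tau> * sign \<sigma>"
      using assms by (intro sign_compose) (auto simp: permutation_permutes)
    then show "of_int (sign (\<tau> \<circ> \<sigma>)) * (\<Prod>i<k. c ((\<tau> \<circ> \<sigma>) i) (t ! i)) = of_int (sign \<tau>) * (of_int (sign \<sigma>) * (\<Prod>i<k. c (\<tau> (\<sigma> i)) (t ! i)))"
      by simp
  qed
  also have "\<dots> = of_int (sign \<tau>) * minor k (\<lambda>i. c (\<tau> i)) t"
    by (simp add: minor_def sum_distrib_left)
  finally show ?thesis by (simp add: mult.assoc[symmetric] sign_idempotent flip: of_int_mult)
qed

text \<open>Expansions below collect terms by reordering the labels \<open>t\<close>, whereas the
  definition permutes the rows \<open>c\<close>.\<close>

lemma minor_transposed: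
  "minor k c t = (\<Sum>\<sigma> | \<sigma> permutes {..<k}. of_int (sign \<sigma>) * (\<Prod>i<k. c i (t ! \<sigma> i)))"
proof -
  have "minor k c t = (\<Sum>\<sigma> | \<sigma> permutes {..<k}. of_int (sign (inv_into UNIV \<sigma>)) * (\<Prod>i<k. c (inv_into UNIV \<sigma> i) (t ! i)))"
    unfolding minor_def by (rule sum_permutations_inverse)
  also have "\<dots> = (\<Sum>\<sigma> | \<sigma> permutes {..<k}. of_int (sign \<sigma>) * (\<Prod>i<k. c i (t ! \<sigma> i)))"
  proof (rule sum.cong[OF refl])
    fix \<sigma> assume "\<sigma> \<in> {\<sigma>. \<sigma> permutes {..<k}}"
    then have s: "\<sigma> permutes {..<k}" by simp
    have "(\<Prod>i<k. c (inv_into UNIV \<sigma> i) (t ! i)) = (\<Prod>i<k. c (inv_into UNIV \<sigma> (\<sigma> i)) (t ! \<sigma> i))"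
      by (rule prod.permute[OF s, unfolded o_def])
    then show "of_int (sign (inv_into UNIV \<sigma>)) * (\<Prod>i<k. c (inv_into UNIV \<sigma> i) (t ! i)) = of_int (sign \<sigma>) * (\<Prod>i<k. c i (t ! \<sigma> i))"
      using permutes_inverses(2)[OF s] sign_inverse[OF permutes_imp_permutation[OF _ s]] by simp
  qed
  finally show ?thesis .
qed

lemma plucker_coord_not_distinct:
  assumes "\<not> distinct bs" shows "plucker_coord bs t = 0"
proof -
  obtain a b where "a < length bs" "b < length bs" "a \<noteq> b" "bs ! a = bs ! b"
    using assms by (auto simp: distinct_conv_nth)
  then show ?thesis unfolding plucker_coord_minor by (intro minor_not_distinct[of _ a b]) auto
qed

lemma plucker_coord_permute:
  assumes "\<tau> permutes {..<length bs}"
  shows "plucker_coord (map (\<lambda>i. bs ! \<tau> i) [0..<length bs]) t = of_int (sign \<tau>) * plucker_coord bs t"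
proof -
  have "plucker_coord (map (\<lambda>i. bs ! \<tau> i) [0..<length bs]) t = minor (length bs) (\<lambda>i x. bs ! \<tau> i $ x) t"
    unfolding plucker_coord_minor by (auto intro: minor_cong)
  then show ?thesis using minor_permute[OF assms, of "\<lambda>i x. bs ! i $ x"] by (simp add: plucker_coord_minor)
qed

section \<open>Multilinear expansion of Pluecker coordinates\<close>

lemma plucker_coord_linear:
  assumes "v = (\<Sum>x\<in>I. c x *s w x)" "finite I"
  shows "plucker_coord (xs @ v # ys) t = (\<Sum>x\<in>I. c x * plucker_coord (xs @ w x # ys) t)"
proof -
  let ?k = "length (xs @ v # ys)" and ?q = "length xs"
  let ?R = "\<lambda>\<sigma>. (\<Prod>i\<in>{..<?k} - {inv_into UNIV \<sigma> ?q}. ((xs @ v # ys) ! \<sigma> i) $ (t ! i))"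
  have *: "(\<Prod>i<?k. ((xs @ z # ys) ! \<sigma> i) $ (t ! i)) = z $ (t ! inv_into UNIV \<sigma> ?q) * ?R \<sigma>"
    if s: "\<sigma> permutes {..<?k}" for \<sigma> z
  proof -
    have q: "inv_into UNIV \<sigma> ?q \<in> {..<?k}" using permutes_in_image[OF permutes_inv[OF s]] by simp
    have e: "\<sigma> (inv_into UNIV \<sigma> ?q) = ?q" using permutes_inverses(1)[OF s] .
    have ne: "\<sigma> i \<noteq> ?q" if "i \<noteq> inv_into UNIV \<sigma> ?q" for i using that permutes_inverses(2)[OF s] by metis
    have "(xs @ z # ys) ! \<sigma> i = (xs @ v # ys) ! \<sigma> i" if "i \<noteq> inv_into UNIV \<sigma> ?q" for i
      using ne[OF that] by (auto simp: nth_append nth_Cons split: nat.split)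
    then show ?thesis
      by (subst prod.remove[OF _ q]) (auto simp: e intro!: prod.cong)
  qed
  have len: "length (xs @ w x # ys) = ?k" for x by simp
  have "plucker_coord (xs @ v # ys) t = (\<Sum>\<sigma> | \<sigma> permutes {..<?k}. of_int (sign \<sigma>) * ((\<Sum>x\<in>I. c x * w x $ (t ! inv_into UNIV \<sigma> ?q)) * ?R \<sigma>))"
    unfolding plucker_coord_def by (intro sum.cong refl) (simp only: * mem_Collect_eq, simp add: assms)
  also have "\<dots> = (\<Sum>x\<in>I. \<Sum>\<sigma> | \<sigma> permutes {..<?k}. c x * (of_int (sign \<sigma>) * (w x $ (t ! inv_into UNIV \<sigma> ?q) * ?R \<sigma>)))"
    by (subst sum.swap) (simp add: sum_distrib_left sum_distrib_right algebra_simps)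
  also have "\<dots> = (\<Sum>x\<in>I. c x * plucker_coord (xs @ w x # ys) t)"
  proof (rule sum.cong[OF refl])
    fix x
    have "plucker_coord (xs @ w x # ys) t = (\<Sum>\<sigma> | \<sigma> permutes {..<?k}. of_int (sign \<sigma>) * (w x $ (t ! inv_into UNIV \<sigma> ?q) * ?R \<sigma>))"
      unfolding plucker_coord_def by (subst len, subst len, rule sum.cong[OF refl]) (simp only: * mem_Collect_eq)
    then show "(\<Sum>\<sigma> | \<sigma> permutes {..<?k}. c x * (of_int (sign \<sigma>) * (w x $ (t ! inv_into UNIV \<sigma> ?q) * ?R \<sigma>))) = c x * plucker_coord (xs @ w x # ys) t"
      by (simp only: sum_distrib_left)
  qed
  finally show ?thesis .
qed

lemma plucker_coord_multilinear:
  assumes "finite I" "\<And>i. i < length b \<Longrightarrow> b ! i = (\<Sum>x\<in>I. c i x *s w x)"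
  shows "plucker_coord (xs @ b @ ys) t =
    (\<Sum>l | set l \<subseteq> I \<and> length l = length b. (\<Prod>i<length b. c i (l ! i)) * plucker_coord (xs @ map w l @ ys) t)"
  using assms(2)
proof (induction b arbitrary: xs c)
  case Nil
  have "{l. set l \<subseteq> I \<and> length l = 0} = {[]}" by auto
  then show ?case by simp
next
  case (Cons v b)
  have IH: "plucker_coord ((xs @ [w x]) @ b @ ys) t =
    (\<Sum>l | set l \<subseteq> I \<and> length l = length b. (\<Prod>i<length b. c (Suc i) (l ! i)) * plucker_coord ((xs @ [w x]) @ map w l @ ys) t)" for x
    by (rule Cons.IH[of "\<lambda>i. c (Suc i)"]) (use Cons.prems[of "Suc _"] in auto)
  have "plucker_coord (xs @ (v # b) @ ys) t = (\<Sum>x\<in>I. c 0 x * plucker_coord ((xs @ [w x]) @ b @ ys) t)"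
    using plucker_coord_linear[of v "c 0" w I xs "b @ ys" t] Cons.prems[of 0] assms(1) by simp
  also have "\<dots> = (\<Sum>x\<in>I. \<Sum>l | set l \<subseteq> I \<and> length l = length b.
      (\<Prod>i<length (v # b). c i ((x # l) ! i)) * plucker_coord (xs @ map w (x # l) @ ys) t)"
    unfolding IH sum_distrib_left
    by (intro sum.cong refl) (simp add: prod.lessThan_Suc_shift mult.assoc del: prod.lessThan_Suc)
  also have "\<dots> = (\<Sum>(x, l)\<in>I \<times> {l. set l \<subseteq> I \<and> length l = length b}.
      (\<Prod>i<length (v # b). c i ((x # l) ! i)) * plucker_coord (xs @ map w (x # l) @ ys) t)"
    by (rule sum.cartesian_product)
  also have "\<dots> = (\<Sum>l | set l \<subseteq> I \<and> length l = length (v # b). (\<Prod>i<length (v # b). c i (l ! i)) * plucker_coord (xs @ map w l @ ys) t)"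
    by (rule sum.reindex_bij_witness[where j = "\<lambda>(x, l). x # l" and i = "\<lambda>l. (hd l, tl l)"])
       (auto simp: length_Suc_conv)
  finally show ?case .
qed

text \<open>A fixed but arbitrary ordering of each set; it takes the place of increasing tuples of
  coordinates.\<close>

definition enum_list :: "'x set \<Rightarrow> 'x list" where
  "enum_list S = (SOME l. set l = S \<and> distinct l)"

lemma enum_list:
  assumes "finite S"
  shows "set (enum_list S) = S" "distinct (enum_list S)" "length (enum_list S) = card S"
proof -
  have "set (enum_list S) = S \<and> distinct (enum_list S)"
    unfolding enum_list_def using finite_distinct_list[OF assms] by (rule someI_ex)
  then show "set (enum_list S) = S" "distinct (enum_list S)" "length (enum_list S) = card S"
    using distinct_card by fastforce+
qed

lemma sum_over_orderings:
  assumes "distinct L"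
  shows "(\<Sum>l | distinct l \<and> set l = set L. f l) =
    (\<Sum>\<sigma> | \<sigma> permutes {..<length L}. f (map (\<lambda>i. L ! \<sigma> i) [0..<length L]))"
proof -
  let ?g = "\<lambda>\<sigma>. map (\<lambda>i. L ! \<sigma> i) [0..<length L]"
  have pl: "?g \<sigma> = permute_list \<sigma> L" for \<sigma> by (simp add: permute_list_def)
  have "inj_on ?g {\<sigma>. \<sigma> permutes {..<length L}}"
  proof (rule inj_onI)
    fix \<sigma> \<tau> assume s: "\<sigma> \<in> {\<sigma>. \<sigma> permutes {..<length L}}" "\<tau> \<in> {\<sigma>. \<sigma> permutes {..<length L}}"
      and e: "?g \<sigma> = ?g \<tau>"
    have "\<sigma> i = \<tau> i" if "i < length L" for i
    proof -
      have "L ! \<sigma> i = L ! \<tau> i" using e that by auto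
      moreover have "\<sigma> i < length L" "\<tau> i < length L" using s that permutes_in_image by fastforce+
      ultimately show ?thesis using assms nth_eq_iff_index_eq by blast
    qed
    moreover have "\<sigma> i = \<tau> i" if "\<not> i < length L" for i
      using s that by (simp add: permutes_not_in)
    ultimately show "\<sigma> = \<tau>" by blast
  qed
  moreover have "?g ` {\<sigma>. \<sigma> permutes {..<length L}} = {l. distinct l \<and> set l = set L}"
  proof (intro equalityI subsetI)
    fix l assume "l \<in> {l. distinct l \<and> set l = set L}"
    then have "mset l = mset L" using assms set_eq_iff_mset_eq_distinct by blast
    then obtain p where "p permutes {..<length L}" "permute_list p L = l" by (rule mset_eq_permutation)
    then show "l \<in> ?g ` {\<sigma>. \<sigma> permutes {..<length L}}" unfolding pl by blast
  qed (use assms in \<open>auto simp: pl simp del: map_eq_conv\<close>)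
  ultimately show ?thesis by (metis (no_types, lifting) sum.reindex_cong)
qed

text \<open>Lists with a repeated label contribute zero; the others are grouped by their set of
  labels, and the orderings of one set add up to a minor of the coefficients. With \<open>w\<close>
  another basis this is the change of basis, with \<open>w\<close> the images of the unit vectors
  the effect of a matrix, and with \<open>w\<close> the unit vectors and \<open>ys\<close> arbitrary
  it is Laplace expansion. The ordering \<open>e\<close> is left open since different uses need
  different ones.\<close>

lemma plucker_coord_expand:
  assumes "finite I" "\<And>i. i < length b \<Longrightarrow> b ! i = (\<Sum>x\<in>I. c i x *s w x)"
    and "\<And>S. S \<subseteq> I \<Longrightarrow> set (e S) = S \<and> distinct (e S)"
  shows "plucker_coord (b @ ys) t =
    (\<Sum>S | S \<subseteq> I \<and> card S = length b. minor (length b) c (e S) * plucker_coord (map w (e S) @ ys) t)"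
proof -
  let ?k = "length b"
  let ?F = "\<lambda>l. (\<Prod>i<?k. c i (l ! i)) * plucker_coord (map w l @ ys) t"
  have fin: "finite {l. set l \<subseteq> I \<and> length l = ?k}" using assms(1) by (rule finite_lists_length_eq)
  have "plucker_coord (b @ ys) t = (\<Sum>l | set l \<subseteq> I \<and> length l = ?k. ?F l)"
    using plucker_coord_multilinear[OF assms(1,2), where xs = "[]"] by simp
  also have "\<dots> = (\<Sum>l | distinct l \<and> set l \<subseteq> I \<and> length l = ?k. ?F l)"
    by (rule sum.mono_neutral_right[OF fin]) (auto intro!: plucker_coord_not_distinct simp: distinct_map)
  also have "\<dots> = (\<Sum>S | S \<subseteq> I \<and> card S = ?k. \<Sum>l | l \<in> {l. distinct l \<and> set l \<subseteq> I \<and> length l = ?k} \<and> set l = S. ?F l)"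
    by (rule sum.group[symmetric])
       (use assms(1) in \<open>auto simp: distinct_card intro: finite_subset[OF _ fin]\<close>)
  also have "\<dots> = (\<Sum>S | S \<subseteq> I \<and> card S = ?k. minor ?k c (e S) * plucker_coord (map w (e S) @ ys) t)"
  proof (rule sum.cong[OF refl])
    fix S assume "S \<in> {S. S \<subseteq> I \<and> card S = ?k}"
    then have S: "S \<subseteq> I" "card S = ?k" "finite S" using assms(1) finite_subset by auto
    define L where "L = e S"
    have L: "set L = S" "distinct L" "length L = ?k" using assms(3)[OF S(1)] S(2) distinct_card[of L] by (auto simp: L_def)
    have "{l. l \<in> {l. distinct l \<and> set l \<subseteq> I \<and> length l = ?k} \<and> set l = S} = {l. distinct l \<and> set l = set L}"
      using S L by (auto dest: distinct_card)
    then have "(\<Sum>l | l \<in> {l. distinct l \<and> set l \<subseteq> I \<and> length l = ?k} \<and> set l = S. ?F l) =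
      (\<Sum>\<sigma> | \<sigma> permutes {..<?k}. ?F (map (\<lambda>i. L ! \<sigma> i) [0..<?k]))"
      using sum_over_orderings[OF L(2), of ?F] by (simp add: L(3))
    also have "\<dots> = (\<Sum>\<sigma> | \<sigma> permutes {..<?k}. of_int (sign \<sigma>) * (\<Prod>i<?k. c i (L ! \<sigma> i)) * plucker_coord (map w L @ ys) t)"
    proof (rule sum.cong[OF refl])
      fix \<sigma> assume "\<sigma> \<in> {\<sigma>. \<sigma> permutes {..<?k}}"
      then have s: "\<sigma> permutes {..<?k}" by simp
      let ?n = "length (map w L @ ys)"
      have "\<sigma> permutes {..<?n}" by (rule permutes_subset[OF s]) (simp add: L)
      moreover have "map (\<lambda>i. (map w L @ ys) ! \<sigma> i) [0..<?n] = map w (map (\<lambda>i. L ! \<sigma> i) [0..<?k]) @ ys"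
      proof (rule nth_equalityI)
        fix i assume "i < length (map (\<lambda>i. (map w L @ ys) ! \<sigma> i) [0..<?n])"
        then show "map (\<lambda>i. (map w L @ ys) ! \<sigma> i) [0..<?n] ! i = (map w (map (\<lambda>i. L ! \<sigma> i) [0..<?k]) @ ys) ! i"
          using permutes_in_image[OF s, of i] permutes_not_in[OF s, of i] by (auto simp: nth_append L)
      qed (simp add: L)
      ultimately have "plucker_coord (map w (map (\<lambda>i. L ! \<sigma> i) [0..<?k]) @ ys) t = of_int (sign \<sigma>) * plucker_coord (map w L @ ys) t"
        using plucker_coord_permute[of \<sigma> "map w L @ ys" t] by metis
      then show "?F (map (\<lambda>i. L ! \<sigma> i) [0..<?k]) = of_int (sign \<sigma>) * (\<Prod>i<?k. c i (L ! \<sigma> i)) * plucker_coord (map w L @ ys) t"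
        by simp
    qed
    also have "\<dots> = minor ?k c L * plucker_coord (map w L @ ys) t"
      by (simp add: minor_transposed sum_distrib_right)
    finally show "(\<Sum>l | l \<in> {l. distinct l \<and> set l \<subseteq> I \<and> length l = ?k} \<and> set l = S. ?F l) = minor ?k c (e S) * plucker_coord (map w (e S) @ ys) t"
      by (simp add: L_def)
  qed
  finally show ?thesis .
qed

lemma plucker_coord_span:
  assumes "length bs' = length bs" "\<And>v. v \<in> set bs' \<Longrightarrow> v \<in> vec.span (set bs)"
  shows "\<exists>c. \<forall>t. plucker_coord bs' t = c * plucker_coord bs t"
proof -
  let ?k = "length bs"
  have "\<exists>f. v = (\<Sum>l<?k. f l *s bs ! l)" if v: "v \<in> vec.span (set bs)" for v
    using v
  proof (induction rule: vec.span_induct_alt)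
    case base
    show ?case by (rule exI[of _ "\<lambda>_. 0"]) simp
  next
    case (step a x y)
    then obtain f where f: "y = (\<Sum>l<?k. f l *s bs ! l)" by blast
    obtain j where j: "j < ?k" "x = bs ! j" using step by (metis in_set_conv_nth)
    have "a *s x = (\<Sum>l<?k. (if l = j then a else 0) *s bs ! l)"
      using j by (subst sum.remove[of _ j]) auto
    then have "a *s x + y = (\<Sum>l<?k. (f l + (if l = j then a else 0)) *s bs ! l)"
      by (simp only: f vec.scale_left_distrib sum.distrib add.commute)
    then show ?case by (rule exI[of _ "\<lambda>l. f l + (if l = j then a else 0)"])
  qed
  then obtain C where C: "\<And>v. v \<in> vec.span (set bs) \<Longrightarrow> v = (\<Sum>l<?k. C v l *s bs ! l)" by metis
  have *: "plucker_coord bs' t = minor ?k (\<lambda>i. C (bs' ! i)) (sorted_list_of_set {..<?k}) * plucker_coord bs t" for t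
  proof -
    have "plucker_coord (bs' @ []) t =
      (\<Sum>S | S \<subseteq> {..<?k} \<and> card S = length bs'. minor (length bs') (\<lambda>i. C (bs' ! i)) (sorted_list_of_set S) * plucker_coord (map ((!) bs) (sorted_list_of_set S) @ []) t)"
      by (rule plucker_coord_expand) (use C assms in \<open>auto simp: finite_subset[OF _ finite_lessThan]\<close>)
    moreover have "{S. S \<subseteq> {..<?k} \<and> card S = length bs'} = {{..<?k}}"
      using assms(1) card_subset_eq[of "{..<?k}"] by auto
    ultimately show ?thesis using assms(1) by (simp add: lessThan_atLeast0 map_nth)
  qed
  then show ?thesis by blast
qed

lemma plucker_coord_basis_change:
  assumes "is_basis_list W bs" "is_basis_list W bs'"
  shows "\<exists>c. c \<noteq> 0 \<and> (\<forall>t. plucker_coord bs' t = c * plucker_coord bs t)"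
proof -
  have len: "length b = vec.dim W" if "is_basis_list W b" for b
    using that unfolding is_basis_list_def
    by (metis distinct_card vec.dim_span_eq_card_independent)
  have inW: "v \<in> vec.span (set b)" if "v \<in> set b'" "is_basis_list W b" "is_basis_list W b'" for v b b'
    using that unfolding is_basis_list_def using vec.span_base by blast
  obtain c where c: "\<forall>t. plucker_coord bs' t = c * plucker_coord bs t"
    using plucker_coord_span[of bs' bs] len inW assms by metis
  obtain c' where c': "\<forall>t. plucker_coord bs t = c' * plucker_coord bs' t"
    using plucker_coord_span[of bs bs'] len inW assms by metis
  show ?thesis
  \<comment> \<open>If \<open>c = 0\<close>, both lists have only zero coordinates and the factor 1
    serves as well. This avoids showing that some coordinate of a basis is nonzero.\<close>
  proof (cases "c = 0")
    case True
    then have "\<forall>t. plucker_coord bs' t = 1 * plucker_coord bs t" using c c' by simp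
    then show ?thesis using one_neq_zero by blast
  qed (use c in blast)
qed

section \<open>Determinants of full lists of vectors\<close>

definition bracket :: "('a::field ^ 'n::finite) list \<Rightarrow> 'a" where
  "bracket vs = plucker_coord vs (enum_list UNIV)"

lemma vec_expand_axis: "v = (\<Sum>x\<in>UNIV. (v $ x) *s (axis x 1 :: 'a::field^'n))"
  by (simp add: vec_eq_iff axis_def if_distrib cong: if_cong)

lemma matrix_vector_mult_axis: "(A :: 'a::field^'n^'m) *v axis k 1 = column k A"
  by (simp add: matrix_vector_mult_def column_def axis_def vec_eq_iff if_distrib cong: if_cong)

lemma enum_list_finite:
  "set (enum_list S) = (S :: 'n::finite set)" "distinct (enum_list S)" "length (enum_list S) = card S"
  by (simp_all add: enum_list)

text \<open>The complementary minor is kept as a bracket in which unit vectors replace the block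
  \<open>b\<close>, so that the next block can be expanded in the same way.\<close>

lemma bracket_laplace:
  "bracket (b @ ys) =
    (\<Sum>S | card S = length b. plucker_coord b (enum_list S) * bracket (map (\<lambda>x. axis x 1) (enum_list S) @ ys))"
proof -
  have "b ! i = (\<Sum>x\<in>UNIV. (b ! i $ x) *s axis x 1)" for i by (rule vec_expand_axis)
  from plucker_coord_expand[OF finite this, of enum_list ys "enum_list UNIV"] show ?thesis
    by (simp add: bracket_def plucker_coord_minor enum_list_finite)
qed

text \<open>The factor is the determinant of \<open>g\<close>; what matters is that it is the same
  for all \<open>vs\<close>.\<close>

lemma bracket_matrix_vector_mult:
  fixes g :: "'a::field ^ 'n ^ 'n"
  shows "\<exists>c. \<forall>vs. length vs = CARD('n) \<longrightarrow> bracket (map ((*v) g) vs) = c * bracket vs"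
proof (intro exI allI impI)
  fix vs :: "('a ^ 'n) list" assume len: "length vs = CARD('n)"
  have "map ((*v) g) vs ! i = (\<Sum>x\<in>UNIV. (vs ! i $ x) *s (g *v axis x 1))" if "i < length (map ((*v) g) vs)" for i
  proof -
    have "g *v (vs ! i) = (\<Sum>x\<in>UNIV. (vs ! i $ x) *s (g *v axis x 1))"
      by (simp only: matrix_mult_sum[of g "vs ! i"] matrix_vector_mult_axis)
    then show ?thesis using that by simp
  qed
  from plucker_coord_expand[OF finite this, of enum_list "[]" "enum_list UNIV"]
  have "bracket (map ((*v) g) vs) = (\<Sum>S | S \<subseteq> (UNIV::'n set) \<and> card S = length (map ((*v) g) vs).
      minor (length (map ((*v) g) vs)) (\<lambda>i. ($) (vs ! i)) (enum_list S) * plucker_coord (map (\<lambda>x. g *v axis x 1) (enum_list S) @ []) (enum_list UNIV))"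
    by (simp add: bracket_def enum_list_finite)
  moreover have "{S. S \<subseteq> (UNIV::'n set) \<and> card S = length (map ((*v) g) vs)} = {UNIV}"
    using len card_eq_UNIV_imp_eq_UNIV[where 'a = 'n] by auto
  ultimately show "bracket (map ((*v) g) vs) = plucker_coord (map (\<lambda>x. g *v axis x 1) (enum_list UNIV)) (enum_list UNIV) * bracket vs"
    by (simp add: bracket_def plucker_coord_minor)
qed

text \<open>The sign of a cyclic shift depends only on the two lengths, hence a single
  \<open>c\<close> for all lists. A block can thus be moved to the end inside a polynomial identity
  in the remaining vectors.\<close>

lemma plucker_coord_rotate:
  "\<exists>c. \<forall>xs ys :: ('a::field ^ 'n) list. length xs = p \<longrightarrow> length ys = q \<longrightarrow>
     plucker_coord (xs @ ys) t = c * plucker_coord (ys @ xs) t"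
proof (intro exI allI impI)
  fix xs ys :: "('a ^ 'n) list" assume len: "length xs = p" "length ys = q"
  let ?\<tau> = "\<lambda>i. if i < p + q then (i + q) mod (p + q) else i"
  have "bij_betw ?\<tau> {..<p + q} {..<p + q}"
  proof (rule bij_betwI[where g = "\<lambda>i. (i + p) mod (p + q)"])
    fix i assume i: "i \<in> {..<p + q}"
    have "0 < p + q" using i by (simp only: lessThan_iff)
    then have "(i + p) mod (p + q) < p + q" by (rule mod_less_divisor)
    moreover have "(i + (q + p)) mod (p + q) = i" using i by (simp add: add.commute[of q p])
    ultimately show "(?\<tau> i + p) mod (p + q) = i" "?\<tau> ((i + p) mod (p + q)) = i"
      using i by (simp_all add: mod_add_left_eq add.assoc)
  next
    have "(i + k) mod (p + q) \<in> {..<p + q}" if "i \<in> {..<p + q}" for i k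
      using that mod_less_divisor[of "p + q" "i + k"] by (cases "p + q") auto
    then show "?\<tau> \<in> {..<p + q} \<rightarrow> {..<p + q}" "(\<lambda>i. (i + p) mod (p + q)) \<in> {..<p + q} \<rightarrow> {..<p + q}"
      by auto
  qed
  then have "?\<tau> permutes {..<p + q}" by (rule bij_imp_permutes) simp
  then have \<tau>: "?\<tau> permutes {..<length (ys @ xs)}" by (simp add: len add.commute)
  have "map (\<lambda>i. (ys @ xs) ! ?\<tau> i) [0..<length (ys @ xs)] = xs @ ys"
  proof (rule nth_equalityI)
    fix i assume "i < length (map (\<lambda>i. (ys @ xs) ! ?\<tau> i) [0..<length (ys @ xs)])"
    then have i: "i < p + q" by (simp add: len)
    show "map (\<lambda>i. (ys @ xs) ! ?\<tau> i) [0..<length (ys @ xs)] ! i = (xs @ ys) ! i"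
    proof (cases "i < p")
      case True
      then show ?thesis using i len by (simp add: nth_append)
    next
      case False
      then have "(i + q) mod (p + q) = i - p" using i by (simp add: mod_if)
      moreover have "i - p < q" using i False by simp
      ultimately show ?thesis using i False len by (simp add: nth_append)
    qed
  qed (simp add: len)
  then show "plucker_coord (xs @ ys) t = of_int (sign ?\<tau>) * plucker_coord (ys @ xs) t"
    using plucker_coord_permute[OF \<tau>, of t] by simp
qed

lemma bracket_axis:
  fixes l :: "'n::finite list"
  assumes "set l = UNIV" "distinct l"
  shows "bracket (map (\<lambda>x. axis x 1) l) \<noteq> (0 :: 'a::field)"
proof -
  let ?k = "length l" and ?t = "enum_list (UNIV :: 'n set)"
  have "mset ?t = mset l" using assms enum_list_finite[of "UNIV :: 'n set"]
    by (metis set_eq_iff_mset_eq_distinct)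
  then obtain p where p: "p permutes {..<?k}" "permute_list p l = ?t" by (rule mset_eq_permutation)
  have t: "?t ! i = l ! p i" if "i < ?k" for i using p(2) permute_list_nth[OF p(1) that] by simp
  have "(\<Prod>i<?k. (axis (l ! \<sigma> i) 1 :: 'a^'n) $ (?t ! i)) = 0" if s: "\<sigma> permutes {..<?k}" "\<sigma> \<noteq> p" for \<sigma>
  proof -
    obtain i where i: "\<sigma> i \<noteq> p i" using s(2) by blast
    then have "i < ?k" using permutes_not_in[OF s(1), of i] permutes_not_in[OF p(1), of i] by (cases "i < ?k") auto
    moreover have "l ! \<sigma> i \<noteq> l ! p i"
      using i assms(2) \<open>i < ?k\<close> permutes_in_image[OF s(1), of i] permutes_in_image[OF p(1), of i] by (simp add: nth_eq_iff_index_eq)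
    ultimately show ?thesis by (intro prod_zero) (auto simp: t axis_def intro!: bexI[of _ i])
  qed
  moreover have "(\<Prod>i<?k. (axis (l ! p i) 1 :: 'a^'n) $ (?t ! i)) = 1" by (simp add: t axis_def)
  moreover have "(\<Prod>i<?k. (map (\<lambda>x. axis x 1 :: 'a^'n) l ! \<sigma> i) $ (?t ! i)) = (\<Prod>i<?k. (axis (l ! \<sigma> i) 1 :: 'a^'n) $ (?t ! i))"
    if "\<sigma> permutes {..<?k}" for \<sigma>
    by (rule prod.cong[OF refl]) (use permutes_in_image[OF that] in simp)
  ultimately have "(\<Prod>i<?k. (map (\<lambda>x. axis x 1 :: 'a^'n) l ! \<sigma> i) $ (?t ! i)) = (if \<sigma> = p then 1 else 0)"
    if "\<sigma> permutes {..<?k}" for \<sigma>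
    using that by simp
  then have "bracket (map (\<lambda>x. axis x 1 :: 'a^'n) l) =
      (\<Sum>\<sigma> | \<sigma> permutes {..<?k}. if \<sigma> = p then of_int (sign \<sigma>) else 0)"
    unfolding bracket_def plucker_coord_minor minor_def length_map
    by (intro sum.cong) auto
  also have "\<dots> = of_int (sign p)" using p(1) by (simp add: finite_permutations)
  finally show ?thesis by (simp add: sign_def)
qed

section \<open>Multihomogeneous polynomials\<close>

lemma eval_poly_superset:
  assumes "finite A" "Poly_Mapping.keys f \<subseteq> A"
  shows "eval_poly p f = (\<Sum>\<mu>\<in>A. Poly_Mapping.lookup f \<mu> *
     (\<Prod>v\<in>Poly_Mapping.keys \<mu>. p v ^ Poly_Mapping.lookup \<mu> v))"
  unfolding eval_poly_def
  by (rule sum.mono_neutral_left) (use assms in \<open>auto simp: in_keys_iff\<close>)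

lemma monomial_superset:
  assumes "finite A" "Poly_Mapping.keys \<mu> \<subseteq> A"
  shows "(\<Prod>v\<in>Poly_Mapping.keys \<mu>. (p v :: 'a::field) ^ Poly_Mapping.lookup \<mu> v) = (\<Prod>v\<in>A. p v ^ Poly_Mapping.lookup \<mu> v)"
  by (rule prod.mono_neutral_left) (use assms in \<open>auto simp: in_keys_iff\<close>)

lemma eval_poly_add: "eval_poly p (f + g) = eval_poly p f + eval_poly p g"
proof -
  let ?A = "Poly_Mapping.keys f \<union> Poly_Mapping.keys g"
  have "eval_poly p h = (\<Sum>\<mu>\<in>?A. Poly_Mapping.lookup h \<mu> *
     (\<Prod>v\<in>Poly_Mapping.keys \<mu>. p v ^ Poly_Mapping.lookup \<mu> v))" if "Poly_Mapping.keys h \<subseteq> ?A" for h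
    by (rule eval_poly_superset) (use that in auto)
  then show ?thesis using Poly_Mapping.keys_add[of f g]
    by (simp add: lookup_add distrib_right sum.distrib)
qed

lemma eval_poly_single:
  "eval_poly p (Poly_Mapping.single \<mu> c) = c * (\<Prod>v\<in>Poly_Mapping.keys \<mu>. p v ^ Poly_Mapping.lookup \<mu> v)"
  by (subst eval_poly_superset[of "{\<mu>}"]) auto

lemma eval_poly_zero [simp]: "eval_poly p 0 = 0"
  by (simp add: eval_poly_def)

lemma monomial_add:
  "(\<Prod>v\<in>Poly_Mapping.keys (\<mu> + \<nu>). (p v :: 'a::field) ^ Poly_Mapping.lookup (\<mu> + \<nu>) v) =
   (\<Prod>v\<in>Poly_Mapping.keys \<mu>. p v ^ Poly_Mapping.lookup \<mu> v) * (\<Prod>v\<in>Poly_Mapping.keys \<nu>. p v ^ Poly_Mapping.lookup \<nu> v)"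
proof -
  let ?A = "Poly_Mapping.keys \<mu> \<union> Poly_Mapping.keys \<nu>"
  have *: "(\<Prod>v\<in>Poly_Mapping.keys \<rho>. p v ^ Poly_Mapping.lookup \<rho> v) = (\<Prod>v\<in>?A. p v ^ Poly_Mapping.lookup \<rho> v)"
    if "Poly_Mapping.keys \<rho> \<subseteq> ?A" for \<rho>
    by (rule monomial_superset) (use that in auto)
  show ?thesis
    unfolding *[OF Poly_Mapping.keys_add] *[of \<mu>, OF Un_upper1] *[of \<nu>, OF Un_upper2]
    by (simp add: lookup_add power_add prod.distrib)
qed

lemma poly_mapping_additive_induct [case_names zero single add]:
  assumes "P 0" "\<And>\<mu> c. P (Poly_Mapping.single \<mu> c)" "\<And>f g. P f \<Longrightarrow> P g \<Longrightarrow> P (f + g)"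
  shows "P f"
proof (induction f rule: Poly_Mapping.update_induct)
  case const
  then show ?case using assms(1) .
next
  case (update f a b)
  have "Poly_Mapping.update a b f = f + Poly_Mapping.single a b"
    by (rule poly_mapping_eqI)
       (use update(1) in \<open>auto simp: lookup_update lookup_add lookup_single when_def in_keys_iff\<close>)
  then show ?case using assms(2,3) update by simp
qed

lemma eval_poly_mult: "eval_poly p (f * g) = eval_poly p f * eval_poly p g"
proof (induction f rule: poly_mapping_additive_induct)
  case (single \<mu> c)
  show ?case
  proof (induction g rule: poly_mapping_additive_induct)
    case (single \<nu> d)
    then show ?case by (simp add: mult_single eval_poly_single monomial_add)
  qed (simp_all add: eval_poly_add distrib_left)
qed (simp_all add: eval_poly_add distrib_right)

text \<open>Speaks of the function and hides the polynomial: forms can then be assembled from their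
  formulas by closure properties, without naming monomials.\<close>

definition multiform :: "nat list \<Rightarrow> nat \<Rightarrow> (nat \<Rightarrow> nat \<Rightarrow> nat) \<Rightarrow> (('n plucker_var \<Rightarrow> 'a::field) \<Rightarrow> 'a) \<Rightarrow> bool" where
  "multiform ks m d F \<longleftrightarrow> (\<exists>f. multihomogeneous ks m d f \<and> (\<forall>p. F p = eval_poly p f))"

definition multihom_monomial :: "nat list \<Rightarrow> nat \<Rightarrow> (nat \<Rightarrow> nat \<Rightarrow> nat) \<Rightarrow> ('n plucker_var \<Rightarrow>\<^sub>0 nat) \<Rightarrow> bool" where
  "multihom_monomial ks m d \<mu> \<longleftrightarrow> Poly_Mapping.keys \<mu> \<subseteq> plucker_vars ks m \<and>
       (\<forall>j<m. \<forall>i<length ks.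
          (\<Sum>v | v \<in> Poly_Mapping.keys \<mu> \<and> fst v = j \<and> fst (snd v) = i. Poly_Mapping.lookup \<mu> v) = d j i)"

lemma multihomogeneous_monomials:
  "multihomogeneous ks m d f \<longleftrightarrow> (\<forall>\<mu>\<in>Poly_Mapping.keys f. multihom_monomial ks m d \<mu>)"
  by (simp add: multihomogeneous_def multihom_monomial_def)

lemma multihom_monomial_add:
  assumes "multihom_monomial ks m d \<mu>" "multihom_monomial ks m e \<nu>"
  shows "multihom_monomial ks m (\<lambda>j i. d j i + e j i) (\<mu> + \<nu>)"
proof -
  have keys: "Poly_Mapping.keys (\<mu> + \<nu>) \<subseteq> Poly_Mapping.keys \<mu> \<union> Poly_Mapping.keys \<nu>" by (rule Poly_Mapping.keys_add)
  have "(\<Sum>v | v \<in> Poly_Mapping.keys \<rho> \<and> fst v = j \<and> fst (snd v) = i. Poly_Mapping.lookup \<rho> v) =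
    (\<Sum>v | v \<in> Poly_Mapping.keys \<mu> \<union> Poly_Mapping.keys \<nu> \<and> fst v = j \<and> fst (snd v) = i. Poly_Mapping.lookup \<rho> v)"
    if "Poly_Mapping.keys \<rho> \<subseteq> Poly_Mapping.keys \<mu> \<union> Poly_Mapping.keys \<nu>" for \<rho> i j
    by (rule sum.mono_neutral_left) (use that in \<open>auto simp: in_keys_iff\<close>)
  from this[OF keys] this[of \<mu>] this[of \<nu>] show ?thesis
    using assms keys unfolding multihom_monomial_def by (auto simp: lookup_add sum.distrib)
qed

lemma multiform_zero: "multiform ks m d (\<lambda>_. 0)"
  unfolding multiform_def by (rule exI[of _ 0]) (simp add: multihomogeneous_def)

lemma multiform_const: "multiform ks m (\<lambda>_ _. 0) (\<lambda>_. c)"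
  unfolding multiform_def
  by (rule exI[of _ "Poly_Mapping.single 0 c"]) (simp add: multihomogeneous_def eval_poly_single)

lemma multiform_add:
  assumes "multiform ks m d F" "multiform ks m d G"
  shows "multiform ks m d (\<lambda>p. F p + G p)"
proof -
  obtain f g where "multihomogeneous ks m d f" "\<And>p. F p = eval_poly p f"
    "multihomogeneous ks m d g" "\<And>p. G p = eval_poly p g"
    using assms by (auto simp: multiform_def)
  then show ?thesis unfolding multiform_def multihomogeneous_monomials
    using Poly_Mapping.keys_add[of f g] by (intro exI[of _ "f + g"]) (auto simp: eval_poly_add)
qed

lemma multiform_mult:
  assumes "multiform ks m d F" "multiform ks m e G"
  shows "multiform ks m (\<lambda>j i. d j i + e j i) (\<lambda>p. F p * G p)"
proof -
  obtain f g where fg: "multihomogeneous ks m d f" "\<And>p. F p = eval_poly p f"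
    "multihomogeneous ks m e g" "\<And>p. G p = eval_poly p g"
    using assms by (auto simp: multiform_def)
  have "multihomogeneous ks m (\<lambda>j i. d j i + e j i) (f * g)"
    using fg(1,3) Poly_Mapping.keys_mult[of f g] unfolding multihomogeneous_monomials
    by (blast intro: multihom_monomial_add)
  then show ?thesis unfolding multiform_def using fg by (intro exI[of _ "f * g"]) (auto simp: eval_poly_mult)
qed

lemma multiform_cmult:
  assumes "multiform ks m d F" shows "multiform ks m d (\<lambda>p. c * F p)"
  using multiform_mult[OF multiform_const[of ks m c] assms] by simp

lemma multiform_sum:
  assumes "\<And>x. x \<in> A \<Longrightarrow> multiform ks m d (F x)"
  shows "multiform ks m d (\<lambda>p. \<Sum>x\<in>A. F x p)"
  using assms by (induction A rule: infinite_finite_induct) (auto intro: multiform_zero multiform_add)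

lemma multiform_var:
  assumes "(j, i, t) \<in> plucker_vars ks m"
  shows "multiform ks m (\<lambda>j' i'. if j' = j \<and> i' = i then 1 else 0) (\<lambda>p. p (j, i, t))"
proof -
  let ?\<mu> = "Poly_Mapping.single (j, i, t) (1::nat)"
  have "{v. v = (j, i, t) \<and> fst v = j' \<and> fst (snd v) = i'} = (if j' = j \<and> i' = i then {(j, i, t)} else {})" for j' i'
    by auto
  then have "multihom_monomial ks m (\<lambda>j' i'. if j' = j \<and> i' = i then 1 else 0) ?\<mu>"
    using assms by (simp add: multihom_monomial_def)
  then show ?thesis unfolding multiform_def multihomogeneous_monomials
    by (intro exI[of _ "Poly_Mapping.single ?\<mu> 1"]) (auto simp: eval_poly_single)
qed

lemma monomial_scale:
  assumes "multihom_monomial ks m d \<mu>" "\<And>j i t. (j, i, t) \<in> plucker_vars ks m \<Longrightarrow> q (j, i, t) = c j i * p (j, i, t)"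
  shows "(\<Prod>v\<in>Poly_Mapping.keys \<mu>. (q v :: 'a::field) ^ Poly_Mapping.lookup \<mu> v) =
    (\<Prod>(j, i)\<in>{..<m} \<times> {..<length ks}. c j i ^ d j i) * (\<Prod>v\<in>Poly_Mapping.keys \<mu>. p v ^ Poly_Mapping.lookup \<mu> v)"
proof -
  let ?K = "Poly_Mapping.keys \<mu>" and ?e = "Poly_Mapping.lookup \<mu>"
  let ?I = "{..<m} \<times> {..<length ks}"
  let ?h = "\<lambda>v. (fst v, fst (snd v))"
  have K: "?K \<subseteq> plucker_vars ks m" using assms(1) by (simp add: multihom_monomial_def)
  have "q v = c (fst v) (fst (snd v)) * p v" if "v \<in> ?K" for v
    using K that assms(2)[of "fst v" "fst (snd v)" "snd (snd v)"] by auto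
  then have "(\<Prod>v\<in>?K. q v ^ ?e v) = (\<Prod>v\<in>?K. c (fst v) (fst (snd v)) ^ ?e v) * (\<Prod>v\<in>?K. p v ^ ?e v)"
    by (simp add: power_mult_distrib prod.distrib)
  also have "(\<Prod>v\<in>?K. c (fst v) (fst (snd v)) ^ ?e v) =
      (\<Prod>y\<in>?I. \<Prod>v | v \<in> ?K \<and> ?h v = y. c (fst v) (fst (snd v)) ^ ?e v)"
    by (rule prod.group[symmetric]) (use K in \<open>auto simp: plucker_vars_def\<close>)
  also have "\<dots> = (\<Prod>(j, i)\<in>?I. c j i ^ d j i)"
  proof (rule prod.cong[OF refl])
    fix y assume "y \<in> ?I"
    then obtain j i where y: "y = (j, i)" "j < m" "i < length ks" by auto
    have "(\<Prod>v | v \<in> ?K \<and> ?h v = y. c (fst v) (fst (snd v)) ^ ?e v) =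
        (\<Prod>v | v \<in> ?K \<and> fst v = j \<and> fst (snd v) = i. c j i ^ ?e v)"
      using y by (intro prod.cong) auto
    also have "\<dots> = c j i ^ d j i"
      using assms(1) y by (simp add: multihom_monomial_def flip: power_sum)
    finally show "(\<Prod>v | v \<in> ?K \<and> ?h v = y. c (fst v) (fst (snd v)) ^ ?e v) = (case y of (j, i) \<Rightarrow> c j i ^ d j i)"
      using y by simp
  qed
  finally show ?thesis .
qed

text \<open>A change of bases rescales the coordinates of each subspace separately; the scalars
  leave a multihomogeneous polynomial as a common factor.\<close>

lemma multihomogeneous_scale:
  assumes "multihomogeneous ks m d f" "\<And>j i t. (j, i, t) \<in> plucker_vars ks m \<Longrightarrow> q (j, i, t) = c j i * p (j, i, t)"
  shows "eval_poly q f = (\<Prod>(j, i)\<in>{..<m} \<times> {..<length ks}. c j i ^ d j i) * eval_poly p f"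
  unfolding eval_poly_def sum_distrib_left
proof (rule sum.cong[OF refl])
  fix \<mu> assume "\<mu> \<in> Poly_Mapping.keys f"
  then have "multihom_monomial ks m d \<mu>" using assms(1) by (simp add: multihomogeneous_monomials)
  from monomial_scale[OF this, of q c p, OF assms(2)]
  show "Poly_Mapping.lookup f \<mu> * (\<Prod>v\<in>Poly_Mapping.keys \<mu>. q v ^ Poly_Mapping.lookup \<mu> v) =
    (\<Prod>(j, i)\<in>{..<m} \<times> {..<length ks}. c j i ^ d j i) * (Poly_Mapping.lookup f \<mu> * (\<Prod>v\<in>Poly_Mapping.keys \<mu>. p v ^ Poly_Mapping.lookup \<mu> v))"
    by simp
qed

section \<open>Flags given by frames\<close>

definition frame :: "nat \<Rightarrow> (nat \<Rightarrow> 'a::field ^ 'n) \<Rightarrow> bool" where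
  "frame r u \<longleftrightarrow> inj_on u {..<r} \<and> vec.independent (u ` {..<r})"

definition frame_flags :: "nat \<Rightarrow> nat \<Rightarrow> (nat \<Rightarrow> nat \<Rightarrow> 'a::field ^ 'n) \<Rightarrow> ('a ^ 'n) set list list" where
  "frame_flags r m M = map (\<lambda>j. map (\<lambda>i. vec.span (M j ` {..i})) [0..<r]) [0..<m]"

lemma frame_mono: "frame r u \<Longrightarrow> q \<le> r \<Longrightarrow> frame q u"
  unfolding frame_def by (meson image_mono inj_on_subset lessThan_subset_iff vec.independent_mono)

lemma frame_dim: "frame r u \<Longrightarrow> i < r \<Longrightarrow> vec.dim (vec.span (u ` {..i})) = Suc i"
  using frame_mono[of r u "Suc i"]
  by (simp add: frame_def vec.dim_eq_card_independent card_image lessThan_Suc_atMost)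

lemma frame_basis_list:
  "frame r u \<Longrightarrow> i < r \<Longrightarrow> is_basis_list (vec.span (u ` {..i})) (map u [0..<Suc i])"
  using frame_mono[of r u "Suc i"] unfolding is_basis_list_def
  by (auto simp: frame_def distinct_map lessThan_Suc_atMost atLeast0AtMost atLeast0LessThan simp del: upt_Suc)

lemma frame_flags_in_flag_power:
  assumes "\<And>j. j < m \<Longrightarrow> frame r (M j)"
  shows "frame_flags r m M \<in> flag_power [1..<Suc r] m"
proof -
  have "map (\<lambda>i. vec.span (M j ` {..i})) [0..<r] \<in> partial_flags [1..<Suc r]" if "j < m" for j
    unfolding partial_flags_def
    by (auto simp: frame_dim[OF assms[OF that]] sorted_wrt_iff_nth_less vec.subspace_span
        intro!: vec.span_mono image_mono simp del: upt_Suc vec.dim_span)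
  then show ?thesis by (auto simp: flag_power_def frame_flags_def)
qed

lemma frame_fun_upd:
  assumes "frame q u" "w \<notin> vec.span (u ` {..<q})"
  shows "frame (Suc q) (u(q := w))"
proof -
  have "inj_on (u(q := w)) {..<Suc q}"
    using assms vec.span_base[of _ "u ` {..<q}"] by (fastforce simp: frame_def inj_on_def less_Suc_eq)
  moreover have "(u(q := w)) ` {..<Suc q} = insert w (u ` {..<q})" by (auto simp: lessThan_Suc)
  ultimately show ?thesis using assms vec.independent_insertI[of w "u ` {..<q}"] unfolding frame_def
    by simp
qed

lemma partial_flag_frame:
  fixes Ws :: "('a::field ^ 'n) set list"
  assumes "Ws \<in> partial_flags [1..<Suc r]"
  shows "\<exists>u. frame r u \<and> Ws = map (\<lambda>i. vec.span (u ` {..i})) [0..<r]"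
proof -
  have W: "length Ws = r" "\<And>i. i < r \<Longrightarrow> vec.subspace (Ws ! i)" "\<And>i. i < r \<Longrightarrow> vec.dim (Ws ! i) = Suc i"
      "\<And>i j. i < j \<Longrightarrow> j < r \<Longrightarrow> Ws ! i \<subseteq> Ws ! j"
    using assms by (auto simp: partial_flags_def sorted_wrt_iff_nth_less simp del: upt_Suc)
  have "\<exists>u. frame q u \<and> (\<forall>i<q. vec.span (u ` {..i}) = Ws ! i)" if "q \<le> r" for q
    using that
  proof (induction q)
    case 0
    then show ?case by (simp add: frame_def vec.independent_empty)
  next
    case (Suc q)
    then obtain u where u: "frame q u" "\<And>i. i < q \<Longrightarrow> vec.span (u ` {..i}) = Ws ! i" by auto
    have sub: "vec.span (u ` {..<q}) \<subseteq> Ws ! q"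
    proof (cases q)
      case 0
      then show ?thesis using W(2)[of q] Suc.prems by (simp add: vec.subspace_0)
    next
      case (Suc p)
      then have "vec.span (u ` {..<q}) = Ws ! p" using u(2)[of p] by (simp add: lessThan_Suc_atMost)
      then show ?thesis using W(4)[of p q] Suc \<open>Suc q \<le> r\<close> by simp
    qed
    have dim: "vec.dim (vec.span (u ` {..<q})) = q"
      using u(1) by (simp add: frame_def vec.dim_eq_card_independent card_image)
    have "\<not> Ws ! q \<subseteq> vec.span (u ` {..<q})"
      using vec.dim_subset[of "Ws ! q" "vec.span (u ` {..<q})"] dim W(3)[of q] Suc.prems by auto
    then obtain w where w: "w \<in> Ws ! q" "w \<notin> vec.span (u ` {..<q})" by blast
    let ?u = "u(q := w)"
    have fr: "frame (Suc q) ?u" by (rule frame_fun_upd[OF u(1) w(2)])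
    have "?u ` {..q} \<subseteq> Ws ! q"
    proof -
      have "?u ` {..q} = insert w (u ` {..<q})" by (auto simp: atMost_Suc lessThan_Suc_atMost[symmetric] lessThan_Suc)
      moreover have "u ` {..<q} \<subseteq> Ws ! q" using sub vec.span_superset by (rule subset_trans[rotated])
      ultimately show ?thesis using w(1) by simp
    qed
    moreover have "card (?u ` {..q}) = Suc q" "vec.independent (?u ` {..q})"
      using fr card_image[of ?u "{..q}"] card_atMost unfolding frame_def lessThan_Suc_atMost by metis+
    ultimately have "vec.span (?u ` {..q}) = Ws ! q"
      using vec.card_ge_dim_independent[of "?u ` {..q}" "Ws ! q"] vec.span_minimal[of "?u ` {..q}" "Ws ! q"] W(2,3)[of q] Suc.prems
      by (simp add: subset_antisym)
    moreover have "?u ` {..i} = u ` {..i}" if "i < q" for i using that by auto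
    ultimately have "vec.span (?u ` {..i}) = Ws ! i" if "i < Suc q" for i
      using that u(2) by (cases "i = q") auto
    with fr show ?case by (intro exI[of _ ?u] conjI allI impI)
  qed
  from this[OF order_refl] obtain u where "frame r u" "\<And>i. i < r \<Longrightarrow> vec.span (u ` {..i}) = Ws ! i" by auto
  then show ?thesis using W(1) by (intro exI[of _ u]) (auto intro: nth_equalityI)
qed

lemma flag_power_frames:
  assumes "x \<in> flag_power [1..<Suc r] m"
  shows "\<exists>M. (\<forall>j<m. frame r (M j)) \<and> x = frame_flags r m M"
proof -
  have x: "length x = m" "\<And>j. j < m \<Longrightarrow> x ! j \<in> partial_flags [1..<Suc r]"
    using assms by (auto simp: flag_power_def simp del: upt_Suc)
  have "\<forall>j. \<exists>u. j < m \<longrightarrow> frame r u \<and> x ! j = map (\<lambda>i. vec.span (u ` {..i})) [0..<r]"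
    using partial_flag_frame[OF x(2)] by blast
  then obtain M where "\<And>j. j < m \<Longrightarrow> frame r (M j) \<and> x ! j = map (\<lambda>i. vec.span (M j ` {..i})) [0..<r]"
    by metis
  then show ?thesis using x(1) by (intro exI[of _ M]) (auto simp: frame_flags_def intro!: nth_equalityI)
qed

lemma diagonal_act_frame_flags:
  "diagonal_act (scalar_matrices #>\<^bsub>general_linear\<^esub> g) (frame_flags r m M) = frame_flags r m (\<lambda>j i. g *v M j i)"
  by (simp add: diagonal_act_def frame_flags_def PGL_act_coset vec.subspace_span
      vec.linear_span_image[OF matrix_vector_mul_linear_gen, symmetric] image_image o_def)

lemma orbit_frame_flags:
  fixes M :: "nat \<Rightarrow> nat \<Rightarrow> 'a::field ^ 'n"
  shows "orbit PGL diagonal_act (frame_flags r m M) = {frame_flags r m (\<lambda>j i. g *v M j i) | g. invertible g}"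
proof -
  have "carrier PGL = {scalar_matrices #>\<^bsub>general_linear\<^esub> g | g. invertible (g :: 'a ^ 'n ^ 'n)}"
    by (auto simp: PGL_def FactGroup_def RCOSETS_def general_linear_def)
  then show ?thesis
    unfolding orbit_def by (simp add: setcompr_eq_image image_image diagonal_act_frame_flags)
qed

section \<open>Invariants and sparse actions\<close>

text \<open>The fixed vectors \<open>E\<close> make the induction work: after the expansion along the first block, this
  block becomes constant and is moved to the end.\<close>

lemma block_brackets_multiform:
  fixes c :: "nat \<Rightarrow> nat" and E :: "('a::field ^ 'n) list"
  assumes "\<And>j. j \<in> set J \<Longrightarrow> j < m \<and> c j \<le> r"
  shows "\<exists>F. multiform [1..<Suc r] m (\<lambda>j i. if c j = Suc i then count_list J j else 0) F \<and>
    (\<forall>M. bracket (concat (map (\<lambda>j. map (M j) [0..<c j]) J) @ E) = F (\<lambda>(j, i, t). plucker_coord (map (M j) [0..<Suc i]) t))"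
  using assms
proof (induction J arbitrary: E)
  case Nil
  have "(\<lambda>j i. if c j = Suc i then count_list [] j else 0) = (\<lambda>_ _. 0)" by (auto simp: fun_eq_iff)
  then show ?case using multiform_const[of "[1..<Suc r]" m "bracket E"]
    by (intro exI[of _ "\<lambda>_. bracket E"]) (simp del: upt_Suc)
next
  case (Cons j J)
  show ?case
  proof (cases "c j")
    case 0
    have "(\<lambda>j' i. if c j' = Suc i then count_list (j # J) j' else 0) = (\<lambda>j' i. if c j' = Suc i then count_list J j' else 0)"
      using 0 by (auto simp: fun_eq_iff)
    then show ?thesis using Cons.IH[of E] Cons.prems 0 by (simp del: upt_Suc)
  next
    case (Suc i)
    let ?ax = "\<lambda>S :: 'n set. map (\<lambda>x. axis x 1 :: 'a ^ 'n) (enum_list S)"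
    let ?d = "\<lambda>J j i. if c j = Suc i then count_list J j else 0"
    let ?rest = "\<lambda>M. concat (map (\<lambda>j. map (M j) [0..<c j]) J)"
    let ?p = "\<lambda>M :: nat \<Rightarrow> nat \<Rightarrow> 'a ^ 'n. \<lambda>(j, i, t). plucker_coord (map (M j) [0..<Suc i]) t"
    have "\<forall>S. \<exists>F. multiform [1..<Suc r] m (?d J) F \<and> (\<forall>M. bracket (?rest M @ E @ ?ax S) = F (?p M))"
      using Cons.IH Cons.prems by (auto simp del: upt_Suc)
    from choice[OF this] obtain F where F: "\<And>S. multiform [1..<Suc r] m (?d J) (F S)"
        "\<And>S M. bracket (?rest M @ E @ ?ax S) = F S (?p M)" by blast
    define q where "q = sum_list (map c J) + length E"
    have len: "length (?rest M @ E) = q" for M :: "nat \<Rightarrow> nat \<Rightarrow> 'a ^ 'n"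
      by (simp add: q_def length_concat o_def)
    \<comment> \<open>The remaining blocks have total length \<open>q\<close> for every
      \<open>M\<close>, so one \<open>\<kappa>\<close> serves all configurations and may enter the
      coefficients of the form.\<close>
    obtain \<kappa> where \<kappa>: "\<And>xs ys :: ('a ^ 'n) list. length xs = Suc i \<Longrightarrow> length ys = q \<Longrightarrow>
       bracket (xs @ ys) = \<kappa> * bracket (ys @ xs)"
      unfolding bracket_def using plucker_coord_rotate by blast
    define G where "G p = (\<Sum>S | card S = Suc i. p (j, i, enum_list S) * (\<kappa> * F S p))" for p
    have "bracket (concat (map (\<lambda>j. map (M j) [0..<c j]) (j # J)) @ E) = G (?p M)" for M
    proof -
      have "bracket (concat (map (\<lambda>j. map (M j) [0..<c j]) (j # J)) @ E) = bracket (map (M j) [0..<Suc i] @ (?rest M @ E))"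
        by (simp add: Suc)
      also have "\<dots> = (\<Sum>S | card S = Suc i. plucker_coord (map (M j) [0..<Suc i]) (enum_list S) * bracket (?ax S @ (?rest M @ E)))"
        by (subst bracket_laplace) (simp del: upt_Suc)
      also have "\<dots> = G (?p M)"
        unfolding G_def
      proof (rule sum.cong[OF refl])
        fix S :: "'n set" assume "S \<in> {S. card S = Suc i}"
        then have "bracket (?ax S @ (?rest M @ E)) = \<kappa> * bracket ((?rest M @ E) @ ?ax S)"
          by (intro \<kappa> len) (simp add: enum_list_finite)
        then show "plucker_coord (map (M j) [0..<Suc i]) (enum_list S) * bracket (?ax S @ (?rest M @ E)) =
          ?p M (j, i, enum_list S) * (\<kappa> * F S (?p M))"
          using F(2)[of M S] by (simp del: upt_Suc)
      qed
      finally show ?thesis .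
    qed
    moreover have "multiform [1..<Suc r] m (?d (j # J)) G"
    proof -
      have "multiform [1..<Suc r] m (\<lambda>j' i'. (if j' = j \<and> i' = i then 1 else 0) + ?d J j' i') (\<lambda>p. p (j, i, enum_list S) * (\<kappa> * F S p))"
        if "card S = Suc i" for S
        by (intro multiform_mult multiform_var multiform_cmult F)
           (use that Suc Cons.prems[of j] in \<open>auto simp: plucker_vars_def enum_list_finite simp del: upt_Suc\<close>)
      moreover have "(\<lambda>j' i'. (if j' = j \<and> i' = i then 1 else 0) + ?d J j' i') = ?d (j # J)"
        using Suc by (auto simp: fun_eq_iff)
      ultimately show ?thesis unfolding G_def by (intro multiform_sum) simp
    qed
    ultimately show ?thesis by blast
  qed
qed

definition flag_bracket :: "nat \<Rightarrow> (nat \<Rightarrow> nat) \<Rightarrow> (nat \<Rightarrow> nat \<Rightarrow> 'a::field ^ 'n) \<Rightarrow> 'a" where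
  "flag_bracket m c M = bracket (concat (map (\<lambda>j. map (M j) [0..<c j]) [0..<m]))"

definition frame_coords :: "(nat \<Rightarrow> nat \<Rightarrow> 'a::field ^ 'n) \<Rightarrow> 'n plucker_var \<Rightarrow> 'a" where
  "frame_coords M = (\<lambda>(j, i, t). plucker_coord (map (M j) [0..<Suc i]) t)"

lemma flag_bracket_multiform:
  assumes "\<And>j. j < m \<Longrightarrow> c j \<le> r"
  shows "\<exists>F. multiform [1..<Suc r] m (\<lambda>j i. if j < m \<and> c j = Suc i then 1 else 0) F \<and>
    (\<forall>M :: nat \<Rightarrow> nat \<Rightarrow> 'a::field ^ 'n. flag_bracket m c M = F (frame_coords M))"
proof -
  have "count_list [0..<k] j = (if j < k then 1 else 0)" for j k :: nat
    by (induction k) auto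
  then have "(\<lambda>j i. if j < m \<and> c j = Suc i then 1 else 0) = (\<lambda>j i. if c j = Suc i then count_list [0..<m] j else 0)"
    by (auto simp: fun_eq_iff)
  then show ?thesis using block_brackets_multiform[of "[0..<m]" m c r "[]"] assms
    unfolding flag_bracket_def frame_coords_def by (simp del: upt_Suc)
qed

lemma flag_bracket_prod_multiform:
  assumes "\<And>c j. c \<in> set cs \<Longrightarrow> j < m \<Longrightarrow> c j \<le> r"
  shows "\<exists>F. multiform [1..<Suc r] m (\<lambda>j i. \<Sum>c\<leftarrow>cs. if j < m \<and> c j = Suc i then 1 else 0) F \<and>
    (\<forall>M :: nat \<Rightarrow> nat \<Rightarrow> 'a::field ^ 'n. (\<Prod>c\<leftarrow>cs. flag_bracket m c M) = F (frame_coords M))"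
  using assms
proof (induction cs)
  case Nil
  then show ?case using multiform_const[of "[1..<Suc r]" m 1] by (intro exI[of _ "\<lambda>_. 1"]) simp
next
  case (Cons c cs)
  obtain F where "multiform [1..<Suc r] m (\<lambda>j i. if j < m \<and> c j = Suc i then 1 else 0) F"
      "\<And>M :: nat \<Rightarrow> nat \<Rightarrow> 'a ^ 'n. flag_bracket m c M = F (frame_coords M)"
    using flag_bracket_multiform[of m c r] Cons.prems by auto
  moreover obtain G where "multiform [1..<Suc r] m (\<lambda>j i. \<Sum>c\<leftarrow>cs. if j < m \<and> c j = Suc i then 1 else 0) G"
      "\<And>M :: nat \<Rightarrow> nat \<Rightarrow> 'a ^ 'n. (\<Prod>c\<leftarrow>cs. flag_bracket m c M) = G (frame_coords M)"
    using Cons by auto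
  ultimately show ?case
    using multiform_mult[of "[1..<Suc r]" m _ F _ G] by (intro exI[of _ "\<lambda>p. F p * G p"]) (simp del: upt_Suc)
qed

text \<open>One \<open>\<kappa>\<close> for all shapes \<open>c\<close>: two products with equally
  many brackets are multiplied by the same power of it.\<close>

lemma flag_bracket_mult:
  fixes g :: "'a::field ^ 'n ^ 'n"
  shows "\<exists>\<kappa>. \<forall>c M. (\<Sum>j<m. c j) = CARD('n) \<longrightarrow> flag_bracket m c (\<lambda>j i. g *v M j i) = \<kappa> * flag_bracket m c M"
proof -
  obtain \<kappa> where \<kappa>: "\<And>vs :: ('a ^ 'n) list. length vs = CARD('n) \<Longrightarrow> bracket (map ((*v) g) vs) = \<kappa> * bracket vs"
    using bracket_matrix_vector_mult[of g] by blast
  have "flag_bracket m c (\<lambda>j i. g *v M j i) = \<kappa> * flag_bracket m c M" if "(\<Sum>j<m. c j) = CARD('n)" for c M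
  proof -
    have "length (concat (map (\<lambda>j. map (M j) [0..<c j]) [0..<m])) = CARD('n)"
      using that by (simp add: length_concat o_def interv_sum_list_conv_sum_set_nat lessThan_atLeast0)
    from \<kappa>[OF this] show ?thesis by (simp add: flag_bracket_def map_concat o_def)
  qed
  then show ?thesis by blast
qed

lemma frame_matrix_vector_mult:
  fixes g :: "'a::field ^ 'n ^ 'n"
  assumes "frame r u" "invertible g"
  shows "frame r (\<lambda>i. g *v u i)"
proof -
  have inj: "inj ((*v) g)" using assms(2) by (rule inj_matrix_vector_mult)
  have "vec.independent ((*v) g ` (u ` {..<r}))"
    by (rule vec.independent_inj_image) (use assms inj in \<open>auto simp: frame_def\<close>)
  moreover have "inj_on ((*v) g \<circ> u) {..<r}"
    using assms(1) inj by (intro comp_inj_on) (auto simp: frame_def intro: inj_on_subset)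
  ultimately show ?thesis by (simp add: frame_def image_image o_def)
qed

text \<open>The bases hidden in \<open>nonvanishing\<close> differ from the initial segments of the
  frame by scalars on Pluecker coordinates, so the frame itself can be used to test an open
  set.\<close>

lemma nonvanishing_frame_flags:
  assumes "\<And>j. j < m \<Longrightarrow> frame r (M j)" "multihomogeneous [1..<Suc r] m d f"
  shows "frame_flags r m M \<in> nonvanishing [1..<Suc r] m f \<longleftrightarrow> eval_poly (frame_coords M) f \<noteq> 0"
proof -
  let ?x = "frame_flags r m M"
  have basis: "is_basis_list (?x ! j ! i) (map (M j) [0..<Suc i])" if "j < m" "i < r" for i j
    using frame_basis_list[OF assms(1)] that by (simp add: frame_flags_def del: upt_Suc)
  have "eval_poly (frame_coords M) f \<noteq> 0" if nv: "?x \<in> nonvanishing [1..<Suc r] m f"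
  proof -
    obtain B where B: "\<And>i j. j < m \<Longrightarrow> i < r \<Longrightarrow> is_basis_list (?x ! j ! i) (B j i)"
        "eval_poly (\<lambda>(j, i, t). plucker_coord (B j i) t) f \<noteq> 0"
      using nv by (auto simp: nonvanishing_def simp del: upt_Suc)
    have "\<forall>j i. \<exists>c. j < m \<longrightarrow> i < r \<longrightarrow> (\<forall>t. plucker_coord (B j i) t = c * plucker_coord (map (M j) [0..<Suc i]) t)"
      using plucker_coord_basis_change[OF basis B(1)] by blast
    then obtain c where c: "\<And>j i t. j < m \<Longrightarrow> i < r \<Longrightarrow> plucker_coord (B j i) t = c j i * plucker_coord (map (M j) [0..<Suc i]) t"
      by metis
    have "eval_poly (\<lambda>(j, i, t). plucker_coord (B j i) t) f =
        (\<Prod>(j, i)\<in>{..<m} \<times> {..<length [1..<Suc r]}. c j i ^ d j i) * eval_poly (frame_coords M) f"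
      by (rule multihomogeneous_scale[OF assms(2)])
         (auto simp: c plucker_vars_def frame_coords_def simp del: upt_Suc)
    then show ?thesis using B(2) by auto
  qed
  moreover have "?x \<in> nonvanishing [1..<Suc r] m f" if "eval_poly (frame_coords M) f \<noteq> 0"
    unfolding nonvanishing_def using frame_flags_in_flag_power[OF assms(1)] basis that
    by (auto simp: frame_coords_def simp del: upt_Suc intro!: exI[of _ "\<lambda>j i. map (M j) [0..<Suc i]"])
  ultimately show ?thesis by blast
qed

text \<open>The quotient \<open>N / D\<close> is an invariant rational function; it is constant on a dense orbit.\<close>

lemma not_dense_action_invariant:
  fixes N D :: "('n::finite plucker_var \<Rightarrow> 'a::field) \<Rightarrow> 'a"
  assumes "multiform [1..<Suc r] m d N" "multiform [1..<Suc r] m d D"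
    and inv: "\<And>g :: 'a ^ 'n ^ 'n. \<exists>\<kappa>. \<forall>M. N (frame_coords (\<lambda>j i. g *v M j i)) = \<kappa> * N (frame_coords M) \<and>
                D (frame_coords (\<lambda>j i. g *v M j i)) = \<kappa> * D (frame_coords M)"
    and y: "\<And>j. j < m \<Longrightarrow> frame r (y j)" "N (frame_coords y) \<noteq> 0" "D (frame_coords y) = 0"
    and z: "\<And>j. j < m \<Longrightarrow> frame r (z j)" "D (frame_coords z) \<noteq> 0"
  shows "\<not> dense_action (PGL :: ('a ^ 'n ^ 'n) set monoid) diagonal_act (zariski_topology [1..<Suc r] m)"
proof
  assume "dense_action (PGL :: ('a ^ 'n ^ 'n) set monoid) diagonal_act (zariski_topology [1..<Suc r] m)"
  then obtain x where x: "x \<in> flag_power [1..<Suc r] m"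
    and dense: "zariski_topology [1..<Suc r] m closure_of (orbit PGL diagonal_act x) = (flag_power [1..<Suc r] m :: ('a ^ 'n) set list list set)"
    unfolding dense_action_def topspace_zariski_topology by blast
  obtain X where X: "\<And>j. j < m \<Longrightarrow> frame r (X j)" "x = frame_flags r m X"
    using flag_power_frames[OF x] by blast
  \<comment> \<open>A member of the pencil spanned by \<open>N\<close> and \<open>D\<close> that
    vanishes at \<open>X\<close>, hence on its orbit, but not at some configuration \<open>w\<close>
    of frames. If \<open>N\<close> and \<open>D\<close> both vanish at \<open>X\<close>, or only
    \<open>D\<close> does, \<open>N\<close> or \<open>D\<close> itself is such a member; otherwise
    \<open>y\<close> distinguishes the combination from zero. The nonvanishing set is then an open
    neighbourhood of \<open>w\<close> that the orbit misses.\<close>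
  obtain a b w where ab: "a * N (frame_coords X) + b * D (frame_coords X) = 0"
    and w: "\<And>j. j < m \<Longrightarrow> frame r (w j)" "a * N (frame_coords w) + b * D (frame_coords w) \<noteq> 0"
  proof (cases "D (frame_coords X) = 0")
    case True
    show ?thesis
    proof (cases "N (frame_coords X) = 0")
      case t: True
      show ?thesis by (rule that[of 1 0 y]) (use t True y in auto)
    next
      case False
      show ?thesis by (rule that[of 0 1 z]) (use False True z in auto)
    qed
  next
    case False
    show ?thesis by (rule that[of "D (frame_coords X)" "- N (frame_coords X)" y]) (use False y in auto)
  qed
  obtain f where f: "multihomogeneous [1..<Suc r] m d f" "\<And>p. a * N p + b * D p = eval_poly p f"
    using multiform_add[OF multiform_cmult[OF assms(1), of a] multiform_cmult[OF assms(2), of b]]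
    unfolding multiform_def by blast
  let ?U = "nonvanishing [1..<Suc r] m f"
  have "openin (zariski_topology [1..<Suc r] m) ?U"
    unfolding zariski_topology_def by (rule topology_generated_by_Basis) (use f(1) in blast)
  moreover have "frame_flags r m w \<in> ?U"
    using nonvanishing_frame_flags[of m r w d f] w f by auto
  moreover have "frame_flags r m w \<in> flag_power [1..<Suc r] m"
    by (rule frame_flags_in_flag_power[OF w(1)])
  ultimately obtain u where u: "u \<in> orbit PGL diagonal_act x" "u \<in> ?U"
    unfolding dense[symmetric] in_closure_of by auto
  then obtain g where g: "invertible g" "u = frame_flags r m (\<lambda>j i. g *v X j i)"
    unfolding X(2) orbit_frame_flags by blast
  obtain \<kappa> where "N (frame_coords (\<lambda>j i. g *v X j i)) = \<kappa> * N (frame_coords X)" "D (frame_coords (\<lambda>j i. g *v X j i)) = \<kappa> * D (frame_coords X)"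
    using inv by blast
  then have "eval_poly (frame_coords (\<lambda>j i. g *v X j i)) f = \<kappa> * (a * N (frame_coords X) + b * D (frame_coords X))"
    unfolding f(2)[symmetric] by (simp add: algebra_simps)
  moreover have "eval_poly (frame_coords (\<lambda>j i. g *v X j i)) f \<noteq> 0"
    using nonvanishing_frame_flags[of m r "\<lambda>j i. g *v X j i" d f] frame_matrix_vector_mult[OF X(1) g(1)] f(1) u(2) g(2)
    by auto
  ultimately show False using ab by simp
qed

text \<open>A bracket of shape \<open>c\<close> has degree one in the member of dimension
  \<open>c j\<close> of flag \<open>j\<close>, for each positive \<open>c j\<close>. Hence
  \<open>deg\<close> makes the multidegrees of the two products agree, and the equal lengths make
  them scale alike under a matrix.\<close>

lemma not_dense_action_brackets:
  assumes "length cs = length cs'"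
    and cs: "\<And>c. c \<in> set cs \<union> set cs' \<Longrightarrow> (\<Sum>j<m. c j) = CARD('n) \<and> (\<forall>j<m. c j \<le> r)"
    and deg: "\<And>j. j < m \<Longrightarrow> mset (map (\<lambda>c. c j) cs) = mset (map (\<lambda>c. c j) cs')"
    and y: "\<And>j. j < m \<Longrightarrow> frame r (y j :: nat \<Rightarrow> 'a ^ 'n)" "\<And>c. c \<in> set cs \<Longrightarrow> flag_bracket m c y \<noteq> 0"
        "c0 \<in> set cs'" "flag_bracket m c0 y = 0"
    and z: "\<And>j. j < m \<Longrightarrow> frame r (z j :: nat \<Rightarrow> 'a ^ 'n)" "\<And>c. c \<in> set cs' \<Longrightarrow> flag_bracket m c z \<noteq> 0"
  shows "\<not> dense_action (PGL :: ('a::field ^ 'n ^ 'n) set monoid) diagonal_act (zariski_topology [1..<Suc r] m)"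
proof -
  let ?d = "\<lambda>cs j i. \<Sum>c\<leftarrow>cs. if j < m \<and> c j = Suc i then 1 else (0::nat)"
  obtain N where N: "multiform [1..<Suc r] m (?d cs) N"
      "\<And>M :: nat \<Rightarrow> nat \<Rightarrow> 'a ^ 'n. (\<Prod>c\<leftarrow>cs. flag_bracket m c M) = N (frame_coords M)"
    using flag_bracket_prod_multiform[of cs m r] cs by auto
  obtain D where D: "multiform [1..<Suc r] m (?d cs') D"
      "\<And>M :: nat \<Rightarrow> nat \<Rightarrow> 'a ^ 'n. (\<Prod>c\<leftarrow>cs'. flag_bracket m c M) = D (frame_coords M)"
    using flag_bracket_prod_multiform[of cs' m r] cs by auto
  have "?d cs j i = ?d cs' j i" for j i
  proof (cases "j < m")
    case True
    have "?d xs j i = (\<Sum>k\<in>#mset (map (\<lambda>c. c j) xs). if k = Suc i then 1 else 0)" for xs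
      using True by (simp flip: sum_mset_sum_list add: multiset.map_comp o_def image_mset.compositionality)
    then show ?thesis using deg[OF True] by simp
  qed simp
  then have "?d cs' = ?d cs" by presburger
  then have D': "multiform [1..<Suc r] m (?d cs) D" using D(1) by (simp del: upt_Suc)
  show ?thesis
  proof (rule not_dense_action_invariant[OF N(1) D'])
    fix g :: "'a ^ 'n ^ 'n"
    obtain \<kappa> where \<kappa>: "\<And>c M. (\<Sum>j<m. c j) = CARD('n) \<Longrightarrow> flag_bracket m c (\<lambda>j i. g *v M j i) = \<kappa> * flag_bracket m c M"
      using flag_bracket_mult[of m g] by blast
    have *: "(\<Prod>c\<leftarrow>xs. flag_bracket m c (\<lambda>j i. g *v M j i)) = \<kappa> ^ length xs * (\<Prod>c\<leftarrow>xs. flag_bracket m c M)"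
      if "set xs \<subseteq> set cs \<union> set cs'" for xs M
      using that by (induction xs) (use \<kappa> cs in \<open>auto simp: algebra_simps\<close>)
    show "\<exists>\<kappa>. \<forall>M. N (frame_coords (\<lambda>j i. g *v M j i)) = \<kappa> * N (frame_coords M) \<and>
                D (frame_coords (\<lambda>j i. g *v M j i)) = \<kappa> * D (frame_coords M)"
      unfolding N(2)[symmetric] D(2)[symmetric]
      by (rule exI[of _ "\<kappa> ^ length cs"]) (use * assms(1) in auto)
  next
    show "N (frame_coords y) \<noteq> 0" "D (frame_coords y) = 0" "D (frame_coords z) \<noteq> 0"
      unfolding N(2)[symmetric] D(2)[symmetric] using y z by (auto simp: prod_list_zero_iff)
  qed (use y z in auto)
qed

section \<open>Configurations of unit vectors\<close>

definition unit_vec :: "nat \<Rightarrow> 'a::field ^ 'n::finite" where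
  "unit_vec k = axis (enum_list UNIV ! k) 1"

lemma unit_vec_inj: "inj_on (unit_vec :: nat \<Rightarrow> 'a::field ^ 'n::finite) {..<CARD('n)}"
  using enum_list_finite(2)[of "UNIV :: 'n set"]
  by (intro inj_onI) (simp add: unit_vec_def axis_eq_axis nth_eq_iff_index_eq enum_list_finite)

lemma unit_vec_frame:
  assumes "inj_on u {..<r}" "u ` {..<r} \<subseteq> {..<CARD('n)}"
  shows "frame r (\<lambda>i. unit_vec (u i) :: 'a::field ^ 'n::finite)"
proof -
  have "vec.independent ((\<lambda>i. unit_vec (u i) :: 'a ^ 'n) ` {..<r})"
    by (rule vec.independent_mono[OF independent_cart_basis]) (auto simp: cart_basis_def unit_vec_def)
  moreover have "inj_on (unit_vec \<circ> u :: nat \<Rightarrow> 'a ^ 'n) {..<r}"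
    using assms unit_vec_inj by (intro comp_inj_on) (auto intro: inj_on_subset)
  ultimately show ?thesis by (simp add: frame_def o_def)
qed

lemma flag_bracket_unit_vec:
  fixes u :: "nat \<Rightarrow> nat \<Rightarrow> nat"
  defines "M \<equiv> \<lambda>j i. unit_vec (u j i) :: 'a::field ^ 'n::finite"
  assumes c: "(\<Sum>j<m. c j) = CARD('n)"
  shows "(\<Union>j<m. u j ` {..<c j}) = {..<CARD('n)} \<Longrightarrow> flag_bracket m c M \<noteq> 0"
    and "j1 < m \<Longrightarrow> j2 < m \<Longrightarrow> j1 \<noteq> j2 \<Longrightarrow> i1 < c j1 \<Longrightarrow> i2 < c j2 \<Longrightarrow> u j1 i1 = u j2 i2 \<Longrightarrow> flag_bracket m c M = 0"
proof -
  define l where "l = concat (map (\<lambda>j. map (u j) [0..<c j]) [0..<m])"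
  have len: "length l = CARD('n)"
    using c by (simp add: l_def length_concat o_def interv_sum_list_conv_sum_set_nat lessThan_atLeast0)
  have set: "set l = (\<Union>j<m. u j ` {..<c j})" by (auto simp: l_def)
  have vecs: "concat (map (\<lambda>j. map (M j) [0..<c j]) [0..<m]) = map unit_vec l"
    by (simp add: l_def M_def map_concat o_def)
  {
    assume "(\<Union>j<m. u j ` {..<c j}) = {..<CARD('n)}"
    then have l: "set l = {..<CARD('n)}" "distinct l" using set len by (auto intro: card_distinct)
    let ?e = "(!) (enum_list (UNIV :: 'n set))"
    have "?e ` {..<CARD('n)} = UNIV"
      using enum_list_finite[of "UNIV :: 'n set"] by (metis lessThan_atLeast0 list.set_map map_nth set_upt)
    moreover have "inj_on ?e {..<CARD('n)}"
      using enum_list_finite[of "UNIV :: 'n set"] by (auto intro: inj_on_nth)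
    ultimately have "bracket (map (\<lambda>x. axis x 1) (map ?e l)) \<noteq> (0 :: 'a)"
      using l by (intro bracket_axis) (auto simp: distinct_map)
    then show "flag_bracket m c M \<noteq> 0"
      unfolding flag_bracket_def vecs by (simp add: unit_vec_def[abs_def] o_def)
  next
    assume a: "j1 < m" "j2 < m" "j1 \<noteq> j2" "i1 < c j1" "i2 < c j2" "u j1 i1 = u j2 i2"
    let ?S = "SIGMA j:{..<m}. {..<c j}"
    have im: "set l = (\<lambda>(j, i). u j i) ` ?S" by (auto simp: set)
    have "\<not> distinct l"
    proof
      assume "distinct l"
      then have "card ((\<lambda>(j, i). u j i) ` ?S) = card ?S" using len c distinct_card[of l] by (simp add: im)
      then have "inj_on (\<lambda>(j, i). u j i) ?S" by (intro eq_card_imp_inj_on) auto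
      from inj_onD[OF this, of "(j1, i1)" "(j2, i2)"] show False using a by auto
    qed
    then have "\<not> distinct (map unit_vec l :: ('a ^ 'n) list)" by (auto simp: distinct_map)
    then show "flag_bracket m c M = 0"
      unfolding flag_bracket_def vecs bracket_def by (rule plucker_coord_not_distinct)
  }
qed

lemma extend_inj_on:
  assumes "inj_on u {..<k}" "u ` {..<k} \<subseteq> {..<n}" "k \<le> r" "r \<le> n"
  shows "\<exists>u' :: nat \<Rightarrow> nat. inj_on u' {..<r} \<and> u' ` {..<r} \<subseteq> {..<n} \<and> (\<forall>i<k. u' i = u i)"
proof -
  have "\<exists>u' :: nat \<Rightarrow> nat. inj_on u' {..<k + d} \<and> u' ` {..<k + d} \<subseteq> {..<n} \<and> (\<forall>i<k. u' i = u i)" if "k + d \<le> n" for d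
    using that
  proof (induction d)
    case 0
    then show ?case using assms(1,2) by auto
  next
    case (Suc d)
    define r where "r = k + d"
    obtain u' where u': "inj_on u' {..<r}" "u' ` {..<r} \<subseteq> {..<n}" "\<forall>i<k. u' i = u i" using Suc by (auto simp: r_def)
    have "card (u' ` {..<r}) < card {..<n}" using Suc.prems card_image_le[of "{..<r}" u'] by (simp add: r_def)
    then have "\<not> {..<n} \<subseteq> u' ` {..<r}" using card_mono[of "u' ` {..<r}" "{..<n}"] by auto
    then obtain a where a: "a < n" "a \<notin> u' ` {..<r}" by auto
    have "inj_on (u'(r := a)) {..<Suc r}"
      using u'(1) a by (auto simp: inj_on_def less_Suc_eq)
    moreover have "(u'(r := a)) ` {..<Suc r} \<subseteq> {..<n}" using u'(2) a(1) by (auto simp: less_Suc_eq image_subset_iff)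
    moreover have "\<forall>i<k. (u'(r := a)) i = u i" using u'(3) by (simp add: r_def)
    ultimately show ?case unfolding r_def add_Suc_right by (intro exI conjI)
  qed
  from this[of "r - k"] show ?thesis using assms(3,4) by simp
qed

text \<open>Models the quotient by the span of the first \<open>b j\<close> vectors of all flags: it
  has a basis labelled by \<open>{..<q}\<close>, and \<open>z j\<close> lists the labels in the
  order in which flag \<open>j\<close> runs through them. A bracket takes the first
  \<open>\<epsilon> j\<close> labels of each list; it is nonzero if they exhaust the basis and zero
  if two flags supply the same label.\<close>

definition coordinate_frames ::
    "nat \<Rightarrow> nat \<Rightarrow> (nat \<Rightarrow> nat) \<Rightarrow> nat \<Rightarrow> (nat \<Rightarrow> nat list) \<Rightarrow> (nat \<Rightarrow> nat \<Rightarrow> 'a::field ^ 'n) \<Rightarrow> bool" where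
  "coordinate_frames r m b q z M \<longleftrightarrow> (\<forall>j<m. frame r (M j)) \<and>
    (\<forall>\<epsilon>. (\<forall>j<m. \<epsilon> j \<le> length (z j)) \<longrightarrow> (\<Sum>j<m. \<epsilon> j) = q \<longrightarrow>
      ((\<Union>j<m. set (take (\<epsilon> j) (z j))) = {..<q} \<longrightarrow> flag_bracket m (\<lambda>j. b j + \<epsilon> j) M \<noteq> 0) \<and>
      (\<forall>j1 j2 i1 i2. j1 < m \<longrightarrow> j2 < m \<longrightarrow> i1 < \<epsilon> j1 \<longrightarrow> i2 < \<epsilon> j2 \<longrightarrow> j1 \<noteq> j2 \<longrightarrow> z j1 ! i1 = z j2 ! i2 \<longrightarrow>
         flag_bracket m (\<lambda>j. b j + \<epsilon> j) M = 0))"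

lemma coordinate_frames_frame: "coordinate_frames r m b q z M \<Longrightarrow> j < m \<Longrightarrow> frame r (M j)"
  by (simp add: coordinate_frames_def)

lemma coordinate_frames_nonzero:
  assumes "coordinate_frames r m b q z M" "\<And>j. j < m \<Longrightarrow> \<epsilon> j \<le> length (z j)" "(\<Sum>j<m. \<epsilon> j) = q"
    "(\<Union>j<m. set (take (\<epsilon> j) (z j))) = {..<q}"
  shows "flag_bracket m (\<lambda>j. b j + \<epsilon> j) M \<noteq> 0"
  using assms unfolding coordinate_frames_def by blast

lemma coordinate_frames_zero:
  assumes "coordinate_frames r m b q z M" "\<And>j. j < m \<Longrightarrow> \<epsilon> j \<le> length (z j)" "(\<Sum>j<m. \<epsilon> j) = q"
    "j1 < m" "j2 < m" "i1 < \<epsilon> j1" "i2 < \<epsilon> j2" "j1 \<noteq> j2" "z j1 ! i1 = z j2 ! i2"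
  shows "flag_bracket m (\<lambda>j. b j + \<epsilon> j) M = 0"
  using assms unfolding coordinate_frames_def by blast

text \<open>The first \<open>b 0 + \<dots> + b (m - 1)\<close> vectors of a basis are distributed over the beginnings of the
  flags, so that for a bracket of the shape \<open>b + \<epsilon>\<close> only the other \<open>q\<close> vectors, arranged by \<open>z\<close>,
  matter.\<close>

lemma ex_coordinate_frames:
  assumes "r \<le> CARD('n::finite)" "(\<Sum>j<m. b j) + q = CARD('n)"
    and z: "\<And>j. j < m \<Longrightarrow> distinct (z j) \<and> set (z j) \<subseteq> {..<q} \<and> b j + length (z j) \<le> r"
  shows "\<exists>M :: nat \<Rightarrow> nat \<Rightarrow> 'a::field ^ 'n. coordinate_frames r m b q z M"
proof -
  let ?n = "CARD('n)"
  define s where "s j = (\<Sum>i<j. b i)" for j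
  have s_mono: "s i \<le> s j" if "i \<le> j" for i j
    unfolding s_def by (rule sum_mono2) (use that in auto)
  have s_le: "s j + b j + q \<le> ?n" if "j < m" for j
    using s_mono[of "Suc j" m] that assms(2) by (simp add: s_def)
  \<comment> \<open>Flag \<open>j\<close> begins with its own block of \<open>b j\<close> unit
    vectors, starting at the partial sum \<open>s j\<close>; the labels in \<open>z j\<close> are
    shifted by \<open>s m\<close>, past all blocks.\<close>
  define u0 where "u0 j i = (if i < b j then s j + i else s m + z j ! (i - b j))" for j i
  have "\<exists>u. inj_on u {..<r} \<and> u ` {..<r} \<subseteq> {..<?n} \<and> (\<forall>i<b j + length (z j). u i = u0 j i)" if j: "j < m" for j
  proof (rule extend_inj_on)
    have nth: "z j ! i < q" if "i < length (z j)" for i using z[OF j] that nth_mem by fastforce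
    have sm: "s m + q = ?n" using assms(2) by (simp add: s_def)
    have sb: "s j + b j \<le> s m" using s_le[OF j] sm by simp
    show "inj_on (u0 j) {..<b j + length (z j)}"
    proof (rule linorder_inj_onI')
      fix i k assume ik: "i \<in> {..<b j + length (z j)}" "k \<in> {..<b j + length (z j)}" "i < k"
      then have "z j ! (i - b j) \<noteq> z j ! (k - b j)" if "\<not> i < b j"
        using z[OF j] that by (auto simp: nth_eq_iff_index_eq)
      then show "u0 j i \<noteq> u0 j k" using ik sb by (auto simp: u0_def)
    qed
    show "u0 j ` {..<b j + length (z j)} \<subseteq> {..<?n}"
    proof -
      have "u0 j i < ?n" if "i < b j + length (z j)" for i
        using that nth[of "i - b j"] sb sm by (cases "i < b j") (auto simp: u0_def less_diff_conv2)
      then show ?thesis by auto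
    qed
  qed (use z[OF j] assms(1) in auto)
  then obtain u where u: "\<And>j. j < m \<Longrightarrow> inj_on (u j) {..<r} \<and> u j ` {..<r} \<subseteq> {..<?n} \<and> (\<forall>i<b j + length (z j). u j i = u0 j i)"
    by metis
  let ?M = "\<lambda>j i. unit_vec (u j i) :: 'a ^ 'n"
  have cover: "x \<in> (\<Union>j<k. {s j..<s j + b j})" if "x < s k" for x k
    using that by (induction k) (auto simp: s_def lessThan_Suc intro: leI)
  have "flag_bracket m (\<lambda>j. b j + \<epsilon> j) ?M \<noteq> 0"
    if e: "\<And>j. j < m \<Longrightarrow> \<epsilon> j \<le> length (z j)" "(\<Sum>j<m. \<epsilon> j) = q" "(\<Union>j<m. set (take (\<epsilon> j) (z j))) = {..<q}" for \<epsilon>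
  proof (rule flag_bracket_unit_vec)
    show "(\<Sum>j<m. b j + \<epsilon> j) = ?n" using assms(2) e(2) by (simp add: sum.distrib)
    show "(\<Union>j<m. u j ` {..<b j + \<epsilon> j}) = {..<?n}"
    proof (intro equalityI subsetI)
      fix x assume "x \<in> (\<Union>j<m. u j ` {..<b j + \<epsilon> j})"
      then obtain j i where ji: "j < m" "i < b j + \<epsilon> j" "x = u j i" by auto
      moreover have "b j + \<epsilon> j \<le> r" using z[OF ji(1)] e(1)[OF ji(1)] by linarith
      ultimately show "x \<in> {..<?n}" using u[OF ji(1)] by fastforce
    next
      fix x assume x: "x \<in> {..<?n}"
      show "x \<in> (\<Union>j<m. u j ` {..<b j + \<epsilon> j})"
      proof (cases "x < s m")
        case True
        then obtain j where j: "j < m" "s j \<le> x" "x < s j + b j" using cover by fastforce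
        then have "x = u j (x - s j)" "x - s j < b j + \<epsilon> j" using u[OF j(1)] by (auto simp: u0_def)
        then show ?thesis using j(1) by (intro UN_I[of j] image_eqI[of _ _ "x - s j"]) auto
      next
        case False
        then have "x - s m \<in> (\<Union>j<m. set (take (\<epsilon> j) (z j)))"
          unfolding e(3) using x assms(2) by (auto simp: s_def)
        then obtain j where j: "j < m" "x - s m \<in> set (take (\<epsilon> j) (z j))" by blast
        then obtain i where i: "i < \<epsilon> j" "i < length (z j)" "x - s m = z j ! i"
          by (auto simp: in_set_conv_nth)
        then have "x = u j (b j + i)" using False u[OF j(1)] by (auto simp: u0_def)
        then show ?thesis using j(1) i(1) by (intro UN_I[of j] image_eqI[of _ _ "b j + i"]) auto
      qed
    qed
  qed
  moreover have "flag_bracket m (\<lambda>j. b j + \<epsilon> j) ?M = 0"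
    if e: "\<And>j. j < m \<Longrightarrow> \<epsilon> j \<le> length (z j)" "(\<Sum>j<m. \<epsilon> j) = q"
      and i: "j1 < m" "j2 < m" "i1 < \<epsilon> j1" "i2 < \<epsilon> j2" "j1 \<noteq> j2" "z j1 ! i1 = z j2 ! i2" for \<epsilon> j1 j2 i1 i2
  proof (rule flag_bracket_unit_vec(2)[OF _ i(1,2,5)])
    show "(\<Sum>j<m. b j + \<epsilon> j) = ?n" using assms(2) e(2) by (simp add: sum.distrib)
    show "b j1 + i1 < b j1 + \<epsilon> j1" "b j2 + i2 < b j2 + \<epsilon> j2" using i by auto
    have "i1 < length (z j1)" "i2 < length (z j2)" using e(1)[OF i(1)] e(1)[OF i(2)] i by linarith+
    then show "u j1 (b j1 + i1) = u j2 (b j2 + i2)" using u i by (simp add: u0_def)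
  qed
  moreover have "frame r (?M j)" if "j < m" for j using u[OF that] by (intro unit_vec_frame) auto
  ultimately show ?thesis unfolding coordinate_frames_def by (intro exI[of _ ?M]) blast
qed

text \<open>Supplies the numbers \<open>b j\<close> of vectors that are divided out; for the
  invariants only their sum and upper bounds matter.\<close>

lemma sum_below_caps:
  fixes T m :: nat and cap :: "nat \<Rightarrow> nat"
  assumes "T \<le> (\<Sum>j<m. cap j)"
  shows "\<exists>b. (\<forall>j. b j \<le> cap j) \<and> (\<Sum>j<m. b j) = T"
  using assms
proof (induction m arbitrary: T)
  case 0
  then show ?case by (intro exI[of _ "\<lambda>_. 0"]) auto
next
  case (Suc m)
  have "T - min T (cap m) \<le> (\<Sum>j<m. cap j)" using Suc.prems unfolding sum.lessThan_Suc by linarith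
  then obtain b where b: "\<forall>j. b j \<le> cap j" "(\<Sum>j<m. b j) = T - min T (cap m)"
    using Suc.IH by blast
  have "(\<Sum>j<m. (b(m := min T (cap m))) j) = (\<Sum>j<m. b j)" by (intro sum.cong) auto
  then show ?case using b by (intro exI[of _ "b(m := min T (cap m))"]) auto
qed

text \<open>The cross-ratio \<open>[01][23] / [02][13]\<close> of the vectors following the first \<open>b j\<close> in the flags
  \<open>0, \<dots>, 3\<close>; its denominator vanishes at \<open>M1\<close>, but neither its numerator at \<open>M1\<close> nor its
  denominator at \<open>M2\<close>.\<close>

lemma sparse_four:
  assumes "m \<ge> 4" "r > 0" "r < CARD('n::finite)" "CARD('n) + 2 \<le> m * r"
  shows "\<not> dense_action (PGL :: ('a::field ^ 'n ^ 'n) set monoid) diagonal_act (zariski_topology [1..<Suc r] m)"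
proof -
  let ?n = "CARD('n)"
  \<comment> \<open>Each of the flags 0 to 3 must keep one vector for the cross-ratio, so at most
    \<open>m * r - 4\<close> vectors can be divided out. The \<open>n - 2\<close> that are needed
    fit exactly when \<open>n \<le> m * r - 2\<close>.\<close>
  have "(\<Sum>j<m. if j < 4 then r - 1 else r) + 4 = m * r"
  proof -
    have "(\<Sum>j<m. if j < 4 then r - 1 else r) = (\<Sum>j<(4::nat). if j < 4 then r - 1 else r) + (\<Sum>j\<in>{4..<m}. if j < 4 then r - 1 else r)"
      using assms(1) by (subst sum.union_disjoint[symmetric]) (auto intro: sum.cong)
    also have "\<dots> = 4 * (r - 1) + (m - 4) * r" by simp
    also have "\<dots> + 4 = m * r"
      using assms(1,2) by (cases r) (auto simp: le_iff_add algebra_simps)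
    finally show ?thesis .
  qed
  then have "?n - 2 \<le> (\<Sum>j<m. if j < 4 then r - 1 else r)" using assms(4) by linarith
  then obtain b where b: "\<And>j. b j \<le> (if j < 4 then r - 1 else r)" "(\<Sum>j<m. b j) = ?n - 2"
    using sum_below_caps[of "?n - 2" "\<lambda>j. if j < 4 then r - 1 else r" m] by blast
  have n: "(\<Sum>j<m. b j) + 2 = ?n" using b(2) assms(2,3) by simp
  have br: "b j + (if j < 4 then 1 else 0) \<le> r" for j using b(1)[of j] assms(2) by (auto split: if_splits)
  let ?e = "\<lambda>S j. if j \<in> S then 1 else (0::nat)"
  \<comment> \<open>In the quotient plane, \<open>?z1\<close> gives the flags the directions 0, 1,
    0, 1, so that \<open>[02]\<close> vanishes but \<open>[01]\<close> and \<open>[23]\<close> do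
    not; \<open>?z2\<close> gives 0, 0, 1, 1, so that \<open>[02]\<close> and \<open>[13]\<close>
    are nonzero.\<close>
  let ?z1 = "\<lambda>j. if j < 4 then [j mod 2] else []" and ?z2 = "\<lambda>j. if j < 4 then [j div 2] else []"
  have z: "distinct (?z1 j) \<and> set (?z1 j) \<subseteq> {..<2} \<and> b j + length (?z1 j) \<le> r"
      "distinct (?z2 j) \<and> set (?z2 j) \<subseteq> {..<2} \<and> b j + length (?z2 j) \<le> r" if "j < m" for j
    using br[of j] by auto
  obtain M1 :: "nat \<Rightarrow> nat \<Rightarrow> 'a ^ 'n" where M1: "coordinate_frames r m b 2 ?z1 M1"
    using ex_coordinate_frames[where z = ?z1, OF less_imp_le[OF assms(3)] n z(1)] by blast
  obtain M2 :: "nat \<Rightarrow> nat \<Rightarrow> 'a ^ 'n" where M2: "coordinate_frames r m b 2 ?z2 M2"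
    using ex_coordinate_frames[where z = ?z2, OF less_imp_le[OF assms(3)] n z(2)] by blast
  have sum_e: "(\<Sum>j<m. ?e S j) = card S" if "S \<subseteq> {..<4}" for S
  proof -
    have "{..<m} \<inter> S = S" using that assms(1) by auto
    then show ?thesis by (simp add: sum.If_cases)
  qed
  have le_e: "?e S j \<le> length (?z1 j)" "?e S j \<le> length (?z2 j)" if "S \<subseteq> {..<4}" for S and j :: nat
    using that by auto
  have un_e: "(\<Union>j<m. set (take (?e S j) (if j < 4 then [f j] else []))) = f ` S"
    if "S \<subseteq> {..<4}" for S and f :: "nat \<Rightarrow> nat"
  proof -
    have "set (take (?e S j) (if j < 4 then [f j] else [])) = (if j \<in> S then {f j} else {})" for j
      using that by auto
    moreover have "(\<Union>j<m. if j \<in> S then {f j} else {}) = f ` S" using that assms(1) by force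
    ultimately show ?thesis by simp
  qed
  have 2: "{..<2} = {0, 1 :: nat}" by auto
  let ?c = "\<lambda>S j. b j + ?e S j"
  have nz1: "flag_bracket m (?c S) M1 \<noteq> 0" if "S \<subseteq> {..<4}" "card S = 2" "(\<lambda>j. j mod 2) ` S = {..<2}" for S
  proof (rule coordinate_frames_nonzero[OF M1])
    show "(\<Sum>j<m. ?e S j) = 2" using sum_e[OF that(1)] that(2) by (simp only:)
    show "(\<Union>j<m. set (take (?e S j) (?z1 j))) = {..<2}" using un_e[OF that(1), of "\<lambda>j. j mod 2"] that(3) by (simp only:)
  qed (rule le_e(1)[OF that(1)])
  have nz2: "flag_bracket m (?c S) M2 \<noteq> 0" if "S \<subseteq> {..<4}" "card S = 2" "(\<lambda>j. j div 2) ` S = {..<2}" for S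
  proof (rule coordinate_frames_nonzero[OF M2])
    show "(\<Sum>j<m. ?e S j) = 2" using sum_e[OF that(1)] that(2) by (simp only:)
    show "(\<Union>j<m. set (take (?e S j) (?z2 j))) = {..<2}" using un_e[OF that(1), of "\<lambda>j. j div 2"] that(3) by (simp only:)
  qed (rule le_e(2)[OF that(1)])
  have nz: "flag_bracket m (?c {0, 1}) M1 \<noteq> 0" "flag_bracket m (?c {2, 3}) M1 \<noteq> 0"
      "flag_bracket m (?c {0, 2}) M2 \<noteq> 0" "flag_bracket m (?c {1, 3}) M2 \<noteq> 0"
    using nz1[of "{0, 1}"] nz1[of "{2, 3}"] nz2[of "{0, 2}"] nz2[of "{1, 3}"] 2 by (simp_all add: insert_commute)
  have z1: "flag_bracket m (?c {0, 2}) M1 = 0"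
  proof (rule coordinate_frames_zero[OF M1, of "?e {0, 2}" 0 2 0 0])
    show "?e {0, 2} j \<le> length (?z1 j)" for j :: nat by (rule le_e(1)) auto
    show "(\<Sum>j<m. ?e {0, 2} j) = 2" by (subst sum_e) auto
  qed (use assms(1) in auto)
  show ?thesis
  proof (rule not_dense_action_brackets[where cs = "[?c {0, 1}, ?c {2, 3}]" and cs' = "[?c {0, 2}, ?c {1, 3}]" and y = M1 and z = M2 and ?c0.0 = "?c {0, 2}"])
    fix c assume "c \<in> set [?c {0, 1}, ?c {2, 3}] \<union> set [?c {0, 2}, ?c {1, 3}]"
    then have "c \<in> ?c ` {{0, 1}, {2, 3}, {0, 2}, {1, 3}}"
      by (simp only: list.set Un_iff insert_iff empty_iff image_insert image_empty) blast
    then obtain S where S: "c = ?c S" "S \<in> {{0, 1}, {2, 3}, {0, 2}, {1, 3}}" by (rule imageE)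
    then have "S \<subseteq> {..<4}" "card S = 2" by auto
    then have "(\<Sum>j<m. c j) = ?n" using sum_e n S(1) by (simp add: sum.distrib)
    moreover have "c j \<le> r" for j using br[of j] \<open>S \<subseteq> {..<4}\<close> S(1) by (auto split: if_splits)
    ultimately show "(\<Sum>j<m. c j) = ?n \<and> (\<forall>j<m. c j \<le> r)" by blast
  qed (use coordinate_frames_frame[OF M1] coordinate_frames_frame[OF M2] nz z1 in \<open>auto simp del: sum.insert\<close>)
qed

text \<open>The triple ratio \<open>[210][102][021] / [201][120][012]\<close>, where the digits count the vectors taken
  from each flag beyond the first \<open>b j\<close>.\<close>

lemma sparse_three:
  assumes "r > 1" "r < CARD('n::finite)" "CARD('n) + 3 \<le> 3 * r"
  shows "\<not> dense_action (PGL :: ('a::field ^ 'n ^ 'n) set monoid) diagonal_act (zariski_topology [1..<Suc r] 3)"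
proof -
  let ?n = "CARD('n)"
  \<comment> \<open>Each flag keeps two vectors for the triple ratio, and
    \<open>n - 3 \<le> 3 * (r - 2)\<close> is the bound \<open>n \<le> 3 * r - 3\<close>.\<close>
  have "?n - 3 \<le> (\<Sum>j<(3::nat). r - 2)" using assms by simp
  then obtain b :: "nat \<Rightarrow> nat" where b: "\<And>j. b j \<le> r - 2" "(\<Sum>j<(3::nat). b j) = ?n - 3"
    using sum_below_caps[of "?n - 3" "\<lambda>_. r - 2" 3] by blast
  have n: "(\<Sum>j<3. b j) + 3 = ?n" using b(2) assms by simp
  have br: "b j + 2 \<le> r" for j using b(1)[of j] assms(1) by simp
  let ?e = "\<lambda>x y z :: nat. (!) [x, y, z]"
  have lt3: "j < 3 \<longleftrightarrow> j = 0 \<or> j = 1 \<or> j = 2" for j :: nat by auto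
  have l3: "{..<3} = {0, 1, 2 :: nat}" by auto
  \<comment> \<open>Flag \<open>j\<close> starts with label \<open>j\<close> and continues with its
    cyclic predecessor in \<open>?z1\<close>, its successor in \<open>?z2\<close>. The brackets of
    the numerator combine two labels of a flag with the first of its successor, those of the
    denominator with the first of its predecessor; the second label must avoid it.\<close>
  let ?z1 = "\<lambda>j. [[0, 2], [1, 0], [2, 1 :: nat]] ! j" and ?z2 = "\<lambda>j. [[0, 1], [1, 2], [2, 0 :: nat]] ! j"
  have z: "distinct (?z1 j) \<and> set (?z1 j) \<subseteq> {..<3} \<and> b j + length (?z1 j) \<le> r"
      "distinct (?z2 j) \<and> set (?z2 j) \<subseteq> {..<3} \<and> b j + length (?z2 j) \<le> r" if "j < 3" for j
    using br[of j] that by (auto simp: lt3)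
  obtain M1 :: "nat \<Rightarrow> nat \<Rightarrow> 'a ^ 'n" where M1: "coordinate_frames r 3 b 3 ?z1 M1"
    using ex_coordinate_frames[where z = ?z1, OF less_imp_le[OF assms(2)] n z(1)] by blast
  obtain M2 :: "nat \<Rightarrow> nat \<Rightarrow> 'a ^ 'n" where M2: "coordinate_frames r 3 b 3 ?z2 M2"
    using ex_coordinate_frames[where z = ?z2, OF less_imp_le[OF assms(2)] n z(2)] by blast
  let ?c = "\<lambda>x y z j. b j + ?e x y z j"
  have nz1: "flag_bracket 3 (?c 2 1 0) M1 \<noteq> 0" "flag_bracket 3 (?c 1 0 2) M1 \<noteq> 0" "flag_bracket 3 (?c 0 2 1) M1 \<noteq> 0"
    by (rule coordinate_frames_nonzero[OF M1]; auto simp: lt3 l3)+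
  have nz2: "flag_bracket 3 (?c 2 0 1) M2 \<noteq> 0" "flag_bracket 3 (?c 1 2 0) M2 \<noteq> 0" "flag_bracket 3 (?c 0 1 2) M2 \<noteq> 0"
    by (rule coordinate_frames_nonzero[OF M2]; auto simp: lt3 l3)+
  have z1: "flag_bracket 3 (?c 2 0 1) M1 = 0"
    by (rule coordinate_frames_zero[OF M1, of "?e 2 0 1" 0 2 1 0]) (auto simp: lt3 l3)
  show ?thesis
  proof (rule not_dense_action_brackets[where cs = "[?c 2 1 0, ?c 1 0 2, ?c 0 2 1]" and cs' = "[?c 2 0 1, ?c 1 2 0, ?c 0 1 2]" and y = M1 and z = M2 and ?c0.0 = "?c 2 0 1"])
    fix c assume "c \<in> set [?c 2 1 0, ?c 1 0 2, ?c 0 2 1] \<union> set [?c 2 0 1, ?c 1 2 0, ?c 0 1 2]"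
    then show "(\<Sum>j<3. c j) = ?n \<and> (\<forall>j<3. c j \<le> r)"
      using n br[of 0] br[of 1] br[of 2] by (auto simp: lt3 l3)
  next
    fix j :: nat assume "j < 3"
    then show "mset (map (\<lambda>c. c j) [?c 2 1 0, ?c 1 0 2, ?c 0 2 1]) = mset (map (\<lambda>c. c j) [?c 2 0 1, ?c 1 2 0, ?c 0 1 2])"
      by (auto simp: lt3)
  qed (use coordinate_frames_frame[OF M1] coordinate_frames_frame[OF M2] nz1 nz2 z1 in auto)
qed

section \<open>A criterion for dense actions\<close>

definition poly_fun :: "('a::field \<Rightarrow> 'a) \<Rightarrow> bool" where
  "poly_fun h \<longleftrightarrow> (\<exists>p. \<forall>s. h s = poly p s)"

lemma poly_fun_const: "poly_fun (\<lambda>_. c)"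
  unfolding poly_fun_def by (rule exI[of _ "[:c:]"]) simp

lemma poly_fun_ident: "poly_fun (\<lambda>s. s)"
  unfolding poly_fun_def by (rule exI[of _ "[:0, 1:]"]) simp

lemma poly_fun_add:
  assumes "poly_fun f" "poly_fun g" shows "poly_fun (\<lambda>s. f s + g s)"
proof -
  obtain p q where "\<And>s. f s = poly p s" "\<And>s. g s = poly q s" using assms by (auto simp: poly_fun_def)
  then show ?thesis unfolding poly_fun_def by (intro exI[of _ "p + q"]) simp
qed

lemma poly_fun_mult:
  assumes "poly_fun f" "poly_fun g" shows "poly_fun (\<lambda>s. f s * g s)"
proof -
  obtain p q where "\<And>s. f s = poly p s" "\<And>s. g s = poly q s" using assms by (auto simp: poly_fun_def)
  then show ?thesis unfolding poly_fun_def by (intro exI[of _ "p * q"]) simp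
qed

lemma poly_fun_sum: "(\<And>x. x \<in> A \<Longrightarrow> poly_fun (f x)) \<Longrightarrow> poly_fun (\<lambda>s. \<Sum>x\<in>A. f x s)"
  by (induction A rule: infinite_finite_induct) (simp_all add: poly_fun_const poly_fun_add)

lemma poly_fun_prod: "(\<And>x. x \<in> A \<Longrightarrow> poly_fun (f x)) \<Longrightarrow> poly_fun (\<lambda>s. \<Prod>x\<in>A. f x s)"
  by (induction A rule: infinite_finite_induct) (simp_all add: poly_fun_const poly_fun_mult)

lemma poly_fun_power: "poly_fun f \<Longrightarrow> poly_fun (\<lambda>s. f s ^ k)"
  by (induction k) (simp_all add: poly_fun_const poly_fun_mult)

lemma poly_fun_finite_zeros:
  assumes "poly_fun h" "h a \<noteq> 0" shows "finite {s. h s = 0}"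
proof -
  obtain p where p: "\<And>s. h s = poly p s" using assms(1) by (auto simp: poly_fun_def)
  then have "p \<noteq> 0" using assms(2) by auto
  then show ?thesis unfolding p by (rule poly_roots_finite)
qed

text \<open>Over a finite field, one plus the product of all \<open>x - a\<close> would have no
  root.\<close>

lemma infinite_alg_closed_field: "infinite (UNIV :: 'a::alg_closed_field set)"
proof
  assume fin: "finite (UNIV :: 'a set)"
  let ?p = "(\<Prod>a\<in>UNIV. [:- a, 1:]) + 1 :: 'a poly"
  have "degree (\<Prod>a\<in>(UNIV :: 'a set). [:- a, 1:]) = card (UNIV :: 'a set)"
    by (subst degree_prod_eq_sum_degree) auto
  then have "degree ?p > 0" using fin by (subst degree_add_eq_left) (auto simp: card_gt_0_iff)
  then obtain x where "poly ?p x = 0" using alg_closed_imp_poly_has_root by blast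
  moreover have "poly (\<Prod>a\<in>UNIV. [:- a, 1:]) x = 0"
    using fin by (auto simp: poly_prod intro!: prod_zero)
  ultimately show False by simp
qed

text \<open>The line is drawn between arrays of vectors, not between flags, and some of its points
  may fail to be frames.\<close>

definition frame_line :: "(nat \<Rightarrow> nat \<Rightarrow> 'a::field ^ 'n) \<Rightarrow> (nat \<Rightarrow> nat \<Rightarrow> 'a ^ 'n) \<Rightarrow> 'a \<Rightarrow> nat \<Rightarrow> nat \<Rightarrow> 'a ^ 'n" where
  "frame_line M X s = (\<lambda>j i. M j i + s *s (X j i - M j i))"

lemma frame_line_0 [simp]: "frame_line M X 0 = M"
  by (simp add: frame_line_def)

lemma frame_line_1 [simp]: "frame_line M X 1 = X"
  by (simp add: frame_line_def)

lemma poly_fun_frame_line: "poly_fun (\<lambda>s. frame_line M X s j i $ x)"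
proof -
  have "frame_line M X s j i $ x = M j i $ x + s * (X j i $ x - M j i $ x)" for s
    by (simp add: frame_line_def right_diff_distrib)
  moreover have "poly_fun (\<lambda>s. M j i $ x + s * (X j i $ x - M j i $ x))"
    by (rule poly_fun_add[OF poly_fun_const poly_fun_mult[OF poly_fun_ident poly_fun_const]])
  ultimately show ?thesis by (simp only:)
qed

lemma poly_fun_plucker_coord:
  "poly_fun (\<lambda>s. plucker_coord (map (frame_line M X s j) [0..<k]) t)"
proof -
  have "plucker_coord (map (frame_line M X s j) [0..<k]) t =
      (\<Sum>\<sigma> | \<sigma> permutes {..<k}. of_int (sign \<sigma>) * (\<Prod>i<k. frame_line M X s j (\<sigma> i) $ (t ! i)))" for s
  proof -
    have "(\<Prod>i<k. (map (frame_line M X s j) [0..<k] ! \<sigma> i) $ (t ! i)) = (\<Prod>i<k. frame_line M X s j (\<sigma> i) $ (t ! i))"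
      if "\<sigma> permutes {..<k}" for \<sigma>
      by (rule prod.cong[OF refl]) (use permutes_in_image[OF that] in simp)
    then show ?thesis by (simp add: plucker_coord_def)
  qed
  moreover have "poly_fun (\<lambda>s. \<Sum>\<sigma> | \<sigma> permutes {..<k}. of_int (sign \<sigma>) * (\<Prod>i<k. frame_line M X s j (\<sigma> i) $ (t ! i)))"
    by (intro poly_fun_sum poly_fun_mult poly_fun_const poly_fun_prod poly_fun_frame_line)
  ultimately show ?thesis by (simp only:)
qed

lemma poly_fun_eval_poly: "poly_fun (\<lambda>s. eval_poly (frame_coords (frame_line M X s)) f)"
proof -
  have "poly_fun (\<lambda>s. frame_coords (frame_line M X s) v)" for v
    unfolding frame_coords_def by (cases v) (simp only: prod.case poly_fun_plucker_coord)
  then show ?thesis unfolding eval_poly_def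
    by (intro poly_fun_sum poly_fun_mult poly_fun_const poly_fun_prod poly_fun_power)
qed

text \<open>If \<open>I\<close> has \<open>CARD('n)\<close> elements, this is the nonvanishing of a
  determinant, stated without ordering \<open>I\<close>.\<close>

definition spanning :: "(nat \<Rightarrow> nat \<Rightarrow> 'a::field ^ 'n) \<Rightarrow> (nat \<times> nat) set \<Rightarrow> bool" where
  "spanning M I \<longleftrightarrow> vec.span ((\<lambda>(j, i). M j i) ` I) = UNIV"

lemma spanning_basis:
  fixes M :: "nat \<Rightarrow> nat \<Rightarrow> 'a::field ^ 'n::finite"
  assumes "spanning M I" "finite I" "card I = CARD('n)"
  shows "inj_on (\<lambda>(j, i). M j i) I" "vec.independent ((\<lambda>(j, i). M j i) ` I)"
proof -
  let ?B = "(\<lambda>(j, i). M j i) ` I"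
  have "CARD('n) \<le> card ?B"
    using vec.dim_le_card[of UNIV ?B] assms(1,2) by (simp add: spanning_def vec_dim_card del: vec.dim_UNIV)
  moreover have "card ?B \<le> card I" by (rule card_image_le[OF assms(2)])
  ultimately have c: "card ?B = CARD('n)" using assms(3) by simp
  then show "inj_on (\<lambda>(j, i). M j i) I" using assms(2,3) by (intro eq_card_imp_inj_on) auto
  show "vec.independent ?B"
    by (rule vec.card_le_dim_spanning[of _ UNIV])
       (use assms c in \<open>auto simp: spanning_def vec_dim_card simp del: vec.dim_UNIV\<close>)
qed

lemma spanning_poly_fun:
  fixes M X :: "nat \<Rightarrow> nat \<Rightarrow> 'a::field ^ 'n::finite"
  assumes "finite I" "card I = CARD('n)"
  shows "\<exists>h. poly_fun h \<and> (\<forall>s. h s \<noteq> 0 \<longleftrightarrow> spanning (frame_line M X s) I)"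
proof -
  obtain \<beta> where \<beta>: "bij_betw \<beta> (UNIV :: 'n set) I"
    using finite_same_card_bij[of "UNIV :: 'n set" I] assms by auto
  define A where "A s = (\<chi> x k. (\<lambda>(j, i). frame_line M X s j i) (\<beta> k) $ x)" for s
  have col: "columns (A s) = (\<lambda>(j, i). frame_line M X s j i) ` I" for s
  proof -
    have "column k (A s) = (\<lambda>(j, i). frame_line M X s j i) (\<beta> k)" for k
      by (simp add: column_def A_def vec_eq_iff)
    then have "columns (A s) = (\<lambda>k. (\<lambda>(j, i). frame_line M X s j i) (\<beta> k)) ` UNIV"
      by (auto simp: columns_def)
    also have "\<dots> = (\<lambda>(j, i). frame_line M X s j i) ` \<beta> ` UNIV" by (simp add: image_image)
    finally show ?thesis using \<beta> by (simp add: bij_betw_def)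
  qed
  have "det (A s) \<noteq> 0 \<longleftrightarrow> spanning (frame_line M X s) I" for s
    unfolding spanning_def col[symmetric] invertible_det_nz[symmetric] invertible_right_inverse
    by (rule matrix_right_invertible_span_columns)
  moreover have "poly_fun (\<lambda>s. det (A s))"
    unfolding det_def A_def by (intro poly_fun_sum poly_fun_mult poly_fun_const poly_fun_prod)
      (simp add: split_def poly_fun_frame_line)
  ultimately show ?thesis by blast
qed

lemma generated_topology_finite_inter:
  assumes "openin (topology_generated_by S) U" "x \<in> U"
  shows "\<exists>F. finite F \<and> F \<subseteq> S \<and> x \<in> \<Inter>F \<and> \<Inter>F \<subseteq> U"
proof -
  have "generate_topology_on S U" using assms(1) by (rule openin_topology_generated_by)
  then show ?thesis using assms(2)
  proof induction
    case (Int a b)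
    then obtain F G where "finite F" "F \<subseteq> S" "x \<in> \<Inter>F" "\<Inter>F \<subseteq> a" "finite G" "G \<subseteq> S" "x \<in> \<Inter>G" "\<Inter>G \<subseteq> b"
      by blast
    then show ?case by (intro exI[of _ "F \<union> G"]) auto
  next
    case (UN K)
    then obtain k where "k \<in> K" "x \<in> k" by blast
    with UN.IH[OF this] obtain F where "finite F" "F \<subseteq> S" "x \<in> \<Inter>F" "\<Inter>F \<subseteq> k" by blast
    then show ?case using \<open>k \<in> K\<close> by (intro exI[of _ F] conjI) (auto dest: subset_trans)
  next
    case (Basis s)
    then show ?case by (intro exI[of _ "{s}"]) auto
  qed simp
qed

text \<open>A point \<open>M\<close> is joined to \<open>X\<close> by a line of frames; all but finitely many of its points lie in
  a given neighbourhood of \<open>M\<close> and satisfy the spanning conditions.\<close>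

lemma dense_action_criterion:
  fixes X :: "nat \<Rightarrow> nat \<Rightarrow> 'a::alg_closed_field ^ 'n::finite"
  assumes "finite \<I>"
    and I: "\<And>I. I \<in> \<I> \<Longrightarrow> finite I \<and> card I = CARD('n) \<and> spanning X I"
    and cover: "\<And>j. j < m \<Longrightarrow> \<exists>I\<in>\<I>. {j} \<times> {..<r} \<subseteq> I"
    and orb: "\<And>M :: nat \<Rightarrow> nat \<Rightarrow> 'a ^ 'n. (\<And>I. I \<in> \<I> \<Longrightarrow> spanning M I) \<Longrightarrow>
       \<exists>g. invertible g \<and> frame_flags r m M = frame_flags r m (\<lambda>j i. g *v X j i)"
  shows "dense_action (PGL :: ('a ^ 'n ^ 'n) set monoid) diagonal_act (zariski_topology [1..<Suc r] m)"
proof -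
  have frame: "frame r (M j)" if M: "\<And>I. I \<in> \<I> \<Longrightarrow> spanning M I" and "j < m" for M :: "nat \<Rightarrow> nat \<Rightarrow> 'a ^ 'n" and j
  proof -
    obtain J where J: "J \<in> \<I>" "{j} \<times> {..<r} \<subseteq> J" using cover \<open>j < m\<close> by blast
    have basis: "inj_on (\<lambda>(j, i). M j i) J" "vec.independent ((\<lambda>(j, i). M j i) ` J)"
      using spanning_basis[OF M[OF J(1)]] I[OF J(1)] by blast+
    have inj: "inj_on (\<lambda>(j, i). M j i) ({j} \<times> {..<r})" by (rule inj_on_subset[OF basis(1) J(2)])
    have ind: "vec.independent ((\<lambda>(j, i). M j i) ` ({j} \<times> {..<r}))"
      by (rule vec.independent_mono[OF basis(2) image_mono[OF J(2)]])
    have "inj_on (M j) {..<r}" using inj by (auto simp: inj_on_def)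
    moreover have "(\<lambda>(j, i). M j i) ` ({j} \<times> {..<r}) = M j ` {..<r}" by auto
    ultimately show ?thesis using ind by (simp add: frame_def)
  qed
  let ?T = "zariski_topology [1..<Suc r] m :: ('a ^ 'n) set list list topology"
  let ?x = "frame_flags r m X"
  have x: "?x \<in> flag_power [1..<Suc r] m" by (rule frame_flags_in_flag_power) (use frame I in blast)
  have "y \<in> ?T closure_of (orbit PGL diagonal_act ?x)" if y: "y \<in> flag_power [1..<Suc r] m" for y
    unfolding in_closure_of topspace_zariski_topology
  proof (intro conjI allI impI)
    fix U assume U: "y \<in> U \<and> openin ?T U"
    obtain M where M: "\<And>j. j < m \<Longrightarrow> frame r (M j)" "y = frame_flags r m M" using flag_power_frames[OF y] by blast
    define S where "S = {nonvanishing [1..<Suc r] m f | f :: ('n, 'a) plucker_poly. \<exists>d. multihomogeneous [1..<Suc r] m d f}"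
    have "openin (topology_generated_by S) U" using U by (simp only: zariski_topology_def S_def)
    then obtain F where F: "finite F" "F \<subseteq> S" "y \<in> \<Inter>F" "\<Inter>F \<subseteq> U"
      using generated_topology_finite_inter[of S U y] U by blast
    have "\<forall>V\<in>F. \<exists>h. poly_fun h \<and> h 0 \<noteq> 0 \<and>
        (\<forall>s. (\<forall>j<m. frame r (frame_line M X s j)) \<longrightarrow> h s \<noteq> 0 \<longrightarrow> frame_flags r m (frame_line M X s) \<in> V)"
    proof
      fix V assume V: "V \<in> F"
      then obtain f d where f: "V = nonvanishing [1..<Suc r] m f" "multihomogeneous [1..<Suc r] m d f"
        using F(2) unfolding S_def by blast
      let ?h = "\<lambda>s. eval_poly (frame_coords (frame_line M X s)) f"
      have "frame_flags r m M \<in> nonvanishing [1..<Suc r] m f" using V F(3) M(2) f(1) by blast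
      then have "?h 0 \<noteq> 0" using nonvanishing_frame_flags[of m r M d f] M(1) f(2) by simp
      moreover have "frame_flags r m (frame_line M X s) \<in> V" if "\<forall>j<m. frame r (frame_line M X s j)" "?h s \<noteq> 0" for s
        using nonvanishing_frame_flags[of m r "frame_line M X s" d f] that f by blast
      ultimately show "\<exists>h. poly_fun h \<and> h 0 \<noteq> 0 \<and>
        (\<forall>s. (\<forall>j<m. frame r (frame_line M X s j)) \<longrightarrow> h s \<noteq> 0 \<longrightarrow> frame_flags r m (frame_line M X s) \<in> V)"
        using poly_fun_eval_poly[of M X f] by (intro exI[of _ ?h] conjI allI impI)
    qed
    from bchoice[OF this] obtain h where h: "\<forall>V\<in>F. poly_fun (h V) \<and> h V 0 \<noteq> 0 \<and>
        (\<forall>s. (\<forall>j<m. frame r (frame_line M X s j)) \<longrightarrow> h V s \<noteq> 0 \<longrightarrow> frame_flags r m (frame_line M X s) \<in> V)" by blast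
    have "\<forall>I\<in>\<I>. \<exists>k. poly_fun k \<and> (\<forall>s. k s \<noteq> 0 \<longleftrightarrow> spanning (frame_line M X s) I)"
      using spanning_poly_fun I by blast
    from bchoice[OF this] obtain k where k: "\<forall>I\<in>\<I>. poly_fun (k I) \<and> (\<forall>s. k I s \<noteq> 0 \<longleftrightarrow> spanning (frame_line M X s) I)" by blast
    \<comment> \<open>Each polynomial is nonzero at one end of the line: \<open>h V\<close> at 0,
      since \<open>y\<close> lies in \<open>V\<close>, and \<open>k J\<close> at 1, since
      \<open>X\<close> is generic. \<open>M\<close> itself may violate the spanning
      conditions.\<close>
    have "finite {s. h V s = 0}" if "V \<in> F" for V
      using h that poly_fun_finite_zeros[of "h V" 0] by blast
    moreover have "finite {s. k J s = 0}" if "J \<in> \<I>" for J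
      using k that I[OF that] poly_fun_finite_zeros[of "k J" 1] by force
    ultimately have "finite ((\<Union>V\<in>F. {s. h V s = 0}) \<union> (\<Union>J\<in>\<I>. {s. k J s = 0}))"
      using F(1) assms(1) by blast
    then obtain s where s: "s \<notin> (\<Union>V\<in>F. {s. h V s = 0}) \<union> (\<Union>J\<in>\<I>. {s. k J s = 0})"
      using ex_new_if_finite[OF infinite_alg_closed_field] by blast
    have sp: "spanning (frame_line M X s) J" if "J \<in> \<I>" for J using s k that by blast
    let ?z = "frame_flags r m (frame_line M X s)"
    have "\<forall>j<m. frame r (frame_line M X s j)" using frame[OF sp] by blast
    then have "?z \<in> \<Inter>F" using s h by blast
    then have "?z \<in> U" using F(4) by blast
    moreover have "?z \<in> orbit PGL diagonal_act ?x"
      unfolding orbit_frame_flags using orb[OF sp] by blast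
    ultimately show "\<exists>z. z \<in> orbit PGL diagonal_act ?x \<and> z \<in> U" by blast
  qed (use y in auto)
  then have "?T closure_of (orbit PGL diagonal_act ?x) = topspace ?T"
    using closure_of_subset_topspace[of ?T] unfolding topspace_zariski_topology by blast
  then show ?thesis unfolding dense_action_def using x topspace_zariski_topology by blast
qed

section \<open>Normal forms of generic configurations\<close>

abbreviation vecs :: "(nat \<Rightarrow> nat \<Rightarrow> 'a::field ^ 'n) \<Rightarrow> (nat \<times> nat) set \<Rightarrow> ('a ^ 'n) set" where
  "vecs M I \<equiv> (\<lambda>(j, i). M j i) ` I"

section \<open>Change of adapted bases\<close>

lemma triangular_sum:
  fixes u :: "nat \<Rightarrow> 'a::field ^ 'n"
  assumes "c i \<noteq> 0" "w = (\<Sum>l\<le>i. c l *s u l)"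
  shows "w \<in> vec.span (u ` {..i}) \<and> u i \<in> vec.span (insert w (u ` {..<i}))"
proof
  show "w \<in> vec.span (u ` {..i})"
    unfolding assms(2) by (intro vec.span_sum vec.span_scale vec.span_base) auto
  have "w = c i *s u i + (\<Sum>l<i. c l *s u l)"
    unfolding assms(2) by (simp only: lessThan_Suc_atMost[symmetric] sum.lessThan_Suc add.commute)
  then have "u i = (1 / c i) *s (w - (\<Sum>l<i. c l *s u l))"
    using assms(1) by (simp add: vec.scale_right_diff_distrib)
  moreover have "(1 / c i) *s (w - (\<Sum>l<i. c l *s u l)) \<in> vec.span (insert w (u ` {..<i}))"
    by (intro vec.span_scale vec.span_diff vec.span_sum) (auto intro: vec.span_base vec.span_scale)
  ultimately show "u i \<in> vec.span (insert w (u ` {..<i}))" by simp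
qed

text \<open>The hypothesis compares each new vector with the old vectors below it, not with the new
  ones. Replacements at different positions can therefore be checked independently of each
  other.\<close>

lemma triangular_span:
  assumes tri: "\<And>i. i < r \<Longrightarrow> w i \<in> vec.span (u ` {..i}) \<and> u i \<in> vec.span (insert (w i) (u ` {..<i}))"
  shows "i < r \<Longrightarrow> vec.span (w ` {..i}) = vec.span (u ` {..i :: nat})"
proof (induction i rule: less_induct)
  case (less i)
  have prev: "vec.span (w ` {..<i}) = vec.span (u ` {..<i})"
  proof (cases i)
    case (Suc k)
    then show ?thesis using less.IH[of k] less.prems by (simp add: lessThan_Suc_atMost)
  qed simp
  have ins: "v ` {..i} = insert (v i) (v ` {..<i})" for v :: "nat \<Rightarrow> 'a ^ 'b"
    by (auto simp: lessThan_Suc_atMost[symmetric] lessThan_Suc)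
  show ?case
  proof (rule vec.span_eq[THEN iffD2], intro conjI)
    have "u ` {..<i} \<subseteq> vec.span (u ` {..i})" by (auto intro: vec.span_base)
    then have "vec.span (u ` {..<i}) \<subseteq> vec.span (u ` {..i})" by (rule vec.span_minimal) simp
    then show "w ` {..i} \<subseteq> vec.span (u ` {..i})"
      using tri[OF less.prems] vec.span_superset[of "w ` {..<i}"] unfolding ins[of w] prev by auto
    have "vec.span (insert (w i) (u ` {..<i})) \<subseteq> vec.span (w ` {..i})"
    proof (rule vec.span_minimal)
      have "vec.span (w ` {..<i}) \<subseteq> vec.span (w ` {..i})" by (rule vec.span_mono) auto
      then show "insert (w i) (u ` {..<i}) \<subseteq> vec.span (w ` {..i})"
        using vec.span_superset[of "u ` {..<i}"] unfolding prev by (auto intro: vec.span_base)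
    qed simp
    moreover have "u ` {..<i} \<subseteq> vec.span (insert (w i) (u ` {..<i}))" by (auto intro: vec.span_base)
    ultimately show "u ` {..i} \<subseteq> vec.span (w ` {..i})"
      using tri[OF less.prems] unfolding ins[of u] by auto
  qed
qed

text \<open>A matrix need not carry \<open>X\<close> to \<open>M\<close> itself: it may carry it to
  any other basis \<open>C\<close> adapted to the flags of \<open>M\<close>. The normal forms
  consist in choosing \<open>C\<close> so that it satisfies the same relations as
  \<open>X\<close>.\<close>

lemma frame_flags_eqI:
  assumes tri: "\<And>j i. j < m \<Longrightarrow> i < r \<Longrightarrow>
      C j i \<in> vec.span (M j ` {..i}) \<and> M j i \<in> vec.span (insert (C j i) (M j ` {..<i}))"
    and g: "\<And>j i. j < m \<Longrightarrow> i < r \<Longrightarrow> g *v X j i = C j i"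
  shows "frame_flags r m M = frame_flags r m (\<lambda>j i. g *v X j i)"
proof -
  have "vec.span (M j ` {..i}) = vec.span ((\<lambda>i. g *v X j i) ` {..i})" if "j < m" "i < r" for j i
  proof -
    have "(\<lambda>i. g *v X j i) ` {..i} = C j ` {..i}" using g that by (intro image_cong) auto
    then show ?thesis using triangular_span[of r "C j" "M j" i] tri that by simp
  qed
  then show ?thesis by (auto simp: frame_flags_def)
qed

lemma spanning_triangular:
  assumes "spanning M ({..<m} \<times> {..<r})"
    and tri: "\<And>j i. j < m \<Longrightarrow> i < r \<Longrightarrow>
      C j i \<in> vec.span (M j ` {..i}) \<and> M j i \<in> vec.span (insert (C j i) (M j ` {..<i}))"
  shows "spanning C ({..<m} \<times> {..<r})"
proof -
  have "M j i \<in> vec.span (vecs C ({..<m} \<times> {..<r}))" if "j < m" "i < r" for j i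
  proof -
    have "M j i \<in> vec.span (C j ` {..i})"
      using triangular_span[of r "C j" "M j" i] tri that by (auto intro: vec.span_base)
    moreover have "vec.span (C j ` {..i}) \<subseteq> vec.span (vecs C ({..<m} \<times> {..<r}))"
      using that by (intro vec.span_mono) force
    ultimately show ?thesis by blast
  qed
  then have "vecs M ({..<m} \<times> {..<r}) \<subseteq> vec.span (vecs C ({..<m} \<times> {..<r}))" by auto
  then have "vec.span (vecs M ({..<m} \<times> {..<r})) \<subseteq> vec.span (vecs C ({..<m} \<times> {..<r}))"
    by (rule vec.span_minimal) simp
  then show ?thesis using assms(1) by (auto simp: spanning_def)
qed

lemma spanning_mono: "spanning M I \<Longrightarrow> I \<subseteq> J \<Longrightarrow> spanning M J"
  unfolding spanning_def using vec.span_mono[of "vecs M I" "vecs M J"] by blast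

lemma spanning_remove:
  assumes "spanning M J" "M j i \<in> vec.span (vecs M (J - {(j, i)}))"
  shows "spanning M (J - {(j, i)})"
proof -
  have "vecs M J \<subseteq> vec.span (vecs M (J - {(j, i)}))"
  proof
    fix v assume "v \<in> vecs M J"
    then obtain j' i' where "(j', i') \<in> J" "v = M j' i'" by auto
    then show "v \<in> vec.span (vecs M (J - {(j, i)}))"
      using assms(2) by (cases "(j', i') = (j, i)") (auto intro!: vec.span_base)
  qed
  then have "vec.span (vecs M J) \<subseteq> vec.span (vecs M (J - {(j, i)}))" by (rule vec.span_minimal) simp
  then show ?thesis using assms(1) by (auto simp: spanning_def)
qed

section \<open>Linear relations between indexed vectors\<close>

lemma spanning_relation_zero:
  fixes M :: "nat \<Rightarrow> nat \<Rightarrow> 'a::field ^ 'n::finite"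
  assumes "spanning M I" "finite I" "card I = CARD('n)" "(\<Sum>(j, i)\<in>I. c (j, i) *s M j i) = 0" "p \<in> I"
  shows "c p = 0"
proof -
  let ?h = "\<lambda>(j, i). M j i"
  note basis = spanning_basis[OF assms(1-3)]
  let ?f = "\<lambda>v. c (inv_into I ?h v)"
  have "(\<Sum>v\<in>vecs M I. ?f v *s v) = (\<Sum>q\<in>I. ?f (?h q) *s ?h q)"
    by (subst sum.reindex[OF basis(1)]) simp
  also have "\<dots> = (\<Sum>(j, i)\<in>I. c (j, i) *s M j i)"
    by (intro sum.cong) (auto simp: inv_into_f_f[OF basis(1)] split: prod.splits)
  finally have "?f (?h p) = 0"
    using basis(2) assms(2,4,5) unfolding vec.independent_explicit by auto
  then show ?thesis using inv_into_f_f[OF basis(1) assms(5)] by simp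
qed

text \<open>Coefficients belong to index pairs, so two equal vectors at different indices also count
  as a relation.\<close>

lemma ex_relation:
  fixes M :: "nat \<Rightarrow> nat \<Rightarrow> 'a::field ^ 'n::finite"
  assumes "finite J" "card J > CARD('n)"
  shows "\<exists>c. (\<Sum>(j, i)\<in>J. c (j, i) *s M j i) = 0 \<and> (\<exists>p\<in>J. c p \<noteq> 0)"
proof (cases "inj_on (\<lambda>(j, i). M j i) J")
  case True
  let ?h = "\<lambda>(j, i). M j i"
  have "card (vecs M J) > vec.dim (vecs M J)"
    using assms(2) card_image[OF True] vec.dim_subset[of "vecs M J" UNIV] by (simp add: vec_dim_card del: vec.dim_UNIV)
  then have "vec.dependent (vecs M J)" by (intro vec.dependent_biggerset_general) simp
  then obtain f where f: "\<exists>v\<in>vecs M J. f v \<noteq> 0" "(\<Sum>v\<in>vecs M J. f v *s v) = 0"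
    using vec.dependent_finite[OF finite_imageI[OF assms(1)], of "\<lambda>(j, i). M j i"] by blast
  have "(\<Sum>(j, i)\<in>J. f (?h (j, i)) *s M j i) = (\<Sum>v\<in>vecs M J. f v *s v)"
    by (subst sum.reindex[OF True]) (auto intro: sum.cong split: prod.splits)
  then show ?thesis using f by (intro exI[of _ "\<lambda>p. f (?h p)"]) auto
next
  case False
  then obtain a b a' b' where p: "(a, b) \<in> J" "(a', b') \<in> J" "(a, b) \<noteq> (a', b')" "M a b = M a' b'"
    by (auto simp: inj_on_def)
  let ?c = "\<lambda>p. if p = (a, b) then 1 else if p = (a', b') then - 1 else (0 :: 'a)"
  have "(\<Sum>(j, i)\<in>J. ?c (j, i) *s M j i) = (\<Sum>(j, i)\<in>{(a, b), (a', b')}. ?c (j, i) *s M j i)"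
    using p assms(1) by (intro sum.mono_neutral_right) (auto split: if_splits)
  also have "\<dots> = M a b + - M a' b'"
    using p(3) by (subst sum.insert) (auto split: if_splits)
  also have "\<dots> = 0" by (simp add: p(4))
  finally have "(\<Sum>(j, i)\<in>J. ?c (j, i) *s M j i) = 0" .
  moreover have "?c (a, b) \<noteq> 0" by simp
  ultimately show ?thesis using p(1) by (intro exI[of _ ?c] conjI bexI[of _ "(a, b)"])
qed

text \<open>If \<open>c q\<close> were zero, the relation would be one between basis vectors. This
  turns genericity into the nonzero leading coefficients that \<open>triangular_sum\<close>
  requires.\<close>

lemma relation_coeff_nonzero:
  fixes M :: "nat \<Rightarrow> nat \<Rightarrow> 'a::field ^ 'n::finite"
  assumes "(\<Sum>(j, i)\<in>J. c (j, i) *s M j i) = 0" "\<exists>p\<in>J. c p \<noteq> 0" "finite J" "card J = Suc (CARD('n))"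
    and "q \<in> J" "spanning M (J - {q})"
  shows "c q \<noteq> 0"
proof
  assume "c q = 0"
  then have "(\<Sum>(j, i)\<in>J - {q}. c (j, i) *s M j i) = 0"
    using assms(1,3,5) by (subst (asm) sum.remove[of J q]) (auto split: prod.splits)
  then have "c p = 0" if "p \<in> J - {q}" for p
    using spanning_relation_zero[OF assms(6)] that assms(3-5) by auto
  then show False using assms(2) \<open>c q = 0\<close> by auto
qed

lemma ex_spanning:
  assumes "finite I" "card I = CARD('n::finite)"
  shows "\<exists>X :: nat \<Rightarrow> nat \<Rightarrow> 'a::field ^ 'n. spanning X I"
proof -
  obtain \<beta> where \<beta>: "bij_betw \<beta> I (UNIV :: 'n set)"
    using finite_same_card_bij[of I "UNIV :: 'n set"] assms by auto
  let ?X = "\<lambda>j i. axis (\<beta> (j, i)) 1 :: 'a ^ 'n"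
  have "vecs ?X I = (\<lambda>x. axis x 1) ` (\<beta> ` I)" by (auto simp: image_image split: prod.splits)
  also have "\<dots> = cart_basis" using \<beta> by (auto simp: bij_betw_def cart_basis_def)
  finally have "spanning ?X I" by (simp add: spanning_def)
  then show ?thesis by blast
qed

lemma ex_matrix_between:
  fixes X C :: "nat \<Rightarrow> nat \<Rightarrow> 'a::field ^ 'n::finite"
  assumes "finite I" "card I = CARD('n)" "spanning X I" "spanning C I"
  shows "\<exists>g. invertible g \<and> (\<forall>(j, i)\<in>I. g *v X j i = C j i)"
proof -
  let ?h = "\<lambda>(j, i). X j i"
  note basis = spanning_basis[OF assms(3,1,2)]
  obtain f where f: "Vector_Spaces.linear (*s) (*s) f" "\<forall>v\<in>vecs X I. f v = (\<lambda>(j, i). C j i) (inv_into I ?h v)"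
    using vec.linear_independent_extend[OF basis(2), of "\<lambda>v. (\<lambda>(j, i). C j i) (inv_into I ?h v)"] by auto
  have fX: "f (X j i) = C j i" if "(j, i) \<in> I" for j i
    using f(2) that inv_into_f_f[OF basis(1) that] by force
  have "f ` vecs X I = vecs C I" using fX by (auto simp: image_iff) force+
  then have "f ` UNIV = UNIV"
    using vec.linear_span_image[OF f(1), of "vecs X I"] assms(3,4) by (simp add: spanning_def)
  then have "surj ((*v) (matrix f))" using matrix_works[OF f(1)] by auto
  then have "invertible (matrix f)" by (simp add: invertible_right_inverse matrix_right_invertible_surjective)
  then show ?thesis using fX matrix_works[OF f(1)] by (intro exI[of _ "matrix f"]) auto
qed

text \<open>The pairs \<open>(m, i)\<close> stand for auxiliary vectors that complete the \<open>m r\<close> given ones to a basis.\<close>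

lemma dense_independent:
  assumes "m * r \<le> CARD('n::finite)"
  shows "dense_action (PGL :: ('a::alg_closed_field ^ 'n ^ 'n) set monoid) diagonal_act (zariski_topology [1..<Suc r] m)"
proof -
  define I where "I = {..<m} \<times> {..<r} \<union> {m} \<times> {..<CARD('n) - m * r}"
  have I: "finite I" "card I = CARD('n)"
    using assms unfolding I_def by (auto simp: card_cartesian_product intro: card_Un_disjoint[THEN trans])
  obtain X :: "nat \<Rightarrow> nat \<Rightarrow> 'a ^ 'n" where X: "spanning X I" using ex_spanning[OF I] by blast
  show ?thesis
  proof (rule dense_action_criterion[of "{I}" X])
    fix M :: "nat \<Rightarrow> nat \<Rightarrow> 'a ^ 'n" assume M: "\<And>J. J \<in> {I} \<Longrightarrow> spanning M J"
    obtain g where g: "invertible g" "\<forall>(j, i)\<in>I. g *v X j i = M j i"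
      using ex_matrix_between[OF I X M] by auto
    have "frame_flags r m M = frame_flags r m (\<lambda>j i. g *v X j i)"
      by (rule frame_flags_eqI[of m r M]) (use g in \<open>auto simp: I_def intro: vec.span_base\<close>)
    then show "\<exists>g. invertible g \<and> frame_flags r m M = frame_flags r m (\<lambda>j i. g *v X j i)" using g(1) by blast
  qed (use I X in \<open>auto simp: I_def\<close>)
qed

text \<open>Genericity means that the vectors without the last one of any single flag form a basis.
  All last coefficients of the relation are then nonzero, and its part in each flag can replace the
  last vector there.\<close>

lemma dense_one_relation:
  assumes "Suc (CARD('n::finite)) = m * r" "r < CARD('n)"
  shows "dense_action (PGL :: ('a::alg_closed_field ^ 'n ^ 'n) set monoid) diagonal_act (zariski_topology [1..<Suc r] m)"
proof -
  have m: "m \<ge> 2"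
  proof (rule ccontr)
    assume "\<not> m \<ge> 2"
    then have "m = 0 \<or> m = 1" by linarith
    then show False using assms by auto
  qed
  have r: "r > 0" using assms(1) by (cases r) auto
  define T where "T = r - 1"
  have T: "T < r" "{..<r} = {..T}" using r by (auto simp: T_def)
  define J where "J = {..<m} \<times> {..<r}"
  define I where "I j = J - {(j, T)}" for j
  have J: "finite J" "card J = Suc (CARD('n))" using assms(1) by (auto simp: J_def)
  have top: "(j, T) \<in> J" if "j < m" for j using that T by (simp add: J_def)
  have I: "finite (I j)" "card (I j) = CARD('n)" if "j < m" for j
    using top[OF that] J by (auto simp: I_def)
  define l where "l = m - 1"
  have l: "l < m" using m by (simp add: l_def)
  obtain Y :: "nat \<Rightarrow> nat \<Rightarrow> 'a ^ 'n" where Y: "spanning Y (I l)" using ex_spanning[OF I[OF l]] by blast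
  \<comment> \<open>A basis completed by solving the normal relation for the last vector of flag
    \<open>l\<close>.\<close>
  define X where "X j i = (if (j, i) = (l, T) then - (\<Sum>j\<in>{..<m} - {l}. Y j T) else Y j i)" for j i
  have XI: "spanning X (I l)"
  proof -
    have "vecs X (I l) = vecs Y (I l)" by (intro image_cong) (auto simp: X_def I_def split: if_splits)
    then show ?thesis using Y by (simp add: spanning_def)
  qed
  have drop: "spanning Z (I j)" if Z: "spanning Z J" "(\<Sum>j<m. Z j T) = 0" and j: "j < m" for Z :: "nat \<Rightarrow> nat \<Rightarrow> 'a ^ 'n" and j
    unfolding I_def
  proof (rule spanning_remove[OF Z(1)])
    have "Z j T = - (\<Sum>k\<in>{..<m} - {j}. Z k T)"
      using Z(2) j by (simp add: sum.remove[of "{..<m}" j] eq_neg_iff_add_eq_0)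
    moreover have "Z k T \<in> vec.span (vecs Z (J - {(j, T)}))" if "k \<in> {..<m} - {j}" for k
      using that top[of k] by (intro vec.span_base) (force simp: image_iff)
    ultimately show "Z j T \<in> vec.span (vecs Z (J - {(j, T)}))"
      by (simp only:) (intro vec.span_neg vec.span_sum)
  qed
  have X0: "(\<Sum>j<m. X j T) = 0"
    using l by (simp add: sum.remove[of "{..<m}" l] X_def)
  have XJ: "spanning X J" by (rule spanning_mono[OF XI]) (auto simp: I_def)
  show ?thesis
  proof (rule dense_action_criterion[of "I ` {..<m}" X])
    show "finite K \<and> card K = CARD('n) \<and> spanning X K" if "K \<in> I ` {..<m}" for K
      using that I drop[OF XJ X0] by auto
    show "\<exists>K\<in>I ` {..<m}. {j} \<times> {..<r} \<subseteq> K" if "j < m" for j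
    proof -
      obtain k where "k < m" "k \<noteq> j" using m by (metis less_le_trans one_less_numeral_iff pos2 semiring_norm(76) zero_neq_one)
      then show ?thesis using that by (intro bexI[of _ "I k"]) (auto simp: I_def J_def)
    qed
    fix M :: "nat \<Rightarrow> nat \<Rightarrow> 'a ^ 'n" assume M: "\<And>K. K \<in> I ` {..<m} \<Longrightarrow> spanning M K"
    obtain c where c: "(\<Sum>(j, i)\<in>J. c (j, i) *s M j i) = 0" "\<exists>p\<in>J. c p \<noteq> 0"
      using ex_relation[of J M] J by auto
    have cT: "c (j, T) \<noteq> 0" if "j < m" for j
      by (rule relation_coeff_nonzero[OF c J top[OF that]]) (use M that in \<open>auto simp: I_def\<close>)
    define C where "C j i = (if i = T then \<Sum>k\<le>T. c (j, k) *s M j k else M j i)" for j i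
    have tri: "C j i \<in> vec.span (M j ` {..i}) \<and> M j i \<in> vec.span (insert (C j i) (M j ` {..<i}))" if "j < m" "i < r" for j i
    proof (cases "i = T")
      case True
      then show ?thesis using triangular_sum[of "\<lambda>k. c (j, k)" T "C j T" "M j"] cT[OF that(1)] by (simp add: C_def)
    next
      case False
      then show ?thesis by (auto simp: C_def intro: vec.span_base)
    qed
    have CJ: "spanning C J" unfolding J_def
    proof (rule spanning_triangular[OF _ tri])
      show "spanning M ({..<m} \<times> {..<r})" by (rule spanning_mono[of _ "I l"]) (use M l in \<open>auto simp: I_def J_def\<close>)
    qed
    have C0: "(\<Sum>j<m. C j T) = 0"
      using c(1) unfolding J_def T(2) by (simp add: C_def sum.cartesian_product)
    obtain g where g: "invertible g" "\<forall>(j, i)\<in>I l. g *v X j i = C j i"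
      using ex_matrix_between[OF I[OF l] XI drop[OF CJ C0 l]] by blast
    \<comment> \<open>The matrix was chosen on the basis \<open>I l\<close> only; the vector left
      out follows because \<open>X\<close> and \<open>C\<close> satisfy the same relation.\<close>
    have "g *v X l T = C l T"
    proof -
      have "g *v (\<Sum>j<m. X j T) = (\<Sum>j<m. g *v X j T)"
        by (rule vec.linear_sum[OF matrix_vector_mul_linear_gen])
      then have "(\<Sum>j<m. g *v X j T) = (\<Sum>j<m. C j T)" using X0 C0 by simp
      moreover have "(\<Sum>j\<in>{..<m} - {l}. g *v X j T) = (\<Sum>j\<in>{..<m} - {l}. C j T)"
        by (intro sum.cong refl) (use g(2) top in \<open>auto simp: I_def\<close>)
      ultimately show ?thesis using l by (simp add: sum.remove[of "{..<m}" l])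
    qed
    then have "g *v X j i = C j i" if "j < m" "i < r" for j i
      using g(2) that by (cases "(j, i) = (l, T)") (auto simp: I_def J_def)
    then have "frame_flags r m M = frame_flags r m (\<lambda>j i. g *v X j i)"
      by (intro frame_flags_eqI[OF tri])
    then show "\<exists>g. invertible g \<and> frame_flags r m M = frame_flags r m (\<lambda>j i. g *v X j i)" using g(1) by blast
  qed simp
qed

text \<open>Entries \<open>M j i\<close> with \<open>i \<ge> r\<close> lengthen the flags to
  complete ones. Two complete flags in general position meet, in complementary steps, in lines
  \<open>v k\<close>; these are adapted to the first flag and, in reverse order, to the second.
  \<open>I k\<close> expresses transversality of the step of dimension \<open>k\<close> in the first
  flag and that of dimension \<open>n - k\<close> in the second.\<close>

lemma dense_two:
  assumes "r < CARD('n::finite)"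
  shows "dense_action (PGL :: ('a::alg_closed_field ^ 'n ^ 'n) set monoid) diagonal_act (zariski_topology [1..<Suc r] 2)"
proof -
  let ?n = "CARD('n)"
  define I where "I k = {0::nat} \<times> {..<k} \<union> {1} \<times> {..<?n - k}" for k
  have I: "finite (I k)" "card (I k) = ?n" if "k \<le> ?n" for k
  proof -
    have "card (I k) = card ({0::nat} \<times> {..<k}) + card ({1::nat} \<times> {..<?n - k})"
      unfolding I_def by (rule card_Un_disjoint) auto
    then show "card (I k) = ?n" using that by (simp add: card_cartesian_product)
  qed (simp add: I_def)
  obtain Y :: "nat \<Rightarrow> nat \<Rightarrow> 'a ^ 'n" where Y: "spanning Y (I ?n)" using ex_spanning[OF I[OF order_refl]] by blast
  define X where "X j i = (if j = 0 then Y 0 i else Y 0 (?n - 1 - i))" for j i :: nat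
  have two: "j < 2 \<longleftrightarrow> j = 0 \<or> j = 1" for j :: nat by auto
  have XI: "spanning X (I k)" if "k \<le> ?n" for k
  proof -
    have "Y 0 i \<in> vecs X (I k)" if "i < ?n" for i
    proof (cases "i < k")
      case True
      then show ?thesis by (intro image_eqI[of _ _ "(0, i)"]) (auto simp: X_def I_def)
    next
      case False
      then show ?thesis using that \<open>k \<le> ?n\<close> by (intro image_eqI[of _ _ "(1, ?n - 1 - i)"]) (auto simp: X_def I_def)
    qed
    then have "vecs Y (I ?n) \<subseteq> vecs X (I k)" by (auto simp: I_def)
    then show ?thesis using Y vec.span_mono[of "vecs Y (I ?n)" "vecs X (I k)"] by (auto simp: spanning_def)
  qed
  show ?thesis
  proof (rule dense_action_criterion[of "I ` {..?n}" X])
    show "finite K \<and> card K = ?n \<and> spanning X K" if "K \<in> I ` {..?n}" for K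
      using that I XI by auto
    show "\<exists>K\<in>I ` {..?n}. {j} \<times> {..<r} \<subseteq> K" if "j < 2" for j
      using that assms by (intro bexI[of _ "I (if j = 0 then ?n else 0)"]) (auto simp: I_def two)
    fix M :: "nat \<Rightarrow> nat \<Rightarrow> 'a ^ 'n" assume "\<And>K. K \<in> I ` {..?n} \<Longrightarrow> spanning M K"
    then have M: "spanning M (I k)" if "k \<le> ?n" for k using that by blast
    \<comment> \<open>The first \<open>k + 1\<close> vectors of flag 0 and the first
      \<open>n - k\<close> of flag 1 are one too many. Deleting the last vector on either side
      leaves the basis \<open>I k\<close> or \<open>I (Suc k)\<close>, so both leading coefficients
      are nonzero, and either half of the relation gives \<open>v k\<close> up to sign.\<close>
    have "\<forall>k\<in>{..<?n}. \<exists>c. (\<Sum>(j, i)\<in>insert (0, k) (I k). c (j, i) *s M j i) = 0 \<and> c (0, k) \<noteq> 0 \<and> c (1, ?n - 1 - k) \<noteq> 0"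
    proof
      fix k assume "k \<in> {..<?n}"
      then have k: "k < ?n" by simp
      let ?J = "insert (0, k) (I k)"
      have J: "finite ?J" "card ?J = Suc ?n" using I[of k] k by (auto simp: I_def)
      obtain c where c: "(\<Sum>(j, i)\<in>?J. c (j, i) *s M j i) = 0" "\<exists>p\<in>?J. c p \<noteq> 0"
        using ex_relation[of ?J M] J by auto
      have "?J - {(0, k)} = I k" "?J - {(1, ?n - 1 - k)} = I (Suc k)" using k by (auto simp: I_def)
      then have "c (0, k) \<noteq> 0" "c (1, ?n - 1 - k) \<noteq> 0"
        using relation_coeff_nonzero[OF c J, of "(0, k)"] relation_coeff_nonzero[OF c J, of "(1, ?n - 1 - k)"] M k
        by (auto simp: I_def)
      with c(1) show "\<exists>c. (\<Sum>(j, i)\<in>?J. c (j, i) *s M j i) = 0 \<and> c (0, k) \<noteq> 0 \<and> c (1, ?n - 1 - k) \<noteq> 0"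
        by blast
    qed
    from bchoice[OF this] obtain c where c: "\<And>k. k < ?n \<Longrightarrow> (\<Sum>(j, i)\<in>insert (0, k) (I k). c k (j, i) *s M j i) = 0"
        "\<And>k. k < ?n \<Longrightarrow> c k (0, k) \<noteq> 0" "\<And>k. k < ?n \<Longrightarrow> c k (1, ?n - 1 - k) \<noteq> 0"
      by blast
    define v where "v k = (\<Sum>i\<le>k. c k (0, i) *s M 0 i)" for k
    have v': "v k = (\<Sum>i\<le>?n - 1 - k. (- c k (1, i)) *s M 1 i)" if k: "k < ?n" for k
    proof -
      have "insert (0, k) (I k) = {0} \<times> {..k} \<union> {1} \<times> {..?n - 1 - k}" using k by (auto simp: I_def)
      then have "(\<Sum>(j, i)\<in>{0} \<times> {..k} \<union> {1} \<times> {..?n - 1 - k}. c k (j, i) *s M j i) = 0" using c(1)[OF k] by simp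
      moreover have "(\<Sum>(j, i)\<in>{0} \<times> {..k} \<union> {1} \<times> {..?n - 1 - k}. c k (j, i) *s M j i) =
        (\<Sum>(j, i)\<in>{0} \<times> {..k}. c k (j, i) *s M j i) + (\<Sum>(j, i)\<in>{1} \<times> {..?n - 1 - k}. c k (j, i) *s M j i)"
        by (rule sum.union_disjoint) auto
      ultimately show ?thesis
        by (simp add: v_def eq_neg_iff_add_eq_0 sum_negf flip: sum.cartesian_product)
    qed
    define C where "C j i = (if j = 0 then v i else v (?n - 1 - i))" for j i :: nat
    have tri0: "C 0 i \<in> vec.span (M 0 ` {..i}) \<and> M 0 i \<in> vec.span (insert (C 0 i) (M 0 ` {..<i}))" if "i < ?n" for i
      using triangular_sum[of "\<lambda>k. c i (0, k)" i "v i" "M 0"] c(2)[OF that] by (simp add: C_def v_def)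
    have tri1: "C 1 i \<in> vec.span (M 1 ` {..i}) \<and> M 1 i \<in> vec.span (insert (C 1 i) (M 1 ` {..<i}))" if i: "i < ?n" for i
    proof -
      let ?k = "?n - 1 - i"
      have k: "?k < ?n" "?n - 1 - ?k = i" using i by auto
      show ?thesis
        using triangular_sum[of "\<lambda>k. - c ?k (1, k)" i "v ?k" "M 1"] c(3)[OF k(1)] v'[OF k(1)] k(2) by (simp add: C_def)
    qed
    have CI: "spanning C (I ?n)"
    proof -
      have e: "I ?n = {..<1} \<times> {..<?n}" by (auto simp: I_def)
      show ?thesis unfolding e by (rule spanning_triangular[of M]) (use M[of ?n] tri0 in \<open>auto simp: e\<close>)
    qed
    obtain g where g: "invertible g" "\<forall>(j, i)\<in>I ?n. g *v X j i = C j i"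
      using ex_matrix_between[OF I[OF order_refl] XI[OF order_refl] CI] by blast
    have gX: "g *v X j i = C j i" if "j < 2" "i < r" for j i
    proof -
      have "g *v Y 0 i = v i" if "i < ?n" for i
        using g(2) that by (auto simp: I_def X_def C_def)
      then show ?thesis using that assms by (auto simp: X_def C_def two)
    qed
    have "frame_flags r 2 M = frame_flags r 2 (\<lambda>j i. g *v X j i)"
      by (rule frame_flags_eqI[of 2 r C M, OF _ gX]) (use tri0 tri1 assms in \<open>auto simp: two\<close>)
    then show "\<exists>g. invertible g \<and> frame_flags r 2 M = frame_flags r 2 (\<lambda>j i. g *v X j i)" using g(1) by blast
  qed simp
qed

text \<open>With two vectors too many the relations form a plane; the condition at \<open>q\<close>
  cuts out a line in it, and the value \<open>t\<close> at \<open>b\<close> fixes a point on this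
  line.\<close>

lemma ex_relation_avoiding:
  fixes M :: "nat \<Rightarrow> nat \<Rightarrow> 'a::field ^ 'n::finite"
  assumes "finite J" "card J = CARD('n) + 2" "q \<in> J" "b \<in> J - {q}" "spanning M (J - {q} - {b})"
  shows "\<exists>c. (\<Sum>(j, i)\<in>J. c (j, i) *s M j i) = 0 \<and> c q = 0 \<and> c b = t \<and>
    (t \<noteq> 0 \<longrightarrow> (\<forall>a\<in>J - {q}. spanning M (J - {q} - {a}) \<longrightarrow> c a \<noteq> 0))"
proof -
  have J: "finite (J - {q})" "card (J - {q}) = Suc (CARD('n))" using assms(1-3) by auto
  obtain c where c: "(\<Sum>(j, i)\<in>J - {q}. c (j, i) *s M j i) = 0" "\<exists>p\<in>J - {q}. c p \<noteq> 0"
    using ex_relation[of "J - {q}" M] J by auto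
  note nz = relation_coeff_nonzero[OF c J]
  define d where "d p = (if p = q then 0 else (t / c b) * c p)" for p
  have "(\<Sum>(j, i)\<in>J. d (j, i) *s M j i) = (\<Sum>(j, i)\<in>J - {q}. d (j, i) *s M j i)"
    using assms(1) by (intro sum.mono_neutral_right) (auto simp: d_def)
  also have "\<dots> = (\<Sum>(j, i)\<in>J - {q}. (t / c b) *s (c (j, i) *s M j i))"
    by (intro sum.cong) (auto simp: d_def)
  also have "\<dots> = (t / c b) *s (\<Sum>(j, i)\<in>J - {q}. c (j, i) *s M j i)"
    by (simp add: vec.scale_sum_right split_def)
  also have "\<dots> = 0" by (simp add: c(1))
  finally have "(\<Sum>(j, i)\<in>J. d (j, i) *s M j i) = 0" .
  moreover have "d q = 0" by (simp add: d_def)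
  moreover have "c b \<noteq> 0" using nz[OF assms(4,5)] .
  then have "d b = t" using assms(4) by (simp add: d_def)
  moreover have "d a \<noteq> 0" if "t \<noteq> 0" "a \<in> J - {q}" "spanning M (J - {q} - {a})" for a
    using nz[OF that(2,3)] \<open>c b \<noteq> 0\<close> that by (simp add: d_def)
  ultimately show ?thesis by (intro exI[of _ d] conjI impI ballI)
qed

lemma span_of_sum_eq_0:
  fixes x :: "'a::field ^ 'n"
  assumes "x + y = 0" "y \<in> vec.span B"
  shows "x \<in> vec.span B"
proof -
  have "x = - y" using assms(1) by (simp add: eq_neg_iff_add_eq_0)
  then show ?thesis using vec.span_neg[OF assms(2)] by simp
qed

text \<open>Let \<open>p j\<close>, \<open>q j\<close> be the last two vectors of the \<open>j\<close>-th flag. The lines in which the plane of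
  relations meets the subspaces of dimension \<open>r - 1\<close> are spanned by \<open>c\<close>, \<open>d\<close> and \<open>f = c + d\<close>; in the
  bases read off from them the relations become \<open>p 0 + q 1 + q 2 = 0\<close> and
  \<open>q 0 + p 1 + p 2 - q 2 = 0\<close>.\<close>

lemma dense_two_relations:
  assumes "CARD('n::finite) + 2 = 3 * r" "r > 1"
  shows "dense_action (PGL :: ('a::alg_closed_field ^ 'n ^ 'n) set monoid) diagonal_act (zariski_topology [1..<Suc r] 3)"
proof -
  define T where "T = r - 1"
  define S where "S = r - 2"
  have TS: "T = Suc S" "r = Suc T" using assms(2) by (auto simp: T_def S_def)
  have three: "j < 3 \<longleftrightarrow> j = 0 \<or> j = 1 \<or> j = 2" for j :: nat by auto
  have l3: "{..<3} = {0, 1, 2 :: nat}" by auto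
  define J where "J = {..<3::nat} \<times> {..<r}"
  have J: "finite J" "card J = CARD('n) + 2" using assms(1) by (auto simp: J_def card_cartesian_product)
  have inJ: "(0, S) \<in> J" "(0, T) \<in> J" "(1, S) \<in> J" "(1, T) \<in> J" "(2, S) \<in> J" "(2, T) \<in> J"
    by (auto simp: J_def TS)
  have ST: "S \<noteq> T" by (simp add: TS)
  \<comment> \<open>The first three sets omit both top vectors of one flag and will give the
    coefficients at \<open>S\<close>; the other three omit the last vectors of two flags and give
    those at \<open>T\<close>.\<close>
  define \<I> where "\<I> = {J - {(0, T)} - {(0, S)}, J - {(1, T)} - {(1, S)}, J - {(2, T)} - {(2, S)},
    J - {(0, T)} - {(1, T)}, J - {(0, T)} - {(2, T)}, J - {(1, T)} - {(2, T)}}"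
  let ?I = "J - {(0, T)} - {(2, T)}"
  have card_I: "finite K \<and> card K = CARD('n)" if "K \<in> \<I>" for K
    using that J inJ ST unfolding \<I>_def by (elim insertE emptyE) auto
  have IK: "?I \<in> \<I>" by (simp add: \<I>_def)
  have comm: "J - {p} - {q} = J - {q} - {p}" for p q by auto
  \<comment> \<open>Two vectors are removed in turn, each solved for by one of the relations. The
    order and the relation are chosen so that the second step does not use the vector already
    removed; hence \<open>comm\<close>, and two ways of solving for \<open>Z 2 T\<close>.\<close>
  have drop: "spanning Z K" if Z: "spanning Z J" "Z 0 S + Z 1 T + Z 2 T = 0" "Z 0 T + Z 1 S + Z 2 S - Z 2 T = 0"
      and K: "K \<in> \<I>" for Z :: "nat \<Rightarrow> nat \<Rightarrow> 'a ^ 'n" and K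
  proof -
    have mem: "Z j i \<in> vec.span (vecs Z A)" if "(j, i) \<in> A" for j i A
      using that by (intro vec.span_base) (force simp: image_iff)
    have S0: "Z 0 S \<in> vec.span (vecs Z A)" if "(1, T) \<in> A" "(2, T) \<in> A" for A
      by (rule span_of_sum_eq_0[of _ "Z 1 T + Z 2 T"]) (use Z(2) that in \<open>auto simp: ac_simps intro!: vec.span_add mem\<close>)
    have T1: "Z 1 T \<in> vec.span (vecs Z A)" if "(0, S) \<in> A" "(2, T) \<in> A" for A
      by (rule span_of_sum_eq_0[of _ "Z 0 S + Z 2 T"]) (use Z(2) that in \<open>auto simp: ac_simps intro!: vec.span_add mem\<close>)
    have T2: "Z 2 T \<in> vec.span (vecs Z A)" if "(0, S) \<in> A" "(1, T) \<in> A" for A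
      by (rule span_of_sum_eq_0[of _ "Z 0 S + Z 1 T"]) (use Z(2) that in \<open>auto simp: ac_simps intro!: vec.span_add mem\<close>)
    have T0: "Z 0 T \<in> vec.span (vecs Z A)" if "(1, S) \<in> A" "(2, S) \<in> A" "(2, T) \<in> A" for A
      by (rule span_of_sum_eq_0[of _ "Z 1 S + Z 2 S - Z 2 T"]) (use Z(3) that in \<open>auto simp: algebra_simps intro!: vec.span_add vec.span_diff mem\<close>)
    have S1: "Z 1 S \<in> vec.span (vecs Z A)" if "(0, T) \<in> A" "(2, S) \<in> A" "(2, T) \<in> A" for A
      by (rule span_of_sum_eq_0[of _ "Z 0 T + Z 2 S - Z 2 T"]) (use Z(3) that in \<open>auto simp: algebra_simps intro!: vec.span_add vec.span_diff mem\<close>)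
    have S2: "Z 2 S \<in> vec.span (vecs Z A)" if "(0, T) \<in> A" "(1, S) \<in> A" "(2, T) \<in> A" for A
      by (rule span_of_sum_eq_0[of _ "Z 0 T + Z 1 S - Z 2 T"]) (use Z(3) that in \<open>auto simp: algebra_simps intro!: vec.span_add vec.span_diff mem\<close>)
    have T2': "Z 2 T \<in> vec.span (vecs Z A)" if "(0, T) \<in> A" "(1, S) \<in> A" "(2, S) \<in> A" for A
    proof -
      have "Z 2 T = Z 0 T + Z 1 S + Z 2 S" using Z(3) by simp
      then show ?thesis using that by (simp only:) (intro vec.span_add mem)
    qed
    have "spanning Z (J - {(0, S)} - {(0, T)})"
      by (rule spanning_remove[OF spanning_remove[OF Z(1) S0] T0]) (use inJ ST in simp_all)
    moreover have "spanning Z (J - {(1, S)} - {(1, T)})"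
      by (rule spanning_remove[OF spanning_remove[OF Z(1) S1] T1]) (use inJ ST in simp_all)
    moreover have "spanning Z (J - {(2, S)} - {(2, T)})"
      by (rule spanning_remove[OF spanning_remove[OF Z(1) S2] T2]) (use inJ ST in simp_all)
    moreover have "spanning Z (J - {(0, T)} - {(1, T)})"
      by (rule spanning_remove[OF spanning_remove[OF Z(1) T0] T1]) (use inJ ST in simp_all)
    moreover have "spanning Z (J - {(0, T)} - {(2, T)})"
      by (rule spanning_remove[OF spanning_remove[OF Z(1) T0] T2]) (use inJ ST in simp_all)
    moreover have "spanning Z (J - {(1, T)} - {(2, T)})"
      by (rule spanning_remove[OF spanning_remove[OF Z(1) T1] T2']) (use inJ ST in simp_all)
    ultimately show ?thesis
      using K unfolding \<I>_def comm[of "(0, T)" "(0, S)"] comm[of "(1, T)" "(1, S)"] comm[of "(2, T)" "(2, S)"]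
      by (elim insertE emptyE) (simp_all only:)
  qed
  obtain Y :: "nat \<Rightarrow> nat \<Rightarrow> 'a ^ 'n" where Y: "spanning Y ?I"
    using ex_spanning[of ?I] card_I[OF IK] by blast
  \<comment> \<open>The two normal relations solved for the last vectors of the flags 2 and
    0.\<close>
  define X where "X j i = (if (j, i) = (2, T) then - Y 0 S - Y 1 T
      else if (j, i) = (0, T) then - Y 1 S - Y 2 S - Y 0 S - Y 1 T else Y j i)" for j i
  have XI: "spanning X ?I"
  proof -
    have "vecs X ?I = vecs Y ?I" by (intro image_cong) (auto simp: X_def split: if_splits)
    then show ?thesis using Y by (simp add: spanning_def)
  qed
  have XJ: "spanning X J" by (rule spanning_mono[OF XI]) auto
  have X1: "X 0 S + X 1 T + X 2 T = 0" and X2: "X 0 T + X 1 S + X 2 S - X 2 T = 0"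
    using ST by (simp_all add: X_def)
  show ?thesis
  proof (rule dense_action_criterion[of \<I> X])
    show "finite K \<and> card K = CARD('n) \<and> spanning X K" if "K \<in> \<I>" for K
      using card_I[OF that] drop[OF XJ X1 X2 that] by blast
    show "\<exists>K\<in>\<I>. {j} \<times> {..<r} \<subseteq> K" if "j < 3" for j
    proof (cases "j = 0")
      case True
      then show ?thesis by (intro bexI[of _ "J - {(1, T)} - {(1, S)}"]) (auto simp: \<I>_def J_def)
    next
      case False
      then show ?thesis using that by (intro bexI[of _ "J - {(0, T)} - {(0, S)}"]) (auto simp: \<I>_def J_def)
    qed
    fix M :: "nat \<Rightarrow> nat \<Rightarrow> 'a ^ 'n" assume M: "\<And>K. K \<in> \<I> \<Longrightarrow> spanning M K"
    have sp: "spanning M (J - {(0, T)} - {(0, S)})" "spanning M (J - {(1, T)} - {(1, S)})" "spanning M (J - {(2, T)} - {(2, S)})"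
        "spanning M (J - {(0, T)} - {(1, T)})" "spanning M (J - {(0, T)} - {(2, T)})" "spanning M (J - {(1, T)} - {(2, T)})"
      by (rule M, simp add: \<I>_def)+
    have sp': "spanning M (J - {(1, T)} - {(0, T)})" using sp(4) by (subst comm)
    \<comment> \<open>\<open>c\<close> vanishes at the last vector of flag 0 and \<open>d\<close> at
      that of flag 1. Their values 1 and -1 at the last vector of flag 2 are opposite so that
      \<open>f\<close> vanishes there.\<close>
    obtain c where c: "(\<Sum>(j, i)\<in>J. c (j, i) *s M j i) = 0" "c (0, T) = 0" "c (2, T) = 1"
      "\<forall>a\<in>J - {(0, T)}. spanning M (J - {(0, T)} - {a}) \<longrightarrow> c a \<noteq> 0"
      using ex_relation_avoiding[OF J inJ(2) _ sp(5), of 1] inJ by auto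
    obtain d where d: "(\<Sum>(j, i)\<in>J. d (j, i) *s M j i) = 0" "d (1, T) = 0" "d (2, T) = - 1"
      "\<forall>a\<in>J - {(1, T)}. spanning M (J - {(1, T)} - {a}) \<longrightarrow> d a \<noteq> 0"
      using ex_relation_avoiding[OF J inJ(4) _ sp(6), of "- 1"] inJ by auto
    define f where "f p = c p + d p" for p
    have nz: "c (0, S) \<noteq> 0" "c (1, T) \<noteq> 0" "d (1, S) \<noteq> 0" "d (0, T) \<noteq> 0"
      using c(4) d(4) sp sp' inJ ST by auto
    have f0: "(\<Sum>(j, i)\<in>J. f (j, i) *s M j i) = 0"
      using c(1) d(1) by (simp add: f_def vec.scale_left_distrib sum.distrib split_def)
    have f2: "f (2, T) = 0" by (simp add: f_def c(3) d(3))
    have fS: "f (2, S) \<noteq> 0"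
    proof (rule relation_coeff_nonzero)
      show "(\<Sum>(j, i)\<in>J - {(2, T)}. f (j, i) *s M j i) = 0"
        using f0 f2 J(1) inJ(6) by (simp add: sum.remove[of J "(2, T)"])
      show "\<exists>p\<in>J - {(2, T)}. f p \<noteq> 0"
        using nz(4) c(2) inJ by (intro bexI[of _ "(0, T)"]) (auto simp: f_def)
    qed (use J inJ ST sp(3) in auto)
    define blk where "blk x j = (\<Sum>i\<le>T. x (j, i) *s M j i)" for x :: "nat \<times> nat \<Rightarrow> 'a" and j
    have blk_sum: "blk x 0 + blk x 1 + blk x 2 = 0" if "(\<Sum>(j, i)\<in>J. x (j, i) *s M j i) = 0" for x
    proof -
      have "(\<Sum>j<3. blk x j) = 0"
        using that by (simp add: blk_def J_def TS(2) lessThan_Suc_atMost sum.cartesian_product)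
      then show ?thesis by (simp add: l3 add.assoc)
    qed
    have blk_S: "blk x j = (\<Sum>i\<le>S. x (j, i) *s M j i)" if "x (j, T) = 0" for x j
      using that by (simp add: blk_def TS(1))
    have blk_f: "blk f j = blk c j + blk d j" for j
      by (simp add: blk_def f_def vec.scale_left_distrib sum.distrib)
    \<comment> \<open>In each flag, the relation without last coefficient supplies the vector at
      \<open>S\<close>, another one that at \<open>T\<close>. In flag 2, \<open>blk d 2\<close>
      equals \<open>C 2 S - C 2 T\<close>; this is the origin of the minus sign in the second normal
      relation.\<close>
    define C where "C j i = (if i = T then if j = 0 then blk d 0 else blk c j
      else if i = S then if j = 0 then blk c 0 else if j = 1 then blk d 1 else blk f 2 else M j i)" for j i
    have tri: "C j i \<in> vec.span (M j ` {..i}) \<and> M j i \<in> vec.span (insert (C j i) (M j ` {..<i}))" if "j < 3" "i < r" for j i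
    proof -
      have top: "blk x j \<in> vec.span (M j ` {..T}) \<and> M j T \<in> vec.span (insert (blk x j) (M j ` {..<T}))"
        if "x (j, T) \<noteq> 0" for x
        using triangular_sum[of "\<lambda>i. x (j, i)" T "blk x j" "M j"] that by (simp add: blk_def)
      have below: "blk x j \<in> vec.span (M j ` {..S}) \<and> M j S \<in> vec.span (insert (blk x j) (M j ` {..<S}))"
        if "x (j, T) = 0" "x (j, S) \<noteq> 0" for x
        using triangular_sum[of "\<lambda>i. x (j, i)" S "blk x j" "M j"] that by (simp add: blk_S)
      consider "i = T" | "i = S" | "i \<noteq> T" "i \<noteq> S" by blast
      then show ?thesis
      proof cases
        case 1
        then show ?thesis using top[of d] top[of c] nz c(3) \<open>j < 3\<close> by (auto simp: C_def three)
      next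
        case 2
        then show ?thesis using below[of c] below[of d] below[of f] nz c(2) d(2) f2 fS \<open>j < 3\<close> ST
          by (auto simp: C_def three)
      next
        case 3
        then show ?thesis by (auto simp: C_def intro: vec.span_base)
      qed
    qed
    have CJ: "spanning C J" unfolding J_def
    proof (rule spanning_triangular[OF _ tri])
      show "spanning M ({..<3} \<times> {..<r})" by (rule spanning_mono[OF sp(1)]) (auto simp: J_def)
    qed
    have C1: "C 0 S + C 1 T + C 2 T = 0"
      using blk_sum[OF c(1)] ST by (simp add: C_def)
    have C2: "C 0 T + C 1 S + C 2 S - C 2 T = 0"
      using blk_sum[OF d(1)] ST by (simp add: C_def blk_f add.assoc)
    obtain g where g: "invertible g" "\<forall>(j, i)\<in>?I. g *v X j i = C j i"
      using ex_matrix_between[OF _ _ XI drop[OF CJ C1 C2 IK]] card_I[OF IK] by blast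
    have gI: "g *v X 0 S = C 0 S" "g *v X 1 T = C 1 T" "g *v X 1 S = C 1 S" "g *v X 2 S = C 2 S"
      using g(2) inJ ST by auto
    have "C 0 S + C 1 T + g *v X 2 T = g *v (X 0 S + X 1 T + X 2 T)"
      by (simp only: matrix_vector_right_distrib gI)
    also have "\<dots> = C 0 S + C 1 T + C 2 T" by (simp only: X1 C1 matrix_vector_mult_0_right)
    finally have g2: "g *v X 2 T = C 2 T" by (rule add_left_imp_eq)
    have "g *v X 0 T + C 1 S + C 2 S - C 2 T = g *v (X 0 T + X 1 S + X 2 S - X 2 T)"
      by (simp only: matrix_vector_right_distrib matrix_vector_mult_diff_distrib gI g2)
    also have "\<dots> = C 0 T + C 1 S + C 2 S - C 2 T" by (simp only: X2 C2 matrix_vector_mult_0_right)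
    finally have g0: "g *v X 0 T = C 0 T" by simp
    have "g *v X j i = C j i" if "j < 3" "i < r" for j i
    proof (cases "(j, i) \<in> ?I")
      case True
      then show ?thesis using g(2) by blast
    next
      case False
      then have "(j, i) = (0, T) \<or> (j, i) = (2, T)" using that by (auto simp: J_def)
      then show ?thesis using g0 g2 by auto
    qed
    then have "frame_flags r 3 M = frame_flags r 3 (\<lambda>j i. g *v X j i)"
      by (intro frame_flags_eqI[OF tri])
    then show "\<exists>g. invertible g \<and> frame_flags r 3 M = frame_flags r 3 (\<lambda>j i. g *v X j i)" using g(1) by blast
  qed (simp add: \<I>_def)
qed

theorem theorem3p1:
  fixes r n m :: nat
  assumes "r > 0" and "n > 0" and "m > 0" and "r < n" and "CARD('n::finite) = n"
  shows "dense_action (PGL :: ('a::alg_closed_field ^ 'n ^ 'n) set monoid)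
           diagonal_act (zariski_topology [1..<Suc r] m) \<longleftrightarrow>
         (m \<le> 2 \<or>
          r = 1 \<and> n \<ge> m - 1 \<or>
          m = 3 \<and> r > 1 \<and> n \<ge> 3 * r - 2 \<or>
          m > 3 \<and> r > 1 \<and> n \<ge> m * r - 1)"
proof -
  let ?dense = "dense_action (PGL :: ('a ^ 'n ^ 'n) set monoid) diagonal_act (zariski_topology [1..<Suc r] m)"
  \<comment> \<open>This settles \<open>m = 1\<close> and all dense cases with
    \<open>m \<ge> 4\<close>; for \<open>m = 3\<close> only the boundary
    \<open>3 * r = n + 2\<close> remains.\<close>
  have large: ?dense if "m * r \<le> Suc n"
  proof (cases "m * r = Suc n")
    case True
    then show ?thesis using dense_one_relation[of m r, where 'n = 'n and 'a = 'a] assms(4,5) by simp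
  next
    case False
    then show ?thesis using dense_independent[of m r, where 'n = 'n and 'a = 'a] that assms(5) by simp
  qed
  consider "m = 1" | "m = 2" | "m = 3" | "m \<ge> 4" using assms(3) by linarith
  then show ?thesis
  proof cases
    case 1
    then show ?thesis using large assms(4) by simp
  next
    case 2
    then show ?thesis using dense_two[of r, where 'n = 'n and 'a = 'a] assms(4,5) by simp
  next
    case 3
    show ?thesis
    proof (cases "3 * r \<le> n + 2")
      case True
      have ?dense
      proof (cases "3 * r = n + 2")
        case eq: True
        show ?thesis
        proof (cases "r = 1")
          case True
          then show ?thesis using eq assms(4) by simp
        next
          case False
          then show ?thesis using dense_two_relations[of r, where 'n = 'n and 'a = 'a] eq 3 assms(1,5) by simp
        qed
      next
        case False
        then show ?thesis using large True 3 by simp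
      qed
      moreover have "r = 1 \<and> n \<ge> m - 1 \<or> r > 1 \<and> n \<ge> 3 * r - 2"
        using True 3 assms(1,4) by (cases "r = 1") auto
      ultimately show ?thesis using 3 by blast
    next
      case False
      then have "r > 1" using assms(1,4) by (cases "r = 1") auto
      then have "\<not> ?dense" using sparse_three[of r, where 'n = 'n and 'a = 'a] False 3 assms(4,5) by simp
      moreover have "\<not> n \<ge> 3 * r - 2" using False by simp
      ultimately show ?thesis using 3 \<open>r > 1\<close> by simp
    qed
  next
    case 4
    have "?dense \<longleftrightarrow> m * r \<le> Suc n"
      using large sparse_four[of m r, where 'n = 'n and 'a = 'a] 4 assms(1,4,5) by (cases "m * r \<le> Suc n") auto
    \<comment> \<open>For \<open>r = 1\<close> this bound reads \<open>n \<ge> m - 1\<close>, so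
      conditions (2) and (4) are instances of one inequality.\<close>
    moreover have "m * r \<le> Suc n \<longleftrightarrow> n \<ge> m * r - 1" by linarith
    ultimately show ?thesis using 4 assms(1) by (cases "r = 1") auto
  qed
qed

end
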